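(* Let $q$ be a power of a prime $p$, let $n\geq 2$, and let $X=\{F=0\}\subset\mathbb{P}^n$ be a smooth Frobenius nonclassical hypersurface over $\mathbb{F}_q$ of degree $d\geq 2$. Then $d\leq q+2$, and moreover: (1) $d=q+1$ and $n$ is odd if and only if there exists a nondegenerate skew-symmetric $(n+1)\times(n+1)$ matrix $(A_{ij})$ with entries in $\mathbb{F}_q$ and zero diagonal such that $F=\sum_{i,j=0}^n x_i^qA_{ij}x_j$. (2) $d=q+1$ and $n$ is even if and only if $p=2$ and, up to the action of $\mathrm{PGL}_{n+1}(\mathbb{F}_q)$ on coordinates, $F_{1,0}=x_0^{q-1}F$ and $F=x_0G+\sum_{i,j=1}^n x_i^qB_{ij}x_j$, where $G$ is a polynomial with $\frac{\partial G}{\partial x_0}=0$ and $(B_{ij})_{1\leq i,j\leq n}$ is a nondegenerate skew-symmetric matrix with entries in $\mathbb{F}_q$ and zero diagonal. (3) $d=q+2$ if and only if $p=n=2$ and, after rescaling $F$ by a nonzero constant, $F=x_0x_1x_2(x_0^{q-1}+x_1^{q-1}+x_2^{q-1})+G(x_0^2,x_1^2,x_2^2)$ for some polynomial $G$. Furthermore, condition (1) or condition (3) occurs if and only if $F_{1,0}$ is the zero polynomial.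
   Context: A hypersurface $X=\{F=0\}\subset\mathbb{P}^n$ over $\mathbb{F}_q$ is given by a nonzero homogeneous polynomial $F\in\mathbb{F}_q[x_0,\dots,x_n]$. Define $F_{1,0}:=\sum_{i=0}^n x_i^q\frac{\partial F}{\partial x_i}$. $X$ is called Frobenius nonclassical (over $\mathbb{F}_q$) if $F$ divides $F_{1,0}$; equivalently, the $q$-th Frobenius map sends every $\overline{\mathbb{F}_q}$-point $P\in X$ into the embedded tangent space $T_PX$. *)

theory Defs
  imports "HOL-Library.Poly_Mapping" "HOL-Library.Cardinality" "HOL-Algebra.Algebraic_Closure_Type"
begin

text \<open>Multivariate polynomials over a coefficient ring, in variables x_0, x_1, ... :
  a finitely supported map from monomials (exponent vectors) to coefficients.\<close>

type_synonym 'a mpoly = "(nat \<Rightarrow>\<^sub>0 nat) \<Rightarrow>\<^sub>0 'a"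

definition mvar :: "nat \<Rightarrow> 'a::comm_ring_1 mpoly" where
  "mvar i = Poly_Mapping.single (Poly_Mapping.single i 1) 1"

definition mconst :: "'a::comm_ring_1 \<Rightarrow> 'a mpoly" where
  "mconst c = Poly_Mapping.single 0 c"

definition in_vars :: "nat \<Rightarrow> 'a::comm_ring_1 mpoly \<Rightarrow> bool" where
  "in_vars n F \<longleftrightarrow> (\<forall>m\<in>Poly_Mapping.keys F. \<forall>i\<in>Poly_Mapping.keys m. i \<le> n)"

definition homogeneous :: "nat \<Rightarrow> 'a::comm_ring_1 mpoly \<Rightarrow> bool" where
  "homogeneous d F \<longleftrightarrow> (\<forall>m\<in>Poly_Mapping.keys F. (\<Sum>i\<in>Poly_Mapping.keys m. Poly_Mapping.lookup m i) = d)"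

definition mpderiv :: "nat \<Rightarrow> 'a::comm_ring_1 mpoly \<Rightarrow> 'a mpoly" where
  "mpderiv i F = (\<Sum>m\<in>Poly_Mapping.keys F.
     Poly_Mapping.single (Poly_Mapping.update i (Poly_Mapping.lookup m i - 1) m)
       (of_nat (Poly_Mapping.lookup m i) * Poly_Mapping.lookup F m))"

definition msubst :: "(nat \<Rightarrow> 'a::comm_ring_1 mpoly) \<Rightarrow> 'a mpoly \<Rightarrow> 'a mpoly" where
  "msubst \<sigma> F = (\<Sum>m\<in>Poly_Mapping.keys F. mconst (Poly_Mapping.lookup F m) * (\<Prod>i\<in>Poly_Mapping.keys m. \<sigma> i ^ Poly_Mapping.lookup m i))"

definition meval :: "(nat \<Rightarrow> 'a::comm_ring_1) \<Rightarrow> 'a mpoly \<Rightarrow> 'a" where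
  "meval x F = (\<Sum>m\<in>Poly_Mapping.keys F. Poly_Mapping.lookup F m * (\<Prod>i\<in>Poly_Mapping.keys m. x i ^ Poly_Mapping.lookup m i))"

definition F10 :: "nat \<Rightarrow> nat \<Rightarrow> 'a::comm_ring_1 mpoly \<Rightarrow> 'a mpoly" where
  "F10 q n F = (\<Sum>i\<le>n. mvar i ^ q * mpderiv i F)"

definition frobenius_nonclassical :: "nat \<Rightarrow> nat \<Rightarrow> 'a::comm_ring_1 mpoly \<Rightarrow> bool" where
  "frobenius_nonclassical q n F \<longleftrightarrow> F dvd F10 q n F"

definition smooth_hypersurface :: "nat \<Rightarrow> 'a::field mpoly \<Rightarrow> bool" where
  "smooth_hypersurface n F \<longleftrightarrow>
     \<not> (\<exists>x :: nat \<Rightarrow> 'a alg_closure. (\<exists>i\<le>n. x i \<noteq> 0) \<and>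
          meval x (Poly_Mapping.map to_ac F) = 0 \<and>
          (\<forall>i\<le>n. meval x (mpderiv i (Poly_Mapping.map to_ac F)) = 0))"

definition nondegenerate_on :: "nat set \<Rightarrow> (nat \<Rightarrow> nat \<Rightarrow> 'a::field) \<Rightarrow> bool" where
  "nondegenerate_on I A \<longleftrightarrow>
     (\<forall>v. (\<forall>i\<in>I. (\<Sum>j\<in>I. A i j * v j) = 0) \<longrightarrow> (\<forall>j\<in>I. v j = 0))"

definition skew_zero_diag_on :: "nat set \<Rightarrow> (nat \<Rightarrow> nat \<Rightarrow> 'a::field) \<Rightarrow> bool" where
  "skew_zero_diag_on I A \<longleftrightarrow>
     (\<forall>i\<in>I. \<forall>j\<in>I. A j i = - A i j) \<and> (\<forall>i\<in>I. A i i = 0)"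

definition lin_change :: "nat \<Rightarrow> (nat \<Rightarrow> nat \<Rightarrow> 'a::field) \<Rightarrow> 'a mpoly \<Rightarrow> 'a mpoly" where
  "lin_change n M F = msubst (\<lambda>i. \<Sum>j\<le>n. mconst (M i j) * mvar j) F"

end

theory Submission
  imports Defs
begin

text \<open>Write \<open>F\<^sub>i\<close> for the partial derivatives, \<open>F\<^sub>1\<^sub>,\<^sub>0 = F H\<close>, and recall Euler's relation \<open>\<Sum> x\<^sub>i F\<^sub>i = d F\<close>.
  Both are syzygies, and smoothness makes Koszul homology vanish in the relevant degree, so that all
  syzygies of low degree are visible.

  If \<open>p\<close> does not divide \<open>d\<close>, the \<open>F\<^sub>i\<close> have no common zero, hence the relation
  \<open>\<Sum> (d x\<^sub>i\<^sup>q - H x\<^sub>i) F\<^sub>i = 0\<close> is a Koszul relation: \<open>d x\<^sub>i\<^sup>q - H x\<^sub>i = \<Sum> A\<^sub>i\<^sub>j F\<^sub>j\<close> with \<open>A\<close> alternating of degree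
  \<open>q + 1 - d\<close>. So \<open>d \<le> q + 1\<close>, and for \<open>d = q + 1\<close> the matrix \<open>A\<close> is constant. If it is invertible, solving
  for the \<open>F\<^sub>j\<close> yields form (1) and \<open>H = 0\<close>; a kernel vector \<open>v\<close> yields \<open>l\<^sup>q = H l\<close> for \<open>l = \<Sum> v\<^sub>i x\<^sub>i\<close>, that is,
  \<open>H = l\<^bsup>q - 1\<^esup>\<close>, and in coordinates with \<open>l = x\<^sub>0\<close> one obtains form (2).

  If \<open>p\<close> divides \<open>d\<close>, the exterior product of the two syzygies is a Koszul 2-cycle for \<open>F, F\<^sub>0, \<dots>, F\<^sub>n\<close>, hence
  a boundary: \<open>x\<^sub>i x\<^sub>j\<^sup>q - x\<^sub>j x\<^sub>i\<^sup>q\<close> lies in the ideal of the \<open>F\<^sub>k\<close> and \<open>F\<close>. So \<open>d \<le> q + 2\<close>, and for \<open>d = q + 2\<close>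
  these forms lie in the linear span of the \<open>F\<^sub>k\<close>, which forces \<open>n = 2\<close> and form (3).

  Finally, if \<open>F\<^sub>1\<^sub>,\<^sub>0 = 0\<close>, then \<open>F\<close> (or every \<open>F\<^sub>i\<close>, if \<open>p\<close> divides \<open>d\<close>) vanishes at all rational points, and
  a nonzero form doing so has degree at least \<open>q + 1\<close>.\<close>

subsection \<open>Multivariate polynomials\<close>

text \<open>Koszul homology of \<open>r\<close> forms vanishes in degrees above \<open>r\<close>
  minus the depth of their ideal, and smoothness supplies depth \<open>n + 1\<close>. If
  \<open>p\<close> does not divide \<open>d\<close>, Euler's relation makes a common zero of the
  \<open>n + 1\<close> partials a zero of \<open>F\<close>, so the partials alone have full depth
  and every 1-cycle bounds. If \<open>p\<close> divides \<open>d\<close>, the partials may vanish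
  together away from the hypersurface; \<open>F\<close> has to join as an extra generator, and
  1-cycles need no longer bound. But Euler's relation has then itself become a syzygy, and wedging
  it with the Frobenius relation gives a cycle in degree 2, where homology does vanish. The obstacle
  is that smoothness speaks of points over the algebraic closure, whereas the matrices must have
  entries in the finite field. A Nullstellensatz over the closure and a descent of its cofactors
  turn smoothness into identities \<open>mvar i ^ N = (\<Sum>j<r. a j * f j)\<close> over
  \<open>'a\<close>, which are all that the Koszul argument uses. The cofactors it returns have no
  prescribed degree; comparing homogeneous components makes them constants.\<close>

abbreviation lookup where "lookup \<equiv> Poly_Mapping.lookup"
abbreviation keys where "keys \<equiv> Poly_Mapping.keys"
abbreviation single where "single \<equiv> Poly_Mapping.single"

definition mon :: "(nat \<Rightarrow> 'b::comm_ring_1) \<Rightarrow> (nat \<Rightarrow>\<^sub>0 nat) \<Rightarrow> 'b" where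
  "mon x m = (\<Prod>i\<in>keys m. x i ^ lookup m i)"

definition mdeg :: "(nat \<Rightarrow>\<^sub>0 nat) \<Rightarrow> nat" where
  "mdeg m = (\<Sum>i\<in>keys m. lookup m i)"

text \<open>One evaluation along a coefficient map serves four purposes: \<open>meval\<close>
  (identity), \<open>msubst\<close> (\<open>mconst\<close>), points over the closure
  (\<open>to_ac\<close>), and restriction to a line (\<open>\<lambda>c. [:c:]\<close>).\<close>

definition heval :: "('a \<Rightarrow> 'b) \<Rightarrow> (nat \<Rightarrow> 'b) \<Rightarrow> 'a::comm_ring_1 mpoly \<Rightarrow> 'b::comm_ring_1" where
  "heval \<phi> x F = (\<Sum>m\<in>keys F. \<phi> (lookup F m) * mon x m)"

text \<open>A set of indices rather than a bound: elimination separates \<open>{n}\<close> from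
  \<open>{..<n}\<close>, while the theorem speaks of \<open>{..n}\<close>.\<close>

definition vars_in :: "nat set \<Rightarrow> 'a::comm_ring_1 mpoly \<Rightarrow> bool" where
  "vars_in S F \<longleftrightarrow> (\<forall>m\<in>keys F. keys m \<subseteq> S)"

definition pfilter :: "((nat \<Rightarrow>\<^sub>0 nat) \<Rightarrow> bool) \<Rightarrow> 'a::comm_ring_1 mpoly \<Rightarrow> 'a mpoly" where
  "pfilter P F = Poly_Mapping.mapp (\<lambda>m c. if P m then c else 0) F"

definition hcomp :: "nat \<Rightarrow> 'a::comm_ring_1 mpoly \<Rightarrow> 'a mpoly" where
  "hcomp k = pfilter (\<lambda>m. mdeg m = k)"

lemma mon_superset: "finite S \<Longrightarrow> keys m \<subseteq> S \<Longrightarrow> mon x m = (\<Prod>i\<in>S. x i ^ lookup m i)"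
  unfolding mon_def by (rule prod.mono_neutral_left) (auto simp: in_keys_iff)

lemma mdeg_superset: "finite S \<Longrightarrow> keys m \<subseteq> S \<Longrightarrow> mdeg m = (\<Sum>i\<in>S. lookup m i)"
  unfolding mdeg_def by (rule sum.mono_neutral_left) (auto simp: in_keys_iff)

lemma keys_add_nat: "keys (m + m') = keys m \<union> keys (m' :: nat \<Rightarrow>\<^sub>0 nat)"
  by (auto simp: in_keys_iff lookup_add)

lemma mon_add: "mon x (m + m') = mon x m * mon x m'"
proof -
  let ?S = "keys m \<union> keys m'"
  have "mon x (m + m') = (\<Prod>i\<in>?S. x i ^ lookup (m + m') i)"
    by (rule mon_superset) (auto simp: keys_add_nat)
  also have "\<dots> = (\<Prod>i\<in>?S. x i ^ lookup m i) * (\<Prod>i\<in>?S. x i ^ lookup m' i)"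
    by (simp add: lookup_add power_add prod.distrib)
  also have "\<dots> = mon x m * mon x m'"
    by (subst (1 2) mon_superset[of ?S]) auto
  finally show ?thesis .
qed

lemma mdeg_add: "mdeg (m + m') = mdeg m + mdeg m'"
proof -
  let ?S = "keys m \<union> keys m'"
  have "mdeg (m + m') = (\<Sum>i\<in>?S. lookup (m + m') i)"
    by (rule mdeg_superset) (auto simp: keys_add_nat)
  also have "\<dots> = (\<Sum>i\<in>?S. lookup m i) + (\<Sum>i\<in>?S. lookup m' i)"
    by (simp add: lookup_add sum.distrib)
  also have "\<dots> = mdeg m + mdeg m'"
    by (subst (1 2) mdeg_superset[of ?S]) auto
  finally show ?thesis .
qed

lemma mon_zero [simp]: "mon x 0 = 1"
  by (simp add: mon_def)

lemma mdeg_zero [simp]: "mdeg 0 = 0"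
  by (simp add: mdeg_def)

lemma mon_single [simp]: "mon x (single i k) = x i ^ k"
  by (simp add: mon_def)

lemma mdeg_single [simp]: "mdeg (single i k) = k"
  by (simp add: mdeg_def)

lemma mdeg_eq_0_iff: "mdeg m = 0 \<longleftrightarrow> m = 0"
proof
  assume "mdeg m = 0"
  hence "\<forall>i\<in>keys m. lookup m i = 0" by (simp add: mdeg_def)
  thus "m = 0" by (metis lookup_zero not_in_keys_iff_lookup_eq_zero poly_mapping_eqI)
qed simp

lemma mpoly_sum_singles: "F = (\<Sum>m\<in>keys F. single m (lookup F m))"
proof (rule poly_mapping_eqI)
  fix k
  show "lookup F k = lookup (\<Sum>m\<in>keys F. single m (lookup F m)) k"
    by (cases "k \<in> keys F")
      (auto simp: lookup_sum lookup_single when_def in_keys_iff sum.delta)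
qed

lemma mpoly_induct_single [case_names single add]:
  fixes F :: "'a::comm_ring_1 mpoly"
  assumes "\<And>m c. P (single m c)" and "\<And>F G. P F \<Longrightarrow> P G \<Longrightarrow> P (F + G)"
  shows "P F"
proof -
  have "P (\<Sum>m\<in>A. single m (lookup F m))" if "finite A" for A
    using that
  proof induction
    case empty
    show ?case using assms(1)[of 0 0] by simp
  next
    case (insert m A)
    thus ?case using assms by simp
  qed
  thus ?thesis using mpoly_sum_singles[of F] by (metis finite_keys)
qed

lemma mconst_0 [simp]: "mconst 0 = 0"
  and mconst_1 [simp]: "mconst 1 = 1"
  by (simp_all add: mconst_def)

lemma mconst_add: "mconst (a + b) = mconst a + mconst b"
  and mconst_mult: "mconst (a * b) = mconst a * mconst b"
  and mconst_uminus: "mconst (- a) = - mconst a"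
  by (simp_all add: mconst_def single_add mult_single single_uminus)

lemma mconst_of_nat: "mconst (of_nat k) = of_nat k"
  by (simp add: mconst_def)

lemma mconst_eq_iff [simp]: "mconst a = mconst b \<longleftrightarrow> a = b"
  unfolding mconst_def by (metis lookup_single_eq)

lemma mconst_eq_0_iff [simp]: "mconst a = 0 \<longleftrightarrow> a = 0"
  using mconst_eq_iff[of a 0] by (simp del: mconst_eq_iff)

lemma mconst_sum: "mconst (\<Sum>i\<in>A. f i) = (\<Sum>i\<in>A. mconst (f i))"
  by (induction A rule: infinite_finite_induct) (simp_all add: mconst_add)

lemma mconst_power: "mconst (a ^ k) = mconst a ^ k"
  by (induction k) (simp_all add: mconst_mult)

lemma lookup_mconst_mult [simp]: "lookup (mconst c * F) m = c * lookup F m"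
  unfolding mconst_def
  by (induction F rule: mpoly_induct_single)
    (simp_all add: mult_single lookup_single when_def lookup_add ring_distribs)

lemma mvar_power: "(mvar i :: 'a::comm_ring_1 mpoly) ^ k = single (single i k) 1"
proof (induction k)
  case (Suc k)
  have "(mvar i :: 'a mpoly) ^ Suc k = mvar i * single (single i k) 1" by (simp add: Suc)
  thus ?case by (simp add: mvar_def mult_single flip: single_add)
qed simp

lemma mon_mvar: "mon mvar m = single m 1"
proof (induction m rule: Poly_Mapping.update_induct)
  case const
  show ?case by simp
next
  case (update m a b)
  have "Poly_Mapping.update a b m = m + single a b"
    using update(1) by (intro poly_mapping_eqI)
      (auto simp: lookup_update lookup_add lookup_single when_def in_keys_iff)
  thus ?case by (simp add: mon_add update mvar_power mult_single)
qed

lemma single_eq: "single m c = mconst c * mon mvar m"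
  by (simp add: mon_mvar mconst_def mult_single)

lemma mvar_neq_0 [simp]: "mvar i \<noteq> 0"
  by (metis lookup_single_eq lookup_zero mvar_def zero_neq_one)

subsection \<open>Evaluation\<close>

lemma heval_superset:
  assumes "finite A" "keys F \<subseteq> A" "\<phi> 0 = 0"
  shows "heval \<phi> x F = (\<Sum>m\<in>A. \<phi> (lookup F m) * mon x m)"
  unfolding heval_def using assms by (intro sum.mono_neutral_left) (auto simp: in_keys_iff)

locale coeff_hom =
  fixes \<phi> :: "'a::comm_ring_1 \<Rightarrow> 'b::comm_ring_1"
  assumes hom_add: "\<phi> (a + b) = \<phi> a + \<phi> b"
    and hom_mult: "\<phi> (a * b) = \<phi> a * \<phi> b"
    and hom_1: "\<phi> 1 = 1"
begin

lemma hom_0: "\<phi> 0 = 0"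
  using hom_add[of 0 0] by simp

lemma heval_add: "heval \<phi> x (F + G) = heval \<phi> x F + heval \<phi> x G"
proof -
  let ?S = "keys F \<union> keys G"
  have "heval \<phi> x (F + G) = (\<Sum>m\<in>?S. \<phi> (lookup (F + G) m) * mon x m)"
    by (rule heval_superset) (use keys_add[of F G] hom_0 in auto)
  also have "\<dots> = (\<Sum>m\<in>?S. \<phi> (lookup F m) * mon x m) + (\<Sum>m\<in>?S. \<phi> (lookup G m) * mon x m)"
    by (simp add: lookup_add hom_add sum.distrib ring_distribs)
  also have "\<dots> = heval \<phi> x F + heval \<phi> x G"
    by (subst (1 2) heval_superset[of ?S]) (auto simp: hom_0)
  finally show ?thesis .
qed

lemma heval_single: "heval \<phi> x (single m c) = \<phi> c * mon x m"
  by (simp add: heval_def hom_0)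

lemma heval_0 [simp]: "heval \<phi> x 0 = 0"
  by (simp add: heval_def)

lemma heval_mult: "heval \<phi> x (F * G) = heval \<phi> x F * heval \<phi> x G"
proof (induction F rule: mpoly_induct_single)
  case (single m c)
  show ?case
    by (induction G rule: mpoly_induct_single)
      (simp_all add: heval_single mult_single mon_add hom_mult heval_add ring_distribs mult_ac)
qed (simp add: heval_add ring_distribs)

lemma heval_mconst [simp]: "heval \<phi> x (mconst c) = \<phi> c"
  by (simp add: mconst_def heval_single)

lemma heval_1 [simp]: "heval \<phi> x 1 = 1"
  using heval_mconst[of x 1] by (simp add: hom_1 del: heval_mconst)

lemma heval_mvar [simp]: "heval \<phi> x (mvar i) = x i"
  by (simp add: mvar_def heval_single hom_1)

lemma heval_uminus: "heval \<phi> x (- F) = - heval \<phi> x F"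
  using heval_add[of x F "- F"] by (simp add: eq_neg_iff_add_eq_0 add.commute)

lemma heval_diff: "heval \<phi> x (F - G) = heval \<phi> x F - heval \<phi> x G"
  using heval_add[of x F "- G"] by (simp add: heval_uminus)

lemma heval_power: "heval \<phi> x (F ^ k) = heval \<phi> x F ^ k"
  by (induction k) (simp_all add: heval_mult)

lemma heval_sum: "heval \<phi> x (\<Sum>i\<in>A. f i) = (\<Sum>i\<in>A. heval \<phi> x (f i))"
  by (induction A rule: infinite_finite_induct) (simp_all add: heval_add)

lemma heval_prod: "heval \<phi> x (\<Prod>i\<in>A. f i) = (\<Prod>i\<in>A. heval \<phi> x (f i))"
  by (induction A rule: infinite_finite_induct) (simp_all add: heval_mult)

lemmas heval_simps = heval_add heval_mult heval_uminus heval_diff heval_power heval_sum heval_prod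

end

lemma meval_heval: "meval x F = heval (\<lambda>c. c) x F"
  by (simp add: meval_def heval_def mon_def)

lemma msubst_heval: "msubst \<sigma> F = heval mconst \<sigma> F"
  by (simp add: msubst_def heval_def mon_def)

interpretation id_hom: coeff_hom "\<lambda>c. c"
  by standard auto

interpretation mconst_hom: coeff_hom mconst
  by standard (auto simp: mconst_add mconst_mult)

interpretation ac_hom: coeff_hom to_ac
  by standard auto

interpretation pCons_hom: coeff_hom "\<lambda>c. [:c:]"
  by standard (auto simp: one_pCons)

lemmas meval_simps = id_hom.heval_simps[folded meval_heval]
lemmas msubst_simps = mconst_hom.heval_simps[folded msubst_heval]

lemma meval_mconst [simp]: "meval x (mconst c) = c"
  and meval_mvar [simp]: "meval x (mvar i) = x i"
  and meval_0 [simp]: "meval x 0 = 0"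
  and meval_1 [simp]: "meval x 1 = 1"
  by (simp_all add: meval_heval)

lemma msubst_mconst [simp]: "msubst \<sigma> (mconst c) = mconst c"
  and msubst_mvar [simp]: "msubst \<sigma> (mvar i) = \<sigma> i"
  and msubst_0 [simp]: "msubst \<sigma> 0 = 0"
  and msubst_1 [simp]: "msubst \<sigma> 1 = 1"
  by (simp_all add: msubst_heval)

subsection \<open>Variables and homogeneous components\<close>

lemma in_vars_iff: "in_vars n F \<longleftrightarrow> vars_in {..n} F"
  by (auto simp: in_vars_def vars_in_def)

lemma vars_in_add: "vars_in S F \<Longrightarrow> vars_in S G \<Longrightarrow> vars_in S (F + G)"
  using keys_add[of F G] by (auto simp: vars_in_def)

lemma vars_in_mult: "vars_in S F \<Longrightarrow> vars_in S G \<Longrightarrow> vars_in S (F * G)"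
  using keys_mult[of F G] by (fastforce simp: vars_in_def keys_add_nat)

lemma vars_in_mconst [simp]: "vars_in S (mconst c)"
  by (simp add: vars_in_def mconst_def)

lemma vars_in_0 [simp]: "vars_in S 0" and vars_in_1 [simp]: "vars_in S 1"
  by (simp_all add: vars_in_def)

lemma vars_in_mvar [simp]: "vars_in S (mvar i :: 'a::comm_ring_1 mpoly) \<longleftrightarrow> i \<in> S"
  by (simp add: vars_in_def mvar_def)

lemma vars_in_uminus [simp]: "vars_in S (- F) \<longleftrightarrow> vars_in S F"
  by (simp add: vars_in_def in_keys_iff)

lemma vars_in_diff: "vars_in S F \<Longrightarrow> vars_in S G \<Longrightarrow> vars_in S (F - G)"
  using vars_in_add[of S F "- G"] by simp

lemma vars_in_power: "vars_in S F \<Longrightarrow> vars_in S (F ^ k)"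
  by (induction k) (auto intro: vars_in_mult)

lemma vars_in_sum: "(\<And>i. i \<in> A \<Longrightarrow> vars_in S (f i)) \<Longrightarrow> vars_in S (\<Sum>i\<in>A. f i)"
  by (induction A rule: infinite_finite_induct) (auto intro: vars_in_add)

lemma vars_in_mono: "vars_in S F \<Longrightarrow> S \<subseteq> T \<Longrightarrow> vars_in T F"
  by (auto simp: vars_in_def)

lemma vars_in_induct [consumes 1, case_names mconst mvar add mult]:
  fixes F :: "'a::comm_ring_1 mpoly"
  assumes F: "vars_in S F"
    and const: "\<And>c. P (mconst c)" and var: "\<And>i. i \<in> S \<Longrightarrow> P (mvar i)"
    and add: "\<And>F G. vars_in S F \<Longrightarrow> vars_in S G \<Longrightarrow> P F \<Longrightarrow> P G \<Longrightarrow> P (F + G)"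
    and mult: "\<And>F G. vars_in S F \<Longrightarrow> vars_in S G \<Longrightarrow> P F \<Longrightarrow> P G \<Longrightarrow> P (F * G)"
  shows "P F"
proof -
  define Q where "Q F \<longleftrightarrow> vars_in S F \<and> P F" for F
  have Q1: "Q 1" and Q0: "Q 0"
    using const[of 1] const[of 0] by (simp_all add: Q_def)
  have Qadd: "Q (F + G)" and Qmult: "Q (F * G)" if "Q F" "Q G" for F G
    using that add mult by (auto simp: Q_def intro: vars_in_add vars_in_mult)
  have Qpow: "Q (mvar i ^ k)" if "i \<in> S" for i k
    by (induction k) (use that Q1 Qmult var in \<open>auto simp: Q_def\<close>)
  have Qmon: "Q (\<Prod>i\<in>A. mvar i ^ g i)" if "finite A" "A \<subseteq> S" for A g
    using that by (induction A) (auto intro!: Q1 Qmult Qpow)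
  have Qterm: "Q (single m c)" if "keys m \<subseteq> S" for m c
    unfolding single_eq mon_def using that const by (intro Qmult Qmon) (auto simp: Q_def)
  have "Q (\<Sum>m\<in>A. single m (lookup F m))" if "finite A" "A \<subseteq> keys F" for A
    using that F by (induction A) (auto intro!: Q0 Qadd Qterm simp: vars_in_def)
  from this[of "keys F"] show "P F" using mpoly_sum_singles[of F] by (simp add: Q_def)
qed

lemma homogeneous_iff: "homogeneous d F \<longleftrightarrow> (\<forall>m\<in>keys F. mdeg m = d)"
  by (simp add: homogeneous_def mdeg_def)

lemma homogeneous_add: "homogeneous d F \<Longrightarrow> homogeneous d G \<Longrightarrow> homogeneous d (F + G)"
  using keys_add[of F G] by (auto simp: homogeneous_iff)

lemma homogeneous_mult: "homogeneous d F \<Longrightarrow> homogeneous e G \<Longrightarrow> homogeneous (d + e) (F * G)"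
  using keys_mult[of F G] by (fastforce simp: homogeneous_iff mdeg_add)

lemma homogeneous_0 [simp]: "homogeneous d 0"
  by (simp add: homogeneous_iff)

lemma homogeneous_mconst [simp]: "homogeneous 0 (mconst c)"
  by (simp add: homogeneous_iff mconst_def)

lemma homogeneous_1 [simp]: "homogeneous 0 1"
  by (simp add: homogeneous_iff)

lemma homogeneous_mvar [simp]: "homogeneous (Suc 0) (mvar i)"
  by (simp add: homogeneous_iff mvar_def)

lemma homogeneous_mult_mconst: "homogeneous d F \<Longrightarrow> homogeneous d (mconst c * F)"
  using homogeneous_mult[of 0 "mconst c" d F] by simp

lemma homogeneous_uminus [simp]: "homogeneous d (- F) \<longleftrightarrow> homogeneous d F"
  by (simp add: homogeneous_iff in_keys_iff)

lemma homogeneous_diff: "homogeneous d F \<Longrightarrow> homogeneous d G \<Longrightarrow> homogeneous d (F - G)"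
  using homogeneous_add[of d F "- G"] by simp

lemma homogeneous_power: "homogeneous d F \<Longrightarrow> homogeneous (d * k) (F ^ k)"
  by (induction k) (auto dest: homogeneous_mult)

lemma homogeneous_sum: "(\<And>i. i \<in> A \<Longrightarrow> homogeneous d (f i)) \<Longrightarrow> homogeneous d (\<Sum>i\<in>A. f i)"
  by (induction A rule: infinite_finite_induct) (auto intro: homogeneous_add)

lemma homogeneous_prod:
  "(\<And>i. i \<in> A \<Longrightarrow> homogeneous (e i) (f i)) \<Longrightarrow> homogeneous (\<Sum>i\<in>A. e i) (\<Prod>i\<in>A. f i)"
  by (induction A rule: infinite_finite_induct) (auto intro: homogeneous_mult)

lemma homogeneous_unique: "homogeneous d F \<Longrightarrow> homogeneous e F \<Longrightarrow> F \<noteq> 0 \<Longrightarrow> d = e"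
  unfolding homogeneous_iff by (metis in_keys_iff lookup_zero poly_mapping_eqI)

lemma lookup_pfilter: "lookup (pfilter P F) m = (if P m then lookup F m else 0)"
  by (simp add: pfilter_def lookup_mapp in_keys_iff when_def)

lemma pfilter_add: "pfilter P (F + G) = pfilter P F + pfilter P G"
  by (intro poly_mapping_eqI) (simp add: lookup_pfilter lookup_add)

lemma vars_in_pfilter: "vars_in S F \<Longrightarrow> vars_in S (pfilter P F)"
  by (auto simp: vars_in_def in_keys_iff lookup_pfilter split: if_splits)

lemma lookup_hcomp: "lookup (hcomp k F) m = (if mdeg m = k then lookup F m else 0)"
  by (simp add: hcomp_def lookup_pfilter)

lemma hcomp_add: "hcomp k (F + G) = hcomp k F + hcomp k G"
  by (simp add: hcomp_def pfilter_add)

lemma hcomp_0 [simp]: "hcomp k 0 = 0"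
  by (intro poly_mapping_eqI) (simp add: lookup_hcomp)

lemma hcomp_sum: "hcomp k (\<Sum>i\<in>A. f i) = (\<Sum>i\<in>A. hcomp k (f i))"
  by (induction A rule: infinite_finite_induct) (simp_all add: hcomp_add)

lemma vars_in_hcomp: "vars_in S F \<Longrightarrow> vars_in S (hcomp k F)"
  by (simp add: hcomp_def vars_in_pfilter)

lemma homogeneous_hcomp [simp]: "homogeneous k (hcomp k F)"
  by (auto simp: homogeneous_iff in_keys_iff lookup_hcomp split: if_splits)

lemma hcomp_homogeneous: "homogeneous d F \<Longrightarrow> hcomp k F = (if k = d then F else 0)"
  by (intro poly_mapping_eqI) (auto simp: lookup_hcomp homogeneous_iff in_keys_iff)

lemma hcomp_single: "hcomp k (single m c) = (if mdeg m = k then single m c else 0)"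
  by (intro poly_mapping_eqI) (auto simp: lookup_hcomp lookup_single when_def)

text \<open>This is how degrees enter: taking one component of a syzygy replaces each unknown
  cofactor by a component of known degree, often zero or a constant.\<close>

lemma hcomp_mult_homogeneous:
  assumes "homogeneous d F"
  shows "hcomp k (F * G) = (if d \<le> k then F * hcomp (k - d) G else 0)"
proof -
  have *: "hcomp k (single m c * G) = (if d \<le> k then single m c * hcomp (k - d) G else 0)"
    if "mdeg m = d" for m c
    by (induction G rule: mpoly_induct_single)
      (use that in \<open>auto simp: hcomp_add hcomp_single mult_single mdeg_add ring_distribs\<close>)
  have "hcomp k (F * G) = (\<Sum>m\<in>keys F. hcomp k (single m (lookup F m) * G))"
    by (subst mpoly_sum_singles[of F]) (simp add: hcomp_sum sum_distrib_right)
  also have "\<dots> = (\<Sum>m\<in>keys F. if d \<le> k then single m (lookup F m) * hcomp (k - d) G else 0)"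
    using assms by (intro sum.cong refl *) (simp add: homogeneous_iff)
  also have "\<dots> = (if d \<le> k then F * hcomp (k - d) G else 0)"
    by (subst (3) mpoly_sum_singles[of F]) (simp add: sum_distrib_right)
  finally show ?thesis .
qed

lemma homogeneous_0_imp_mconst:
  assumes "homogeneous 0 F" shows "F = mconst (lookup F 0)"
proof (rule poly_mapping_eqI)
  fix m
  show "lookup F m = lookup (mconst (lookup F 0)) m"
    using assms by (auto simp: homogeneous_iff mconst_def lookup_single when_def mdeg_eq_0_iff in_keys_iff)
qed

lemma hcomp_0_eq: "hcomp 0 F = mconst (lookup F 0)"
  using homogeneous_0_imp_mconst[of "hcomp 0 F"] by (simp add: lookup_hcomp)

text \<open>A nonzero component of \<open>H\<close> in a wrong degree, multiplied by
  \<open>F\<close>, would be a nonzero component of the product in a wrong degree.\<close>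

lemma homogeneous_cofactor:
  fixes F H :: "'a::idom mpoly"
  assumes F: "homogeneous d F" "F \<noteq> 0" and FH: "homogeneous (d + e) (F * H)"
  shows "homogeneous e H"
proof -
  have "hcomp k H = 0" if "k \<noteq> e" for k
  proof -
    have "F * hcomp k H = hcomp (d + k) (F * H)"
      using hcomp_mult_homogeneous[OF F(1), of "d + k" H] by simp
    also have "\<dots> = 0" using hcomp_homogeneous[OF FH, of "d + k"] that by simp
    finally show ?thesis using F(2) by simp
  qed
  hence "lookup H m = 0" if "mdeg m \<noteq> e" for m
    using that by (metis lookup_hcomp lookup_zero)
  thus ?thesis by (auto simp: homogeneous_iff in_keys_iff)
qed

subsection \<open>Partial derivatives\<close>

lemma update_pred_eq: "Poly_Mapping.update i (lookup m i - 1) m = m - single i (1::nat)"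
  by (intro poly_mapping_eqI) (simp add: lookup_update lookup_minus lookup_single when_def)

lemma mpderiv_add: "mpderiv i (F + G) = mpderiv i F + mpderiv i G"
  unfolding mpderiv_def
  by (rule setsum_keys_plus_distrib) (simp_all add: ring_distribs single_add)

lemma mpderiv_single:
  "mpderiv i (single m c) = single (m - single i 1) (of_nat (lookup m i) * c)"
  by (simp add: mpderiv_def update_pred_eq del: One_nat_def)

lemma mpderiv_0 [simp]: "mpderiv i 0 = 0"
  by (simp add: mpderiv_def)

lemma mpderiv_uminus: "mpderiv i (- F) = - mpderiv i F"
  using mpderiv_add[of i F "- F"] by (simp add: eq_neg_iff_add_eq_0 add.commute)

lemma mpderiv_diff: "mpderiv i (F - G) = mpderiv i F - mpderiv i G"
  using mpderiv_add[of i F "- G"] by (simp add: mpderiv_uminus)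

lemma mpderiv_sum: "mpderiv i (\<Sum>j\<in>A. f j) = (\<Sum>j\<in>A. mpderiv i (f j))"
  by (induction A rule: infinite_finite_induct) (simp_all add: mpderiv_add)

lemma minus_single_add:
  "lookup m i \<noteq> 0 \<Longrightarrow> m - single i (1::nat) + m' = m + m' - single i 1"
  by (intro poly_mapping_eqI) (auto simp: lookup_add lookup_minus lookup_single when_def)

lemma mpderiv_mult: "mpderiv i (F * G) = mpderiv i F * G + F * mpderiv i G"
proof (induction F rule: mpoly_induct_single)
  case (single m c)
  show ?case
  proof (induction G rule: mpoly_induct_single)
    case (single m' c')
    \<comment> \<open>If \<open>lookup m i = 0\<close>, truncated subtraction gives the wrong
      exponent, but then the coefficient is zero.\<close>
    have 1: "single (m - single i 1 + m') (of_nat (lookup m i) * c * c')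
        = single (m + m' - single i 1) (of_nat (lookup m i) * c * c')"
      by (cases "lookup m i = 0") (simp_all add: minus_single_add del: One_nat_def)
    have 2: "single (m + (m' - single i 1)) (c * (of_nat (lookup m' i) * c'))
        = single (m + m' - single i 1) (c * (of_nat (lookup m' i) * c'))"
      using minus_single_add[of m' i m]
      by (cases "lookup m' i = 0") (simp_all add: add.commute del: One_nat_def)
    show ?case
      unfolding mult_single mpderiv_single 1 2
      by (simp add: lookup_add ring_distribs mult_ac flip: single_add)
  qed (simp add: mpderiv_add ring_distribs)
qed (simp add: mpderiv_add ring_distribs)

lemma mpderiv_mconst [simp]: "mpderiv i (mconst c) = 0"
  by (simp add: mconst_def mpderiv_single)

lemma mpderiv_mvar: "mpderiv i (mvar j) = (if i = j then 1 else 0)"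
  by (simp add: mvar_def mpderiv_single lookup_single when_def)

lemma mpderiv_mconst_mult: "mpderiv i (mconst c * F) = mconst c * mpderiv i F"
  by (simp add: mpderiv_mult)

lemma mpderiv_power: "mpderiv i (F ^ k) = of_nat k * F ^ (k - 1) * mpderiv i F"
proof (induction k)
  case (Suc k)
  show ?case
  proof (cases k)
    case 0
    thus ?thesis by (simp add: mpderiv_mult mpderiv_mconst[of i 1, simplified])
  next
    case (Suc j)
    thus ?thesis using Suc.IH by (simp add: mpderiv_mult algebra_simps)
  qed
qed (use mpderiv_mconst[of i 1] in simp)

lemma mpderiv_commute: "mpderiv i (mpderiv j F) = mpderiv j (mpderiv i F)"
proof (induction F rule: mpoly_induct_single)
  case (single m c)
  have "m - single j 1 - single i (1::nat) = m - single i 1 - single j 1"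
    by (simp add: diff_diff_add add.commute)
  thus ?case
    by (cases "i = j") (simp_all add: mpderiv_single lookup_minus lookup_single mult_ac)
qed (simp add: mpderiv_add)

lemma lookup_mpderiv:
  "lookup (mpderiv i F) m = of_nat (lookup m i + 1) * lookup F (m + single i 1)"
proof (induction F rule: mpoly_induct_single)
  case (single m' c)
  have "m' - single i 1 = m \<longleftrightarrow> m' = m + single i (1::nat)" if "lookup m' i \<noteq> 0"
  proof
    assume "m' - single i 1 = m"
    thus "m' = m + single i 1"
      using that by (intro poly_mapping_eqI) (auto simp: lookup_add lookup_minus lookup_single when_def)
  qed simp
  thus ?case
    by (cases "lookup m' i = 0")
      (auto simp: mpderiv_single lookup_single when_def lookup_add)
qed (simp add: mpderiv_add lookup_add ring_distribs)

lemma vars_in_mpderiv: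
  assumes "vars_in S F" shows "vars_in S (mpderiv i F)"
  unfolding vars_in_def
proof safe
  fix m j assume m: "m \<in> keys (mpderiv i F)" and j: "j \<in> keys m"
  hence "m + single i 1 \<in> keys F" by (auto simp: in_keys_iff lookup_mpderiv)
  with assms have "keys (m + single i 1) \<subseteq> S" unfolding vars_in_def by blast
  with j show "j \<in> S" by (auto simp: keys_add_nat)
qed

lemma homogeneous_mpderiv:
  assumes "homogeneous d F" shows "homogeneous (d - 1) (mpderiv i F)"
  unfolding homogeneous_iff
proof
  fix m assume m: "m \<in> keys (mpderiv i F)"
  hence "m + single i 1 \<in> keys F" by (auto simp: in_keys_iff lookup_mpderiv)
  with assms have "mdeg (m + single i 1) = d" by (auto simp: homogeneous_iff)
  thus "mdeg m = d - 1" by (simp add: mdeg_add)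
qed

lemma mvar_mult_mpderiv_single:
  "mvar i * mpderiv i (single m c) = single m (of_nat (lookup m i) * c)"
proof (cases "lookup m i = 0")
  case False
  have "single i 1 + (m - single i 1) = m"
    using False by (intro poly_mapping_eqI) (auto simp: lookup_add lookup_minus lookup_single when_def)
  thus ?thesis by (simp add: mvar_def mpderiv_single mult_single)
qed (simp add: mpderiv_single)

lemma of_nat_mult_single:
  fixes c :: "'a::comm_ring_1" and m :: "nat \<Rightarrow>\<^sub>0 nat"
  shows "of_nat d * single m c = single m (of_nat d * c)"
proof -
  have "of_nat d * single m c = mconst (of_nat d) * single m c" by (simp only: mconst_of_nat)
  thus ?thesis by (simp add: mconst_def mult_single del: single_of_nat)
qed

lemma euler_identity:
  fixes F :: "'a::comm_ring_1 mpoly"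
  assumes F: "vars_in S F" "homogeneous d F" and S: "finite S"
  shows "(\<Sum>i\<in>S. mvar i * mpderiv i F) = of_nat d * F"
proof -
  have 1: "(\<Sum>i\<in>S. mvar i * mpderiv i (single m c)) = of_nat d * single m c"
    if m: "m \<in> keys F" for m and c :: 'a
  proof -
    have "(\<Sum>i\<in>S. lookup m i) = d"
      using mdeg_superset[of S m] F m S by (auto simp: vars_in_def homogeneous_iff)
    hence "(\<Sum>i\<in>S. of_nat (lookup m i) :: 'a) = of_nat d" by (simp flip: of_nat_sum)
    hence "(\<Sum>i\<in>S. single m (of_nat (lookup m i) * c)) = single m (of_nat d * c)"
      by (intro poly_mapping_eqI)
        (auto simp: lookup_sum lookup_single when_def simp flip: sum_distrib_right)
    thus ?thesis
      unfolding mvar_mult_mpderiv_single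
      by (simp add: of_nat_mult_single)
  qed
  have "(\<Sum>i\<in>S. mvar i * mpderiv i F)
      = (\<Sum>i\<in>S. mvar i * mpderiv i (\<Sum>m\<in>keys F. single m (lookup F m)))"
    by (simp flip: mpoly_sum_singles)
  also have "\<dots> = (\<Sum>m\<in>keys F. \<Sum>i\<in>S. mvar i * mpderiv i (single m (lookup F m)))"
    unfolding mpderiv_sum sum_distrib_left by (rule sum.swap)
  also have "\<dots> = (\<Sum>m\<in>keys F. of_nat d * single m (lookup F m))"
    by (intro sum.cong refl 1)
  also have "\<dots> = of_nat d * F"
    by (simp flip: mpoly_sum_singles sum_distrib_left)
  finally show ?thesis .
qed

lemma mpderiv_msubst:
  assumes "vars_in S F" "finite S"
  shows "mpderiv k (msubst \<sigma> F) = (\<Sum>i\<in>S. msubst \<sigma> (mpderiv i F) * mpderiv k (\<sigma> i))"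
  using assms
proof (induction rule: vars_in_induct)
  case (mvar j)
  have "(\<Sum>i\<in>S. msubst \<sigma> (mpderiv i (mvar j)) * mpderiv k (\<sigma> i))
      = (\<Sum>i\<in>S. if i = j then mpderiv k (\<sigma> i) else 0)"
    by (intro sum.cong) (auto simp: mpderiv_mvar)
  thus ?case using mvar by simp
next
  case (add F G)
  thus ?case by (simp add: msubst_simps mpderiv_add ring_distribs sum.distrib)
next
  case (mult F G)
  thus ?case
    by (simp add: msubst_simps mpderiv_mult ring_distribs sum.distrib sum_distrib_left
        sum_distrib_right mult_ac)
qed simp

lemma homogeneous_msubst:
  assumes "homogeneous d F" "\<And>i. homogeneous 1 (\<sigma> i)"
  shows "homogeneous d (msubst \<sigma> F)"
  unfolding msubst_def
proof (intro homogeneous_sum homogeneous_mult_mconst)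
  fix m assume m: "m \<in> keys F"
  have "homogeneous (\<Sum>i\<in>keys m. 1 * lookup m i) (\<Prod>i\<in>keys m. \<sigma> i ^ lookup m i)"
    using assms by (intro homogeneous_prod homogeneous_power)
  thus "homogeneous d (\<Prod>i\<in>keys m. \<sigma> i ^ lookup m i)"
    using assms(1) m by (simp add: homogeneous_def)
qed

lemma vars_in_msubst:
  assumes "vars_in S F" "\<And>i. i \<in> S \<Longrightarrow> vars_in T (\<sigma> i)"
  shows "vars_in T (msubst \<sigma> F)"
  using assms(1)
  by (induction rule: vars_in_induct)
    (auto simp: msubst_simps assms(2) intro: vars_in_add vars_in_mult)

subsection \<open>Coefficientwise maps\<close>

lemma lookup_pm_map: "f 0 = 0 \<Longrightarrow> lookup (Poly_Mapping.map f F) m = f (lookup F m)"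
  by (simp add: map.rep_eq when_def)

lemma pm_map_add:
  "f 0 = 0 \<Longrightarrow> (\<And>a b. f (a + b) = f a + f b) \<Longrightarrow>
    Poly_Mapping.map f (F + G) = Poly_Mapping.map f F + Poly_Mapping.map f G"
  by (intro poly_mapping_eqI) (simp add: lookup_pm_map lookup_add)

lemma pm_map_sum:
  assumes "f 0 = 0" "\<And>a b. f (a + b) = f a + f b"
  shows "Poly_Mapping.map f (\<Sum>i\<in>A. F i) = (\<Sum>i\<in>A. Poly_Mapping.map f (F i))"
  by (induction A rule: infinite_finite_induct)
    (simp_all add: pm_map_add assms map_eq_zero_iff)

lemma vars_in_pm_map:
  "f 0 = 0 \<Longrightarrow> vars_in S F \<Longrightarrow> vars_in S (Poly_Mapping.map f F)"
  by (auto simp: vars_in_def in_keys_iff lookup_pm_map)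

lemma homogeneous_pm_map:
  "f 0 = 0 \<Longrightarrow> homogeneous d F \<Longrightarrow> homogeneous d (Poly_Mapping.map f F)"
  by (auto simp: homogeneous_iff in_keys_iff lookup_pm_map)

lemma mpderiv_map_to_ac:
  "mpderiv i (Poly_Mapping.map to_ac F) = Poly_Mapping.map to_ac (mpderiv i F)"
  by (intro poly_mapping_eqI) (simp add: lookup_mpderiv lookup_pm_map)

lemma meval_map_to_ac: "meval x (Poly_Mapping.map to_ac F) = heval to_ac x F"
proof -
  have "keys (Poly_Mapping.map to_ac F) = keys F"
    by (auto simp: in_keys_iff lookup_pm_map)
  thus ?thesis by (simp add: meval_heval heval_def lookup_pm_map)
qed

subsection \<open>Expansion with respect to one variable\<close>

text \<open>The coefficient of \<open>mvar n ^ k\<close> when \<open>F\<close> is read as a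
  polynomial in \<open>mvar n\<close> over the other variables.\<close>

definition slice :: "nat \<Rightarrow> nat \<Rightarrow> 'a::comm_ring_1 mpoly \<Rightarrow> 'a mpoly" where
  "slice n k F = (\<Sum>m\<in>keys F. if lookup m n = k then single (m - single n k) (lookup F m) else 0)"

lemma slice_add: "slice n k (F + G) = slice n k F + slice n k G"
  unfolding slice_def by (rule setsum_keys_plus_distrib) (simp_all add: single_add)

lemma slice_single:
  "slice n k (single m c) = (if lookup m n = k then single (m - single n k) c else 0)"
  by (simp add: slice_def)

lemma lookup_slice:
  "lookup (slice n k F) m = (if lookup m n = 0 then lookup F (m + single n k) else 0)"
proof (induction F rule: mpoly_induct_single)
  case (single m' c)
  have "m' - single n k = m \<longleftrightarrow> m' = m + single n k"
    if "lookup m' n = k" "lookup m n = 0"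
  proof
    assume "m' - single n k = m"
    thus "m' = m + single n k"
      using that by (intro poly_mapping_eqI)
        (auto simp: lookup_add lookup_minus lookup_single when_def)
  qed simp
  moreover have "lookup (m' - single n k) n = 0" if "lookup m' n = k"
    using that by (simp add: lookup_minus)
  ultimately show ?case
    by (auto simp: slice_single lookup_single when_def lookup_add)
qed (simp add: slice_add lookup_add)

lemma vars_in_slice:
  assumes "vars_in S F" shows "vars_in (S - {n}) (slice n k F)"
  unfolding vars_in_def
proof
  fix m assume m: "m \<in> keys (slice n k F)"
  hence "m + single n k \<in> keys F" "n \<notin> keys m"
    by (auto simp: in_keys_iff lookup_slice split: if_splits)
  moreover from this have "keys (m + single n k) \<subseteq> S" using assms unfolding vars_in_def by blast
  ultimately show "keys m \<subseteq> S - {n}" by (auto simp: keys_add_nat)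
qed

lemma homogeneous_slice:
  assumes "homogeneous d F" shows "homogeneous (d - k) (slice n k F)"
  unfolding homogeneous_iff
proof
  fix m assume m: "m \<in> keys (slice n k F)"
  hence "m + single n k \<in> keys F" by (auto simp: in_keys_iff lookup_slice split: if_splits)
  with assms have "mdeg (m + single n k) = d" by (auto simp: homogeneous_iff)
  thus "mdeg m = d - k" by (simp add: mdeg_add)
qed

lemma slice_eq_0_beyond: "homogeneous d F \<Longrightarrow> d < k \<Longrightarrow> slice n k F = 0"
proof (rule poly_mapping_eqI)
  fix m assume "homogeneous d F" "d < k"
  hence "m + single n k \<notin> keys F" by (auto simp: homogeneous_iff mdeg_add)
  thus "lookup (slice n k F) m = lookup 0 m" by (simp add: lookup_slice in_keys_iff)
qed

text \<open>Allowing every \<open>E \<ge> D\<close> lets the bounds of two summands be merged in the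
  induction.\<close>

lemma slice_expansion: "\<exists>D. \<forall>E\<ge>D. F = (\<Sum>k\<le>E. slice n k F * mvar n ^ k)"
proof -
  have expand: "single m c = (\<Sum>k\<le>E. slice n k (single m c) * mvar n ^ k)"
    if "lookup m n \<le> E" for m E and c :: 'a
  proof -
    have "(\<Sum>k\<le>E. slice n k (single m c) * mvar n ^ k)
        = (\<Sum>k\<le>E. if k = lookup m n then single (m - single n k + single n k) c else 0)"
      by (intro sum.cong) (auto simp: slice_single mvar_power mult_single)
    also have "\<dots> = single (m - single n (lookup m n) + single n (lookup m n)) c"
      using that by simp
    also have "m - single n (lookup m n) + single n (lookup m n) = m"
      by (intro poly_mapping_eqI) (auto simp: lookup_add lookup_minus lookup_single when_def)
    finally show ?thesis by simp
  qed
  show ?thesis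
  proof (induction F rule: mpoly_induct_single)
    case (single m c)
    show ?case using expand by blast
  next
    case (add F G)
    then obtain D1 D2 where D: "\<And>E. E \<ge> D1 \<Longrightarrow> F = (\<Sum>k\<le>E. slice n k F * mvar n ^ k)"
      "\<And>E. E \<ge> D2 \<Longrightarrow> G = (\<Sum>k\<le>E. slice n k G * mvar n ^ k)" by blast
    have "F + G = (\<Sum>k\<le>E. slice n k (F + G) * mvar n ^ k)" if "E \<ge> max D1 D2" for E
      using D(1)[of E] D(2)[of E] that by (simp add: slice_add ring_distribs sum.distrib)
    thus ?case by blast
  qed
qed

text \<open>Restriction to the fibre over \<open>a\<close> of the projection that forgets coordinate
  \<open>n\<close>; the result is univariate, so ideals restrict to principal ideals.\<close>

definition eval_last :: "nat \<Rightarrow> (nat \<Rightarrow> 'a) \<Rightarrow> 'a::comm_ring_1 mpoly \<Rightarrow> 'a poly" where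
  "eval_last n a F = heval (\<lambda>c. [:c:]) (\<lambda>i. if i = n then [:0, 1:] else [:a i:]) F"

lemmas eval_last_simps = pCons_hom.heval_simps[where x = "\<lambda>i. if i = n then [:0, 1:] else [:a i:]",
  folded eval_last_def] for n a

lemma eval_last_mconst [simp]: "eval_last n a (mconst c) = [:c:]"
  and eval_last_mvar [simp]: "eval_last n a (mvar i) = (if i = n then [:0, 1:] else [:a i:])"
  and eval_last_0 [simp]: "eval_last n a 0 = 0"
  by (simp_all add: eval_last_def)

lemma poly_eval_last:
  fixes F :: "'a::comm_ring_1 mpoly"
  shows "poly (eval_last n a F) t = meval (a(n := t)) F"
proof -
  have "vars_in UNIV F" by (simp add: vars_in_def)
  thus ?thesis
    by (induction rule: vars_in_induct) (auto simp: eval_last_simps meval_simps)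
qed

lemma coeff_eval_last: "coeff (eval_last n a F) k = meval a (slice n k F)"
proof (induction F rule: mpoly_induct_single)
  case (single m c)
  let ?j = "lookup m n" and ?x = "\<lambda>i. if i = n then [:0, 1:] else [:a i:]"
  define m' where "m' = m - single n ?j"
  have m: "m = m' + single n ?j"
    unfolding m'_def
    by (intro poly_mapping_eqI) (auto simp: lookup_add lookup_minus lookup_single when_def)
  have n: "n \<notin> keys m'" by (simp add: m'_def in_keys_iff lookup_minus)
  have const: "(\<Prod>i\<in>A. [:a i:] ^ g i) = [:\<Prod>i\<in>A. a i ^ g i:]" for A g
    by (induction A rule: infinite_finite_induct)
      (simp_all add: one_pCons poly_const_pow mult.commute)
  have "mon ?x m' = (\<Prod>i\<in>keys m'. [:a i:] ^ lookup m' i)"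
    unfolding mon_def using n by (intro prod.cong) auto
  also have "\<dots> = [:mon a m':]"
    unfolding mon_def by (rule const)
  finally have "eval_last n a (single m c) = [:c * mon a m':] * [:0, 1:] ^ ?j"
    by (subst m) (simp add: eval_last_def pCons_hom.heval_single mon_add mult.commute)
  hence "coeff (eval_last n a (single m c)) k = (if ?j = k then c * mon a m' else 0)"
    by (simp add: monom_altdef[symmetric] flip: smult_monom)
  also have "\<dots> = meval a (slice n k (single m c))"
    by (auto simp: slice_single meval_heval id_hom.heval_single m'_def)
  finally show ?case .
qed (simp add: slice_add eval_last_simps meval_simps)

subsection \<open>The monomial ideals generated by powers of the first variables\<close>

text \<open>The ideal generated by the \<open>N\<close>-th powers of the first \<open>k\<close>
  variables. Described by exponents, membership can be tested monomial by monomial.\<close>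

definition mideal :: "nat \<Rightarrow> nat \<Rightarrow> 'a::comm_ring_1 mpoly set" where
  "mideal N k = {F. \<forall>m\<in>keys F. \<exists>i<k. N \<le> lookup m i}"

lemma mideal_0: "F \<in> mideal N 0 \<longleftrightarrow> F = 0"
proof
  assume "F \<in> mideal N 0"
  hence "keys F = {}" by (auto simp: mideal_def)
  thus "F = 0" using mpoly_sum_singles[of F] by simp
qed (simp add: mideal_def)

lemma mideal_add: "F \<in> mideal N k \<Longrightarrow> G \<in> mideal N k \<Longrightarrow> F + G \<in> mideal N k"
  using keys_add[of F G] by (auto simp: mideal_def)

lemma mideal_uminus: "F \<in> mideal N k \<Longrightarrow> - F \<in> mideal N k"
  by (simp add: mideal_def in_keys_iff)

lemma mideal_diff: "F \<in> mideal N k \<Longrightarrow> G \<in> mideal N k \<Longrightarrow> F - G \<in> mideal N k"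
  using mideal_add[of F N k "- G"] by (simp add: mideal_uminus)

lemma mideal_zero [simp]: "0 \<in> mideal N k"
  by (simp add: mideal_def)

lemma mideal_mult: "F \<in> mideal N k \<Longrightarrow> G * F \<in> mideal N k"
  unfolding mideal_def
proof safe
  fix m assume F: "\<forall>m\<in>keys F. \<exists>i<k. N \<le> lookup m i" and m: "m \<in> keys (G * F)"
  then obtain a b where ab: "m = a + b" "b \<in> keys F" using keys_mult[of G F] by blast
  then obtain i where "i < k" "N \<le> lookup b i" using F by blast
  thus "\<exists>i<k. N \<le> lookup m i" using ab by (intro exI[of _ i]) (simp add: lookup_add)
qed

lemma mideal_sum: "(\<And>i. i \<in> A \<Longrightarrow> f i \<in> mideal N k) \<Longrightarrow> (\<Sum>i\<in>A. f i) \<in> mideal N k"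
  by (induction A rule: infinite_finite_induct) (auto intro: mideal_add)

lemma mideal_mvar_power: "mvar k ^ N * F \<in> mideal N (Suc k)"
proof -
  have "mvar k ^ N \<in> mideal N (Suc k)"
    unfolding mideal_def mvar_power by (auto intro!: exI[of _ k])
  thus ?thesis by (subst mult.commute) (rule mideal_mult)
qed

lemma mideal_Suc: "F \<in> mideal N k \<Longrightarrow> F \<in> mideal N (Suc k)"
  by (auto simp: mideal_def intro: less_SucI)

lemma lookup_single_mult: "lookup (single a (1::'a::comm_ring_1) * F) (a + m) = lookup F (m :: nat \<Rightarrow>\<^sub>0 nat)"
  by (induction F rule: mpoly_induct_single)
    (simp_all add: mult_single lookup_single when_def lookup_add ring_distribs)

text \<open>Multiplication by \<open>mvar k ^ N\<close> changes only the exponent at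
  \<open>k\<close>, whereas membership looks at exponents below \<open>k\<close>. So these powers
  form a regular sequence.\<close>

lemma mideal_regular:
  assumes "mvar k ^ N * F \<in> mideal N k"
  shows "F \<in> mideal N k"
  unfolding mideal_def
proof safe
  fix m assume m: "m \<in> keys F"
  have "single k N + m \<in> keys (mvar k ^ N * F)"
    using m by (simp add: in_keys_iff mvar_power lookup_single_mult)
  then obtain i where "i < k" "N \<le> lookup (single k N + m) i"
    using assms by (auto simp: mideal_def)
  thus "\<exists>i<k. N \<le> lookup m i" by (intro exI[of _ i]) (simp add: lookup_add lookup_single)
qed

lemma mideal_Suc_decomp:
  assumes "F \<in> mideal N (Suc k)"
  shows "\<exists>V. F - mvar k ^ N * V \<in> mideal N k"
proof -
  define P where "P m \<longleftrightarrow> N \<le> lookup m k" for m :: "nat \<Rightarrow>\<^sub>0 nat"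
  define V where "V = (\<Sum>m\<in>{m\<in>keys F. P m}. single (m - single k N) (lookup F m))"
  have "single k N + (m - single k N) = m" if "P m" for m
    using that by (intro poly_mapping_eqI) (auto simp: P_def lookup_add lookup_minus lookup_single when_def)
  hence "mvar k ^ N * V = (\<Sum>m\<in>{m\<in>keys F. P m}. single m (lookup F m))"
    by (auto simp: V_def sum_distrib_left mvar_power mult_single intro!: sum.cong)
  hence V: "lookup (mvar k ^ N * V) m = (if P m then lookup F m else 0)" for m
    by (auto simp: lookup_sum lookup_single when_def in_keys_iff sum.delta)
  have "\<exists>i<k. N \<le> lookup m i" if m: "m \<in> keys (F - mvar k ^ N * V)" for m
  proof -
    have "m \<in> keys F" "\<not> P m" using m by (auto simp: in_keys_iff lookup_minus V split: if_splits)
    thus ?thesis using assms less_Suc_eq by (auto simp: mideal_def P_def)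
  qed
  thus ?thesis by (auto simp: mideal_def)
qed

subsection \<open>The Koszul complex\<close>

text \<open>A chain assigns a coefficient to every finite set of indices; only the values on sets of
  one fixed cardinality matter for a chain of that degree.\<close>

definition ksign :: "nat \<Rightarrow> nat set \<Rightarrow> 'a::comm_ring_1" where
  "ksign j S = (-1) ^ card {s \<in> S. s < j}"

text \<open>The Koszul differential on coefficients: the value at \<open>S\<close> collects what all
  sets \<open>insert j S\<close> contribute, so the degree drops by one.\<close>

definition kbd :: "nat \<Rightarrow> (nat \<Rightarrow> 'a) \<Rightarrow> (nat set \<Rightarrow> 'a) \<Rightarrow> nat set \<Rightarrow> 'a::comm_ring_1" where
  "kbd r f z S = (\<Sum>j\<in>{..<r} - S. ksign j S * f j * z (insert j S))"

text \<open>Exterior multiplication by the basis vector of index \<open>a\<close>.\<close>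

definition kwedge :: "nat \<Rightarrow> (nat set \<Rightarrow> 'a) \<Rightarrow> nat set \<Rightarrow> 'a::comm_ring_1" where
  "kwedge a z S = (if a \<in> S then ksign a S * z (S - {a}) else 0)"

lemma ksign_insert:
  assumes "finite S" "j \<notin> S"
  shows "ksign l (insert j S) = (if j < l then - ksign l S else ksign l S)"
proof (cases "j < l")
  case True
  hence "{s \<in> insert j S. s < l} = insert j {s \<in> S. s < l}" by auto
  thus ?thesis using assms True by (simp add: ksign_def)
next
  case False
  hence "{s \<in> insert j S. s < l} = {s \<in> S. s < l}" by auto
  thus ?thesis using False by (simp add: ksign_def)
qed

lemma ksign_square: "ksign j S * (ksign j S * x) = x"
  by (simp add: ksign_def flip: mult.assoc power_mult_distrib)

text \<open>The diagonal is treated separately because \<open>t j j = - t j j\<close> says nothing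
  in characteristic two.\<close>

lemma sum_antisymmetric_eq_0:
  fixes t :: "'i \<Rightarrow> 'i \<Rightarrow> 'a::ab_group_add"
  assumes "finite A" "\<And>j. j \<in> A \<Longrightarrow> t j j = 0"
    "\<And>j l. j \<in> A \<Longrightarrow> l \<in> A \<Longrightarrow> t j l = - t l j"
  shows "(\<Sum>j\<in>A. \<Sum>l\<in>A. t j l) = 0"
  using assms
proof (induction A)
  case empty
  show ?case by simp
next
  case (insert a A)
  have "(\<Sum>j\<in>A. t j a) = - (\<Sum>l\<in>A. t a l)"
    unfolding sum_negf[symmetric] by (intro sum.cong refl insert.prems(2)) auto
  moreover have "(\<Sum>j\<in>A. \<Sum>l\<in>A. t j l) = 0"
    by (intro insert.IH insert.prems) auto
  moreover have "t a a = 0" by (simp add: insert.prems(1))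
  ultimately show ?case using insert.hyps by (simp add: sum.distrib)
qed

lemma kbd_kbd:
  assumes S: "S \<subseteq> {..<r}"
  shows "kbd r f (kbd r f z) S = 0"
proof -
  have fin: "finite S" using S finite_subset by blast
  define t where "t j l = (if j = l then 0 else
    ksign j S * f j * (ksign l (insert j S) * f l * z (insert l (insert j S))))" for j l
  have "kbd r f (kbd r f z) S = (\<Sum>j\<in>{..<r} - S. \<Sum>l\<in>{..<r} - S. t j l)"
    unfolding kbd_def[of r f "kbd r f z"]
  proof (intro sum.cong refl)
    fix j assume j: "j \<in> {..<r} - S"
    have "(\<Sum>l\<in>{..<r} - S. t j l) = (\<Sum>l\<in>{..<r} - insert j S. t j l)"
      by (intro sum.mono_neutral_right) (auto simp: t_def)
    also have "\<dots> = (\<Sum>l\<in>{..<r} - insert j S.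
        ksign j S * f j * (ksign l (insert j S) * f l * z (insert l (insert j S))))"
      by (intro sum.cong) (auto simp: t_def)
    finally show "ksign j S * f j * kbd r f z (insert j S) = (\<Sum>l\<in>{..<r} - S. t j l)"
      by (simp add: kbd_def sum_distrib_left)
  qed
  also have "\<dots> = 0"
  proof (rule sum_antisymmetric_eq_0)
    fix j l assume "j \<in> {..<r} - S" "l \<in> {..<r} - S"
    thus "t j l = - t l j"
      using fin by (cases j l rule: linorder_cases)
        (auto simp: t_def ksign_insert insert_commute mult_ac)
  qed (auto simp: t_def)
  finally show ?thesis .
qed

text \<open>Wedging with a basis vector is a homotopy from multiplication by \<open>f a\<close> to
  zero; hence the ideal of the \<open>f j\<close> annihilates Koszul homology.\<close>

lemma kbd_kwedge:
  assumes S: "S \<subseteq> {..<r}" and a: "a < r"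
  shows "kbd r f (kwedge a z) S = f a * z S - kwedge a (kbd r f z) S"
proof -
  have fin: "finite S" using S finite_subset by blast
  show ?thesis
  proof (cases "a \<in> S")
    case False
    have "kbd r f (kwedge a z) S
        = (\<Sum>j\<in>{..<r} - S. if j = a then ksign a S * f a * (ksign a (insert a S) * z S) else 0)"
      unfolding kbd_def kwedge_def using False by (intro sum.cong) auto
    also have "\<dots> = ksign a S * (ksign a S * (f a * z S))"
      using False a fin by (simp add: ksign_insert mult_ac)
    finally show ?thesis using False by (simp add: kwedge_def ksign_square)
  next
    case True
    define T where "T = S - {a}"
    have T: "S = insert a T" "a \<notin> T" "finite T" using True fin by (auto simp: T_def)
    have "kwedge a (kbd r f z) S = ksign a S * (\<Sum>j\<in>{..<r} - T. ksign j T * f j * z (insert j T))"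
      using True by (simp add: kwedge_def kbd_def T_def)
    also have "{..<r} - T = insert a ({..<r} - S)" using T a by auto
    also have "(\<Sum>j\<in>\<dots>. ksign j T * f j * z (insert j T))
        = ksign a T * f a * z S + (\<Sum>j\<in>{..<r} - S. ksign j T * f j * z (insert j T))"
      using T by simp
    finally have "kwedge a (kbd r f z) S
        = f a * z S + (\<Sum>j\<in>{..<r} - S. ksign a S * ksign j T * f j * z (insert j T))"
      using ksign_square[of a T "f a * z S"] T
      by (simp add: ring_distribs ksign_insert sum_distrib_left mult_ac)
    moreover have "kbd r f (kwedge a z) S
        = (\<Sum>j\<in>{..<r} - S. - (ksign a S * ksign j T * f j * z (insert j T)))"
      unfolding kbd_def
    proof (intro sum.cong refl)
      fix j assume j: "j \<in> {..<r} - S"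
      have "insert j S - {a} = insert j T" using j T by auto
      moreover have "ksign j S * ksign a (insert j S) = - (ksign a S * ksign j T :: 'a)"
        using j T fin by (cases j a rule: linorder_cases) (auto simp: ksign_insert mult_ac)
      moreover have "ksign j S * f j * (ksign a (insert j S) * x)
          = ksign j S * ksign a (insert j S) * (f j * x)" for x
        by (simp only: mult_ac)
      ultimately show "ksign j S * f j * kwedge a z (insert j S)
          = - (ksign a S * ksign j T * f j * z (insert j T))"
        using True by (simp add: kwedge_def mult.assoc)
    qed
    ultimately show ?thesis by (simp add: sum_negf)
  qed
qed

lemma kbd_linear:
  "kbd r f (\<lambda>S. \<Sum>a\<in>A. c a * z a S) S = (\<Sum>a\<in>A. c a * kbd r f (z a) S)"
  unfolding kbd_def sum_distrib_left sum.swap[of _ A] by (simp add: mult_ac)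

lemma kbd_diff: "kbd r f (\<lambda>S. z S - w S) S = kbd r f z S - kbd r f w S"
  by (simp add: kbd_def ring_distribs sum_subtractf)

lemma kbd_mult: "kbd r f (\<lambda>S. c * z S) S = c * kbd r f z S"
  by (simp add: kbd_def sum_distrib_left mult_ac)

text \<open>Depth sensitivity of the Koszul complex, in explicit form. The key is that \<open>x\<^sub>k\<^sup>N\<close> annihilates
  Koszul homology: a cycle multiplied by it bounds some chain \<open>w\<close>, which modulo \<open>x\<^sub>k\<^sup>N\<close> is itself a cycle
  of one degree higher. Degrees above \<open>r\<close> are void, which starts the descending induction on \<open>k\<close>.\<close>

lemma koszul_acyclic_mod:
  fixes f :: "nat \<Rightarrow> 'a::comm_ring_1 mpoly"
  assumes f: "\<And>i. i < L \<Longrightarrow> mvar i ^ N = (\<Sum>j<r. a i j * f j)"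
    and k: "k \<le> L" and i: "r + k < i + L"
    and z: "\<And>S. S \<subseteq> {..<r} \<Longrightarrow> Suc (card S) = i \<Longrightarrow> kbd r f z S \<in> mideal N k"
  shows "\<exists>w. \<forall>S\<subseteq>{..<r}. card S = i \<longrightarrow> z S - kbd r f w S \<in> mideal N k"
  using k i z
proof (induction "L - k" arbitrary: k i z)
  case 0
  have "card S \<noteq> i" if "S \<subseteq> {..<r}" for S
    using card_mono[OF _ that] 0 by auto
  thus ?case by blast
next
  case (Suc d)
  have k: "k < L" using Suc by auto
  \<comment> \<open>The homotopies for the single \<open>f j\<close>, combined with weights
    \<open>a k j\<close>, form a homotopy for \<open>mvar k ^ N\<close>.\<close>
  define w where "w S = (\<Sum>j<r. a k j * kwedge j z S)" for S
  have w: "kbd r f w S - mvar k ^ N * z S \<in> mideal N k" if S: "S \<subseteq> {..<r}" "card S = i" for S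
  proof -
    have "kbd r f w S = (\<Sum>j<r. a k j * (f j * z S - kwedge j (kbd r f z) S))"
      unfolding w_def kbd_linear using S by (intro sum.cong refl) (simp add: kbd_kwedge)
    also have "\<dots> = mvar k ^ N * z S - (\<Sum>j<r. a k j * kwedge j (kbd r f z) S)"
      by (simp add: f[OF k] right_diff_distrib sum_subtractf sum_distrib_right mult.assoc)
    finally have eq: "kbd r f w S - mvar k ^ N * z S = - (\<Sum>j<r. a k j * kwedge j (kbd r f z) S)"
      by simp
    have fin: "finite S" using S(1) finite_subset by blast
    have "kwedge j (kbd r f z) S \<in> mideal N k" for j
    proof (cases "j \<in> S")
      case True
      have "kbd r f z (S - {j}) \<in> mideal N k"
        using S card_Suc_Diff1[OF fin True] by (intro Suc.prems(3)) (auto simp only: )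
      thus ?thesis using True by (simp add: kwedge_def mideal_mult)
    qed (simp add: kwedge_def)
    thus ?thesis unfolding eq by (intro mideal_uminus mideal_sum mideal_mult)
  qed
  have "\<exists>u. \<forall>S\<subseteq>{..<r}. card S = Suc i \<longrightarrow> w S - kbd r f u S \<in> mideal N (Suc k)"
  proof (rule Suc.hyps(1))
    fix S assume S: "S \<subseteq> {..<r}" "Suc (card S) = Suc i"
    have "kbd r f w S = (kbd r f w S - mvar k ^ N * z S) + mvar k ^ N * z S" by simp
    also have "\<dots> \<in> mideal N (Suc k)"
      using S by (intro mideal_add mideal_Suc w mideal_mvar_power) auto
    finally show "kbd r f w S \<in> mideal N (Suc k)" .
  qed (use Suc k in auto)
  then obtain u where u: "\<And>S. S \<subseteq> {..<r} \<Longrightarrow> card S = Suc i \<Longrightarrow> w S - kbd r f u S \<in> mideal N (Suc k)"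
    by blast
  have "\<exists>V. S \<subseteq> {..<r} \<longrightarrow> card S = Suc i \<longrightarrow> w S - kbd r f u S - mvar k ^ N * V \<in> mideal N k" for S
    using mideal_Suc_decomp[OF u[of S]] by blast
  then obtain v where v: "\<And>S. S \<subseteq> {..<r} \<Longrightarrow> card S = Suc i \<Longrightarrow>
      w S - kbd r f u S - mvar k ^ N * v S \<in> mideal N k" by metis
  \<comment> \<open>Modulo the smaller ideal, \<open>w\<close> is a boundary plus
    \<open>mvar k ^ N * v\<close>. Its boundary is therefore both \<open>mvar k ^ N * z\<close> and
    \<open>mvar k ^ N\<close> times the boundary of \<open>v\<close>; regularity cancels the
    power.\<close>
  have "z S - kbd r f v S \<in> mideal N k" if S: "S \<subseteq> {..<r}" "card S = i" for S
  proof (rule mideal_regular)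
    have fin: "finite S" using S(1) finite_subset by blast
    have "kbd r f (\<lambda>S. w S - kbd r f u S - mvar k ^ N * v S) S \<in> mideal N k"
      unfolding kbd_def[of r f "\<lambda>S. w S - kbd r f u S - mvar k ^ N * v S"]
      using S fin by (intro mideal_sum mideal_mult v) auto
    hence "kbd r f w S - mvar k ^ N * kbd r f v S \<in> mideal N k"
      using S by (simp add: kbd_diff kbd_mult kbd_kbd)
    from mideal_diff[OF this w[OF S]]
    show "mvar k ^ N * (z S - kbd r f v S) \<in> mideal N k" by (simp add: ring_distribs)
  qed
  thus ?case by blast
qed

theorem koszul_acyclic:
  fixes f :: "nat \<Rightarrow> 'a::comm_ring_1 mpoly"
  assumes "\<And>i. i < L \<Longrightarrow> \<exists>N a. mvar i ^ N = (\<Sum>j<r. a j * f j)"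
    and "r < i + L"
    and "\<And>S. S \<subseteq> {..<r} \<Longrightarrow> Suc (card S) = i \<Longrightarrow> kbd r f z S = 0"
  shows "\<exists>w. \<forall>S\<subseteq>{..<r}. card S = i \<longrightarrow> z S = kbd r f w S"
proof -
  obtain M b where b: "\<And>i. i < L \<Longrightarrow> mvar i ^ M i = (\<Sum>j<r. b i j * f j)"
    using assms(1) by metis
  define N where "N = (\<Sum>i<L. M i)"
  have "mvar i ^ N = (\<Sum>j<r. (mvar i ^ (N - M i) * b i j) * f j)" if i: "i < L" for i
  proof -
    have "M i \<le> N" unfolding N_def using i by (intro member_le_sum) auto
    hence "mvar i ^ N = mvar i ^ (N - M i) * (mvar i ^ M i :: 'a mpoly)" by (simp flip: power_add)
    thus ?thesis using b[OF i] by (simp add: sum_distrib_left mult_ac)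
  qed
  from koszul_acyclic_mod[where k = 0 and i = i and z = z, OF this] assms(2,3) show ?thesis
    by (simp add: mideal_0)
qed

subsection \<open>A projective Nullstellensatz\<close>

text \<open>An ideal of the polynomial ring in the variables below \<open>n\<close> only, so that
  contraction to fewer variables is again of this kind.\<close>

definition homog_ideal :: "nat \<Rightarrow> 'a::comm_ring_1 mpoly set \<Rightarrow> bool" where
  "homog_ideal n I \<longleftrightarrow> 0 \<in> I \<and> (\<forall>F\<in>I. vars_in {..<n} F) \<and> (\<forall>F\<in>I. \<forall>G\<in>I. F + G \<in> I) \<and>
     (\<forall>F\<in>I. \<forall>G. vars_in {..<n} G \<longrightarrow> G * F \<in> I) \<and> (\<forall>F\<in>I. \<forall>k. hcomp k F \<in> I)"

lemma homog_idealD: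
  assumes "homog_ideal n I"
  shows "0 \<in> I" "F \<in> I \<Longrightarrow> vars_in {..<n} F" "F \<in> I \<Longrightarrow> G \<in> I \<Longrightarrow> F + G \<in> I"
    "F \<in> I \<Longrightarrow> vars_in {..<n} G \<Longrightarrow> G * F \<in> I" "F \<in> I \<Longrightarrow> hcomp k F \<in> I"
  using assms by (auto simp: homog_ideal_def)

lemma homog_ideal_diff:
  assumes "homog_ideal n I" "F \<in> I" "G \<in> I" shows "F - G \<in> I"
proof -
  have "F + mconst (- 1) * G \<in> I" using assms by (intro homog_idealD(3,4)[OF assms(1)]) auto
  thus ?thesis by (simp add: mconst_uminus)
qed

lemma homog_ideal_sum:
  assumes "homog_ideal n I" "\<And>i. i \<in> A \<Longrightarrow> f i \<in> I" shows "(\<Sum>i\<in>A. f i) \<in> I"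
  using assms(2) by (induction A rule: infinite_finite_induct) (auto intro: homog_idealD[OF assms(1)])

lemma vars_in_of_nat [simp]: "vars_in S (of_nat k)"
  by (metis mconst_of_nat vars_in_mconst)

definition radical :: "nat \<Rightarrow> 'a::comm_ring_1 mpoly set \<Rightarrow> 'a mpoly set" where
  "radical n I = {F. vars_in {..<n} F \<and> (\<exists>N. F ^ N \<in> I)}"

lemma radical_add:
  assumes I: "homog_ideal n I" and F: "F \<in> radical n I" and G: "G \<in> radical n I"
  shows "F + G \<in> radical n I"
proof -
  obtain a b where ab: "F ^ a \<in> I" "G ^ b \<in> I" and v: "vars_in {..<n} F" "vars_in {..<n} G"
    using F G by (auto simp: radical_def)
  have "of_nat ((a + b) choose k) * F ^ k * G ^ (a + b - k) \<in> I" for k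
  proof (cases "a \<le> k")
    case True
    have "(of_nat ((a + b) choose k) * F ^ (k - a) * G ^ (a + b - k)) * F ^ a \<in> I"
      using v by (intro homog_idealD(4)[OF I ab(1)] vars_in_mult vars_in_power) auto
    moreover have "F ^ k = F ^ (k - a) * F ^ a" using True by (simp flip: power_add)
    ultimately show ?thesis by (simp add: mult_ac)
  next
    case False
    have "(of_nat ((a + b) choose k) * F ^ k * G ^ (a - k)) * G ^ b \<in> I"
      using v by (intro homog_idealD(4)[OF I ab(2)] vars_in_mult vars_in_power) auto
    moreover have "G ^ (a + b - k) = G ^ (a - k) * G ^ b" using False by (simp flip: power_add)
    ultimately show ?thesis by (simp add: mult_ac)
  qed
  hence "(F + G) ^ (a + b) \<in> I"
    unfolding binomial_ring by (intro homog_ideal_sum[OF I])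
  thus ?thesis using v by (auto simp: radical_def intro: vars_in_add)
qed

lemma radical_mult:
  assumes I: "homog_ideal n I" and F: "F \<in> radical n I" and G: "vars_in {..<n} G"
  shows "G * F \<in> radical n I"
proof -
  obtain a where "F ^ a \<in> I" "vars_in {..<n} F" using F by (auto simp: radical_def)
  hence "(G * F) ^ a \<in> I"
    unfolding power_mult_distrib using G by (intro homog_idealD(4)[OF I] vars_in_power)
  thus ?thesis using F G by (auto simp: radical_def intro: vars_in_mult)
qed

lemma radical_sum:
  assumes "homog_ideal n I" "\<And>i. i \<in> A \<Longrightarrow> f i \<in> radical n I"
  shows "(\<Sum>i\<in>A. f i) \<in> radical n I"
proof -
  have "0 \<in> radical n I"
    using homog_idealD(1)[OF assms(1)] by (auto simp: radical_def intro!: exI[of _ 1])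
  thus ?thesis using assms(2)
    by (induction A rule: infinite_finite_induct) (auto intro: radical_add[OF assms(1)])
qed

lemma positive_degree_in_radical:
  assumes I: "homog_ideal n I" and F: "vars_in S F" "homogeneous k F" "k > 0"
    and S: "\<And>i. i \<in> S \<Longrightarrow> mvar i \<in> radical n I" "S \<subseteq> {..<n}"
  shows "F \<in> radical n I"
proof -
  have "single m (lookup F m) \<in> radical n I" if m: "m \<in> keys F" for m
  proof -
    have "mdeg m \<noteq> 0" using F m by (auto simp: homogeneous_iff)
    then obtain i where i: "i \<in> keys m" unfolding mdeg_def by (auto simp: sum_eq_0_iff)
    hence "i \<in> S" using F m by (auto simp: vars_in_def)
    have "single m (lookup F m) = single (m - single i 1) (lookup F m) * mvar i"
    proof -
      have "m - single i 1 + single i 1 = m"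
        using i by (intro poly_mapping_eqI) (auto simp: lookup_add lookup_minus lookup_single when_def in_keys_iff)
      thus ?thesis by (simp add: mvar_def mult_single)
    qed
    moreover have "vars_in {..<n} (single (m - single i 1) (lookup F m))"
    proof -
      have "keys (m - single i 1) \<subseteq> keys m" by (auto simp: in_keys_iff lookup_minus)
      thus ?thesis using F m S(2) by (auto simp: vars_in_def)
    qed
    ultimately show ?thesis using radical_mult[OF I S(1)[OF \<open>i \<in> S\<close>]] by simp
  qed
  hence "(\<Sum>m\<in>keys F. single m (lookup F m)) \<in> radical n I" by (intro radical_sum[OF I])
  thus ?thesis using mpoly_sum_singles[of F] by simp
qed

text \<open>Nakayama's lemma at the maximal ideal of the point \<open>a\<close>, by successively eliminating generators.\<close>

lemma nakayama_elimination:
  fixes I :: "'a::field mpoly set" and e :: nat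
  assumes add: "\<And>F G. F \<in> I \<Longrightarrow> G \<in> I \<Longrightarrow> F + G \<in> I"
    and mult: "\<And>F G. F \<in> I \<Longrightarrow> vars_in S G \<Longrightarrow> G * F \<in> I" and zero: "0 \<in> I"
    and r: "vars_in S r" "meval a r \<noteq> 0"
    and c: "\<And>i j. vars_in S (c i j)" "\<And>i j. meval a (c i j) = 0"
    and rel: "\<And>i. i < e \<Longrightarrow> r * u i - (\<Sum>j<e. c i j * u j) \<in> I"
  shows "\<exists>s. vars_in S s \<and> meval a s \<noteq> 0 \<and> (\<forall>i<e. s * u i \<in> I)"
  using r c rel
proof (induction e arbitrary: r c)
  case 0
  thus ?case by auto
next
  case (Suc l)
  \<comment> \<open>The pivot: \<open>c l l\<close> vanishes at \<open>a\<close> and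
    \<open>r\<close> does not, so \<open>s\<close> is invertible at \<open>a\<close>.\<close>
  define s where "s = r - c l l"
  have s: "vars_in S s" "meval a s \<noteq> 0"
    using Suc.prems by (auto simp: s_def meval_simps intro: vars_in_diff)
  have l: "s * u l - (\<Sum>j<l. c l j * u j) \<in> I"
    using Suc.prems(5)[of l] by (simp add: s_def algebra_simps)
  \<comment> \<open>Relation \<open>i\<close> times \<open>s\<close>, plus \<open>c i l\<close>
    times relation \<open>l\<close>, no longer contains \<open>u l\<close>; the new coefficients
    still vanish at \<open>a\<close>.\<close>
  define c' where "c' i j = s * c i j + c i l * c l j" for i j
  have "\<exists>t. vars_in S t \<and> meval a t \<noteq> 0 \<and> (\<forall>i<l. t * u i \<in> I)"
  proof (rule Suc.IH[where r = "r * s" and c = c'])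
    fix i assume i: "i < l"
    have "s * (r * u i - (\<Sum>j<Suc l. c i j * u j)) + c i l * (s * u l - (\<Sum>j<l. c l j * u j)) \<in> I"
      using Suc.prems i s by (intro add mult l) auto
    also have "s * (r * u i - (\<Sum>j<Suc l. c i j * u j)) + c i l * (s * u l - (\<Sum>j<l. c l j * u j))
        = r * s * u i - (\<Sum>j<l. c' i j * u j)"
      by (simp add: c'_def algebra_simps sum.distrib sum_distrib_left)
    finally show "r * s * u i - (\<Sum>j<l. c' i j * u j) \<in> I" .
  qed (use Suc.prems s in \<open>auto simp: c'_def meval_simps intro!: vars_in_add vars_in_mult\<close>)
  then obtain t where t: "vars_in S t" "meval a t \<noteq> 0" "\<And>i. i < l \<Longrightarrow> t * u i \<in> I" by blast
  have "t * s * u i \<in> I" if "i < Suc l" for i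
  proof (cases "i = l")
    case False
    have "s * (t * u i) \<in> I" using that False by (intro mult[OF t(3) s(1)]) auto
    thus ?thesis by (simp add: mult_ac)
  next
    case True
    have sum: "(\<Sum>j\<in>A. c l j * (t * u j)) \<in> I" if "A \<subseteq> {..<l}" for A
    proof -
      have "finite A" using that finite_subset by blast
      thus ?thesis using that by (induction A) (auto intro!: zero add mult t Suc.prems)
    qed
    have "t * (s * u l - (\<Sum>j<l. c l j * u j)) + (\<Sum>j<l. c l j * (t * u j)) \<in> I"
      using t l by (intro add mult sum) auto
    thus ?thesis using True by (simp add: algebra_simps sum_distrib_left)
  qed
  thus ?case using s t by (intro exI[of _ "t * s"]) (auto simp: meval_simps intro: vars_in_mult)
qed

lemma eval_last_surj: "\<exists>Q. vars_in {n} Q \<and> eval_last n a Q = s"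
proof -
  have "eval_last n a (\<Sum>k\<le>degree s. mconst (coeff s k) * mvar n ^ k)
      = (\<Sum>k\<le>degree s. monom (coeff s k) k)"
    unfolding eval_last_simps by (intro sum.cong refl) (simp add: monom_altdef)
  also have "\<dots> = s" by (rule poly_as_sum_of_monoms)
  finally show ?thesis
    by (intro exI[of _ "\<Sum>k\<le>degree s. mconst (coeff s k) * mvar n ^ k"])
      (auto intro!: vars_in_sum vars_in_mult vars_in_power)
qed

text \<open>The restrictions of \<open>I\<close> to the fibre form an ideal of univariate
  polynomials. A nonzero element of least degree generates it and, unless 1 is present, is
  nonconstant, so its root is common to all. If all restrictions are zero, any \<open>t\<close>
  serves.\<close>

lemma univariate_fibre_zero:
  fixes I :: "'a::alg_closed_field mpoly set"
  assumes I: "homog_ideal (Suc n) I" and one: "\<And>F. F \<in> I \<Longrightarrow> eval_last n a F \<noteq> 1"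
  shows "\<exists>t. \<forall>F\<in>I. meval (a(n := t)) F = 0"
proof (cases "\<exists>F\<in>I. eval_last n a F \<noteq> 0")
  case False
  thus ?thesis by (auto simp flip: poly_eval_last)
next
  case True
  then obtain F where F: "F \<in> I" "eval_last n a F \<noteq> 0"
    and min: "\<And>G. G \<in> I \<Longrightarrow> eval_last n a G \<noteq> 0 \<Longrightarrow> degree (eval_last n a F) \<le> degree (eval_last n a G)"
    using ex_has_least_nat[of "\<lambda>F. F \<in> I \<and> eval_last n a F \<noteq> 0" _ "\<lambda>F. degree (eval_last n a F)"] by blast
  let ?h = "eval_last n a F"
  have "degree ?h > 0"
  proof (rule ccontr)
    assume "\<not> degree ?h > 0"
    then obtain b where b: "?h = [:b:]" using degree_eq_zeroE by blast
    hence "b \<noteq> 0" using F by auto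
    hence "eval_last n a (mconst (inverse b) * F) = 1"
      by (simp add: eval_last_simps b one_pCons)
    moreover have "mconst (inverse b) * F \<in> I" by (intro homog_idealD(4)[OF I] F) auto
    ultimately show False using one by blast
  qed
  then obtain t where t: "poly ?h t = 0" using alg_closed_imp_poly_has_root by blast
  have "?h dvd eval_last n a G" if G: "G \<in> I" for G
  proof (rule ccontr)
    assume nd: "\<not> ?h dvd eval_last n a G"
    obtain Q where Q: "vars_in {n} Q" "eval_last n a Q = eval_last n a G div ?h"
      using eval_last_surj by blast
    have "vars_in {..<Suc n} Q" using Q(1) by (rule vars_in_mono) auto
    hence "G - Q * F \<in> I" using G F by (intro homog_ideal_diff[OF I] homog_idealD(4)[OF I])
    moreover have "eval_last n a (G - Q * F) = eval_last n a G mod ?h"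
      by (simp add: eval_last_simps Q minus_div_mult_eq_mod)
    moreover have "eval_last n a G mod ?h \<noteq> 0" using nd by (simp add: dvd_eq_mod_eq_0)
    ultimately show False
      using min[of "G - Q * F"] degree_mod_less'[of ?h "eval_last n a G"] F by auto
  qed
  hence "poly (eval_last n a G) t = 0" if "G \<in> I" for G using t that by (meson dvd_trans poly_eq_0_iff_dvd)
  thus ?thesis by (auto simp: poly_eval_last)
qed

text \<open>Nonvanishing at (0, ..., 0, 1) means that a pure power of \<open>mvar n\<close> occurs
  in \<open>F\<close>. The component of that degree lies in \<open>I\<close> and is monic in
  \<open>mvar n\<close> up to a scalar; its lower coefficients are forms of positive degree.\<close>

lemma monic_relation:
  fixes I :: "'a::field mpoly set"
  assumes I: "homog_ideal (Suc n) I"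
    and F: "F \<in> I" "meval (\<lambda>i. if i = n then 1 else 0) F \<noteq> 0"
  obtains e \<rho> where "\<And>k. vars_in {..<n} (\<rho> k)" "\<And>k. k < e \<Longrightarrow> homogeneous (e - k) (\<rho> k)"
    "mvar n ^ e - (\<Sum>k<e. \<rho> k * mvar n ^ k) \<in> I"
proof -
  let ?x = "\<lambda>i. if i = n then 1 else (0::'a)"
  have "\<exists>m\<in>keys F. mon ?x m \<noteq> 0"
    using F(2) unfolding meval_heval heval_def by (auto intro: ccontr)
  then obtain m where m: "m \<in> keys F" "mon ?x m \<noteq> 0" by blast
  define e where "e = lookup m n"
  have "keys m \<subseteq> {n}"
  proof
    fix i assume i: "i \<in> keys m"
    have "?x i ^ lookup m i \<noteq> 0" using m(2) i by (auto simp: mon_def)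
    thus "i \<in> {n}" using i by (auto simp: in_keys_iff split: if_splits)
  qed
  hence meq: "m = single n e"
    by (intro poly_mapping_eqI) (auto simp: e_def lookup_single when_def in_keys_iff)
  define g where "g = hcomp e F"
  have gI: "g \<in> I" unfolding g_def by (rule homog_idealD(5)[OF I F(1)])
  have hg: "homogeneous e g" by (simp add: g_def)
  define c where "c = lookup (slice n e g) 0"
  have "c = lookup F m" by (simp add: c_def lookup_slice g_def lookup_hcomp meq)
  hence c: "c \<noteq> 0" using m(1) by (auto simp: in_keys_iff)
  have top: "slice n e g = mconst c"
    unfolding c_def by (rule homogeneous_0_imp_mconst) (use homogeneous_slice[OF hg, of e n] in simp)
  obtain D where D: "\<And>E. E \<ge> D \<Longrightarrow> g = (\<Sum>k\<le>E. slice n k g * mvar n ^ k)"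
    using slice_expansion[of g n] by blast
  have "g = (\<Sum>k\<le>max D e. slice n k g * mvar n ^ k)" by (rule D) simp
  also have "\<dots> = (\<Sum>k\<le>e. slice n k g * mvar n ^ k)"
    by (intro sum.mono_neutral_right) (auto simp: slice_eq_0_beyond[OF hg])
  also have "\<dots> = (\<Sum>k<e. slice n k g * mvar n ^ k) + mconst c * mvar n ^ e"
    by (simp add: top flip: lessThan_Suc_atMost)
  finally have g: "g = (\<Sum>k<e. slice n k g * mvar n ^ k) + mconst c * mvar n ^ e" .
  define \<rho> where "\<rho> k = - mconst (inverse c) * slice n k g" for k
  show thesis
  proof
    fix k
    have "vars_in ({..<Suc n} - {n}) (slice n k g)"
      by (intro vars_in_slice homog_idealD(2)[OF I gI])
    moreover have "{..<Suc n} - {n} = {..<n}" by auto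
    ultimately have "vars_in {..<n} (slice n k g)" by (simp only:)
    thus "vars_in {..<n} (\<rho> k)" by (simp add: \<rho>_def vars_in_mult)
    show "homogeneous (e - k) (\<rho> k)"
      unfolding \<rho>_def using homogeneous_slice[OF hg] by (simp add: homogeneous_mult_mconst)
  next
    have "mconst (inverse c) * g \<in> I" by (intro homog_idealD(4)[OF I gI]) simp
    also have "mconst (inverse c) * g = mvar n ^ e - (\<Sum>k<e. \<rho> k * mvar n ^ k)"
    proof -
      have "mconst (inverse c) * (mconst c * mvar n ^ e) = mvar n ^ e"
        using c by (simp flip: mult.assoc mconst_mult)
      thus ?thesis
        by (subst g) (simp add: ring_distribs \<rho>_def sum_distrib_left sum_negf mult.assoc)
    qed
    finally show "mvar n ^ e - (\<Sum>k<e. \<rho> k * mvar n ^ k) \<in> I" .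
  qed
qed

text \<open>Finiteness of the projection: modulo \<open>I\<close>, the powers of
  \<open>mvar n\<close> below \<open>e\<close> generate all others over the polynomials in the
  variables below \<open>n\<close>.\<close>

lemma reduce_powers:
  assumes I: "homog_ideal (Suc n) I"
    and \<rho>: "\<And>k. vars_in {..<n} (\<rho> k)" and rel: "mvar n ^ e - (\<Sum>k<e. \<rho> k * mvar n ^ k) \<in> I"
  shows "\<exists>\<sigma>. (\<forall>j. vars_in {..<n} (\<sigma> j)) \<and> mvar n ^ l - (\<Sum>j<e. \<sigma> j * mvar n ^ j) \<in> I"
proof (induction l rule: less_induct)
  case (less l)
  have up: "vars_in {..<Suc n} F" if "vars_in {..<n} F" for F :: "'a mpoly"
    using that by (rule vars_in_mono) auto
  show ?case
  proof (cases "l < e")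
    case True
    hence "mvar n ^ l - (\<Sum>j<e. (if j = l then 1 else 0) * mvar n ^ j) = (0 :: 'a mpoly)"
      by (simp add: if_distrib[of "\<lambda>x. x * _"] cong: if_cong)
    thus ?thesis
      using homog_idealD(1)[OF I]
      by (intro exI[of _ "\<lambda>j. if j = l then 1 else 0"]) auto
  next
    case False
    have "\<forall>k<e. \<exists>\<sigma>. (\<forall>j. vars_in {..<n} (\<sigma> j)) \<and>
        mvar n ^ (l - e + k) - (\<Sum>j<e. \<sigma> j * mvar n ^ j) \<in> I"
      using False by (intro allI impI less.IH) auto
    then obtain \<sigma> where \<sigma>: "\<And>k j. k < e \<Longrightarrow> vars_in {..<n} (\<sigma> k j)"
      "\<And>k. k < e \<Longrightarrow> mvar n ^ (l - e + k) - (\<Sum>j<e. \<sigma> k j * mvar n ^ j) \<in> I" by metis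
    define \<tau> where "\<tau> j = (\<Sum>k<e. \<rho> k * \<sigma> k j)" for j
    have "mvar n ^ (l - e) * (mvar n ^ e - (\<Sum>k<e. \<rho> k * mvar n ^ k))
        + (\<Sum>k<e. \<rho> k * (mvar n ^ (l - e + k) - (\<Sum>j<e. \<sigma> k j * mvar n ^ j))) \<in> I"
      using \<rho> \<sigma>
      by (intro homog_idealD(3)[OF I] homog_idealD(4)[OF I] homog_ideal_sum[OF I] rel vars_in_power)
        (auto intro: up)
    also have "mvar n ^ (l - e) * (mvar n ^ e - (\<Sum>k<e. \<rho> k * mvar n ^ k))
        + (\<Sum>k<e. \<rho> k * (mvar n ^ (l - e + k) - (\<Sum>j<e. \<sigma> k j * mvar n ^ j)))
        = mvar n ^ l - (\<Sum>j<e. \<tau> j * mvar n ^ j)"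
    proof -
      have "mvar n ^ (l - e) * mvar n ^ e = (mvar n ^ l :: 'a mpoly)"
        using False by (simp flip: power_add)
      moreover have "(\<Sum>j<e. \<tau> j * mvar n ^ j) = (\<Sum>k<e. \<rho> k * (\<Sum>j<e. \<sigma> k j * mvar n ^ j))"
        unfolding \<tau>_def sum_distrib_left sum_distrib_right
        by (subst sum.swap) (simp add: mult.assoc)
      ultimately show ?thesis
        by (simp add: right_diff_distrib sum_subtractf sum_distrib_left power_add mult_ac)
    qed
    finally show ?thesis
      using \<rho> \<sigma> by (intro exI[of _ \<tau>]) (auto simp: \<tau>_def intro!: vars_in_sum vars_in_mult)
  qed
qed

text \<open>The point \<open>(0, \<dots>, 0, 1)\<close> is not a zero of the ideal, so projecting from it is a finite map and no
  generic change of coordinates is needed.\<close>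

theorem projective_nullstellensatz:
  fixes I :: "'a::alg_closed_field mpoly set"
  assumes "homog_ideal n I"
    and "\<And>a. \<exists>i<n. a i \<noteq> 0 \<Longrightarrow> \<exists>F\<in>I. meval a F \<noteq> 0"
    and "i < n"
  shows "\<exists>N. mvar i ^ N \<in> I"
  using assms
proof (induction n arbitrary: I i)
  case 0
  thus ?case by simp
next
  case (Suc n)
  note I = Suc.prems(1)
  have up: "vars_in {..<Suc n} F" if "vars_in {..<n} F" for F :: "'a mpoly"
    using that by (rule vars_in_mono) auto
  have "\<exists>i<Suc n. (if i = n then 1 else 0 :: 'a) \<noteq> 0" by (intro exI[of _ n]) simp
  from Suc.prems(2)[OF this] obtain F0
    where F0: "F0 \<in> I" "meval (\<lambda>i. if i = n then 1 else 0) F0 \<noteq> 0" by blast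
  obtain e \<rho> where \<rho>: "\<And>k. vars_in {..<n} (\<rho> k)" "\<And>k. k < e \<Longrightarrow> homogeneous (e - k) (\<rho> k)"
    and rel: "mvar n ^ e - (\<Sum>k<e. \<rho> k * mvar n ^ k) \<in> I"
    by (rule monic_relation[OF I F0]) (rule that; assumption)
  \<comment> \<open>The elimination ideal, to which the induction hypothesis applies if it has no
    projective zero.\<close>
  define I' where "I' = {F\<in>I. vars_in {..<n} F}"
  have I': "homog_ideal n I'"
    unfolding homog_ideal_def I'_def
    by (auto intro: homog_idealD[OF I] vars_in_add vars_in_mult vars_in_hcomp up)
  show ?case
  proof (cases "\<forall>a. (\<exists>i<n. a i \<noteq> 0) \<longrightarrow> (\<exists>F\<in>I'. meval a F \<noteq> 0)")
    case True
    have lower: "\<exists>N. mvar i ^ N \<in> I" if "i < n" for i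
      using Suc.IH[OF I' _ that] True by (auto simp: I'_def)
    hence rad: "mvar i \<in> radical (Suc n) I" if "i < n" for i
      using that by (auto simp: radical_def)
    \<comment> \<open>The \<open>\<rho> k\<close> are forms of positive degree in variables already
      in the radical, so the monic relation puts \<open>mvar n\<close> there too.\<close>
    have "mvar n ^ e - (\<Sum>k<e. \<rho> k * mvar n ^ k) \<in> radical (Suc n) I"
      using rel homog_idealD(2)[OF I rel] by (auto simp: radical_def intro: exI[of _ 1])
    moreover have "(\<Sum>k<e. mvar n ^ k * \<rho> k) \<in> radical (Suc n) I"
    proof (intro radical_sum[OF I] radical_mult[OF I])
      fix k assume "k \<in> {..<e}"
      hence k: "k < e" by simp
      show "\<rho> k \<in> radical (Suc n) I"
        by (rule positive_degree_in_radical[OF I \<rho>(1) \<rho>(2)[OF k]]) (use k rad in auto)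
    qed (simp add: vars_in_power)
    ultimately have "(mvar n ^ e - (\<Sum>k<e. \<rho> k * mvar n ^ k)) + (\<Sum>k<e. mvar n ^ k * \<rho> k)
        \<in> radical (Suc n) I"
      by (rule radical_add[OF I])
    hence "mvar n ^ e \<in> radical (Suc n) I" by (simp add: mult.commute)
    then obtain N where "mvar n ^ (e * N) \<in> I" by (auto simp: radical_def power_mult)
    thus ?thesis using lower Suc.prems(3) by (metis less_Suc_eq)
  next
    case False
    \<comment> \<open>Lying over: a zero \<open>a\<close> of \<open>I'\<close> should extend to a
      zero of \<open>I\<close>. If it does not, the ideal of the fibre contains 1, and the
      contradiction sought is an element of \<open>I'\<close> that does not vanish at
      \<open>a\<close>.\<close>
    then obtain a i0 where a: "i0 < n" "a i0 \<noteq> 0" and van: "\<And>F. F \<in> I' \<Longrightarrow> meval a F = 0" by blast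
    have "\<exists>F\<in>I. meval (a(n := t)) F \<noteq> 0" for t
      using a by (intro Suc.prems(2) exI[of _ i0]) auto
    then obtain F where F: "F \<in> I" "eval_last n a F = 1"
      using univariate_fibre_zero[OF I, of a] by meson
    define f where "f k = slice n k F" for k
    have "{..<Suc n} - {n} = {..<n}" by auto
    hence fv: "vars_in {..<n} (f k)" for k
      unfolding f_def using vars_in_slice[OF homog_idealD(2)[OF I F(1)], of n k] by simp
    have fa: "meval a (f k) = (if k = 0 then 1 else 0)" for k
      unfolding f_def by (simp add: F(2) flip: coeff_eval_last)
    obtain E where "F = (\<Sum>k\<le>E. f k * mvar n ^ k)"
      unfolding f_def using slice_expansion[of F n] by blast
    hence FE: "F = f 0 + (\<Sum>k=1..E. f k * mvar n ^ k)"
      by (simp add: sum.atMost_shift atMost_atLeast0 sum.atLeast_Suc_atMost)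
    obtain \<sigma> where \<sigma>: "\<And>l j. vars_in {..<n} (\<sigma> l j)"
      "\<And>l. mvar n ^ l - (\<Sum>j<e. \<sigma> l j * mvar n ^ j) \<in> I"
      using reduce_powers[OF I \<rho>(1) rel] by metis
    define c where "c i j = - (\<Sum>k=1..E. f k * \<sigma> (i + k) j)" for i j
    have "\<exists>s. vars_in {..<n} s \<and> meval a s \<noteq> 0 \<and> (\<forall>i<e. s * mvar n ^ i \<in> I)"
    proof (rule nakayama_elimination[where r = "f 0" and c = c])
      fix i
      \<comment> \<open>Reducing the higher powers in \<open>mvar n ^ i * F\<close> gives a linear
        system for the powers below \<open>e\<close>: its leading coefficient \<open>f 0\<close> is
        1 at \<open>a\<close>, and all other coefficients vanish there, as Nakayama
        requires.\<close>
      have "mvar n ^ i * F - (\<Sum>k=1..E. f k * (mvar n ^ (i + k) - (\<Sum>j<e. \<sigma> (i + k) j * mvar n ^ j))) \<in> I"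
        by (intro homog_ideal_diff[OF I homog_idealD(4)[OF I F(1)]] homog_ideal_sum[OF I]
            homog_idealD(4)[OF I \<sigma>(2)] up[OF fv]) (simp add: vars_in_power)
      also have "mvar n ^ i * F - (\<Sum>k=1..E. f k * (mvar n ^ (i + k) - (\<Sum>j<e. \<sigma> (i + k) j * mvar n ^ j)))
          = f 0 * mvar n ^ i - (\<Sum>j<e. c i j * mvar n ^ j)"
      proof -
        have "(\<Sum>j<e. c i j * mvar n ^ j) = - (\<Sum>k=1..E. f k * (\<Sum>j<e. \<sigma> (i + k) j * mvar n ^ j))"
          unfolding c_def sum_distrib_left sum_distrib_right minus_mult_left[symmetric] sum_negf
          by (subst sum.swap) (simp add: mult.assoc)
        thus ?thesis
          by (subst FE) (simp add: ring_distribs sum_subtractf sum_distrib_left power_add mult_ac)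
      qed
      finally show "f 0 * mvar n ^ i - (\<Sum>j<e. c i j * mvar n ^ j) \<in> I" .
    qed (use homog_idealD[OF I] fv \<sigma> up in
        \<open>auto simp: c_def fa meval_simps intro!: vars_in_sum vars_in_mult\<close>)
    then obtain s where s: "vars_in {..<n} s" "meval a s \<noteq> 0" "\<And>i. i < e \<Longrightarrow> s * mvar n ^ i \<in> I" by blast
    \<comment> \<open>Only the power with exponent 0 matters; if \<open>e = 0\<close> there is none,
      but then the monic relation says that 1 lies in \<open>I\<close>.\<close>
    have "s \<in> I"
    proof (cases "e = 0")
      case True
      hence "1 \<in> I" using rel by simp
      from homog_idealD(4)[OF I this up[OF s(1)]] show ?thesis by simp
    next
      case False
      thus ?thesis using s(3)[of 0] by simp
    qed
    hence "s \<in> I'" using s by (simp add: I'_def)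
    thus ?thesis using van s(2) by blast
  qed
qed

text \<open>Coefficients descend along a linear retraction of the algebraic closure onto the base field.\<close>

lemma ac_retraction:
  obtains \<pi> :: "'a::field alg_closure \<Rightarrow> 'a"
  where "\<And>x y. \<pi> (x + y) = \<pi> x + \<pi> y" "\<And>c x. \<pi> (to_ac c * x) = c * \<pi> x" "\<pi> 1 = 1"
proof -
  interpret V: vector_space_pair "\<lambda>c x. to_ac c * (x :: 'a alg_closure)" "(*) :: 'a \<Rightarrow> 'a \<Rightarrow> 'a"
    by standard (auto simp: algebra_simps)
  have "V.vs1.independent {1}" by (simp add: V.vs1.dependent_single)
  then obtain g where g: "Vector_Spaces.linear (\<lambda>c x. to_ac c * (x :: 'a alg_closure)) (*) g" "g 1 = 1"
    using V.linear_independent_extend[of "{1}" "\<lambda>_. 1"] by auto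
  thus thesis
    using that[of g] V.linear_add[OF g(1)] V.linear_scale[OF g(1)] by blast
qed

text \<open>The Nullstellensatz applies to the ideal extended to the closure. Applying
  \<open>\<pi>\<close> to coefficients fixes \<open>mvar i ^ N\<close>, pulls the \<open>f j\<close>
  out by linearity, and leaves cofactors over the base field.\<close>

theorem power_in_ideal_if_no_common_zero:
  fixes f :: "nat \<Rightarrow> 'a::field mpoly"
  assumes f: "\<And>j. j < r \<Longrightarrow> vars_in {..<n} (f j)" "\<And>j. j < r \<Longrightarrow> homogeneous (d j) (f j)"
    and nz: "\<And>x :: nat \<Rightarrow> 'a alg_closure. \<exists>i<n. x i \<noteq> 0 \<Longrightarrow> \<exists>j<r. heval to_ac x (f j) \<noteq> 0"
    and i: "i < n"
  shows "\<exists>N a. mvar i ^ N = (\<Sum>j<r. a j * f j)"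
proof -
  let ?f = "\<lambda>j. Poly_Mapping.map to_ac (f j)"
  define I where "I = {\<Sum>j<r. b j * ?f j | b. \<forall>j. vars_in {..<n} (b j)}"
  have I: "homog_ideal n I"
    unfolding homog_ideal_def
  proof (intro conjI ballI allI impI)
    show "0 \<in> I" unfolding I_def by (rule CollectI, rule exI[of _ "\<lambda>_. 0"]) simp
  next
    fix F assume "F \<in> I"
    then obtain b where b: "F = (\<Sum>j<r. b j * ?f j)" "\<And>j. vars_in {..<n} (b j)" by (auto simp: I_def)
    show "vars_in {..<n} F" using b f by (auto intro!: vars_in_sum vars_in_mult vars_in_pm_map)
    show "G * F \<in> I" if "vars_in {..<n} G" for G
      unfolding I_def using b that
      by (intro CollectI exI[of _ "\<lambda>j. G * b j"]) (auto simp: sum_distrib_left mult_ac intro: vars_in_mult)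
    show "hcomp k F \<in> I" for k
    proof -
      have "hcomp k (b j * ?f j) = (if d j \<le> k then hcomp (k - d j) (b j) else 0) * ?f j" if "j < r" for j
        using hcomp_mult_homogeneous[OF homogeneous_pm_map[of to_ac, OF to_ac_0 f(2)[OF that]], of k "b j"]
        by (simp add: mult.commute)
      hence "hcomp k F = (\<Sum>j<r. (if d j \<le> k then hcomp (k - d j) (b j) else 0) * ?f j)"
        unfolding b(1) hcomp_sum by (intro sum.cong refl) simp
      thus ?thesis unfolding I_def using b(2)
        by (intro CollectI exI[of _ "\<lambda>j. if d j \<le> k then hcomp (k - d j) (b j) else 0"])
          (auto intro: vars_in_hcomp)
    qed
    fix G assume "G \<in> I"
    then obtain b' where b': "G = (\<Sum>j<r. b' j * ?f j)" "\<And>j. vars_in {..<n} (b' j)" by (auto simp: I_def)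
    show "F + G \<in> I"
      unfolding I_def using b b'
      by (intro CollectI exI[of _ "\<lambda>j. b j + b' j"]) (auto simp: sum.distrib ring_distribs intro: vars_in_add)
  qed
  have gen: "?f j \<in> I" if "j < r" for j
    unfolding I_def using that
    by (intro CollectI exI[of _ "\<lambda>l. if l = j then 1 else 0"])
      (auto simp: if_distrib[of "\<lambda>x. x * _"] cong: if_cong)
  have "\<exists>N. mvar i ^ N \<in> I"
  proof (rule projective_nullstellensatz[OF I _ i])
    fix a :: "nat \<Rightarrow> 'a alg_closure" assume "\<exists>i<n. a i \<noteq> 0"
    then obtain j where "j < r" "heval to_ac a (f j) \<noteq> 0" using nz by blast
    thus "\<exists>F\<in>I. meval a F \<noteq> 0" using gen by (intro bexI[of _ "?f j"]) (auto simp: meval_map_to_ac)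
  qed
  then obtain N b where b: "mvar i ^ N = (\<Sum>j<r. b j * ?f j)" by (auto simp: I_def)
  obtain \<pi> :: "'a alg_closure \<Rightarrow> 'a" where \<pi>: "\<And>x y. \<pi> (x + y) = \<pi> x + \<pi> y"
    "\<And>c x. \<pi> (to_ac c * x) = c * \<pi> x" "\<pi> 1 = 1" using ac_retraction by blast
  have \<pi>0: "\<pi> 0 = 0" using \<pi>(2)[of 0 0] by simp
  have scale: "Poly_Mapping.map \<pi> (B * Poly_Mapping.map to_ac G) = Poly_Mapping.map \<pi> B * G"
    for B and G :: "'a mpoly"
  proof (induction B rule: mpoly_induct_single)
    case (single m c)
    show ?case
    proof (induction G rule: mpoly_induct_single)
      case (single m' c')
      show ?case using \<pi>(2)[of c' c] by (simp add: mult_single \<pi>0 mult.commute add.commute)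
    qed (simp add: pm_map_add \<pi>0 \<pi>(1) ring_distribs)
  qed (simp add: pm_map_add \<pi>0 \<pi>(1) ring_distribs)
  have "mvar i ^ N = Poly_Mapping.map \<pi> (mvar i ^ N)"
    by (simp add: mvar_power \<pi>0 \<pi>(3))
  also have "\<dots> = (\<Sum>j<r. Poly_Mapping.map \<pi> (b j) * f j)"
    unfolding b by (simp add: pm_map_sum \<pi>0 \<pi>(1) scale)
  finally show ?thesis by (intro exI)
qed

subsection \<open>Alternating matrices\<close>

text \<open>A nondegenerate alternating form splits off a hyperbolic plane, which lowers
  \<open>card I\<close> by two. The zero diagonal ensures \<open>i \<noteq> j\<close> in every
  characteristic.\<close>

lemma alternating_nondegenerate_even:
  fixes A :: "nat \<Rightarrow> nat \<Rightarrow> 'a::field"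
  assumes "finite I" "skew_zero_diag_on I A" "nondegenerate_on I A"
  shows "even (card I)"
  using assms
proof (induction "card I" arbitrary: I A rule: less_induct)
  case less
  show ?case
  proof (cases "I = {}")
    case False
    then obtain i where i: "i \<in> I" by blast
    have skew: "A l k = - A k l" "A k k = 0" if "k \<in> I" "l \<in> I" for k l
      using less.prems(2) that unfolding skew_zero_diag_on_def by blast+
    have "\<exists>j\<in>I. A i j \<noteq> 0"
    proof (rule ccontr)
      assume no: "\<not> (\<exists>j\<in>I. A i j \<noteq> 0)"
      have "(\<Sum>l\<in>I. A k l * (if l = i then 1 else 0)) = 0" if "k \<in> I" for k
        using no skew(1)[OF i that] that less.prems(1) i
        by (simp add: if_distrib[of "\<lambda>x. _ * x"] sum.delta cong: if_cong)
      from less.prems(3)[unfolded nondegenerate_on_def, rule_format,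
          of "\<lambda>l. if l = i then 1 else 0", OF this i]
      show False by simp
    qed
    then obtain j where j: "j \<in> I" "A i j \<noteq> 0" by blast
    have ij: "i \<noteq> j" using j skew(2)[OF i i] by auto
    define a where "a = A i j"
    have a: "a \<noteq> 0" "A j i = - a" using j skew(1)[OF i j(1)] by (auto simp: a_def)
    define I' where "I' = I - {i, j}"
    have I': "I = insert i (insert j I')" "i \<notin> I'" "j \<notin> I'" "finite I'"
      using i j less.prems(1) by (auto simp: I'_def)
    have card: "card I = Suc (Suc (card I'))" using I' ij by simp
    \<comment> \<open>the Schur complement of the hyperbolic plane spanned by \<open>i\<close> and \<open>j\<close>\<close>
    define A' where "A' k l = A k l + (A k i * A j l - A k j * A i l) / a" for k l
    have "even (card I')"
    proof (rule less.hyps)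
      show "card I' < card I" "finite I'" using card I' by auto
      show "skew_zero_diag_on I' A'"
        unfolding skew_zero_diag_on_def
      proof (intro conjI ballI)
        fix k l assume "k \<in> I'" "l \<in> I'"
        hence kl: "k \<in> I" "l \<in> I" by (auto simp: I'_def)
        show "A' l k = - A' k l"
          using skew(1)[OF kl] skew(1)[OF i kl(1)] skew(1)[OF i kl(2)]
            skew(1)[OF j(1) kl(1)] skew(1)[OF j(1) kl(2)]
          by (simp add: A'_def algebra_simps flip: add_divide_distrib)
      next
        fix k assume "k \<in> I'"
        hence k: "k \<in> I" by (auto simp: I'_def)
        show "A' k k = 0"
          using skew(2)[OF k k] skew(1)[OF i k] skew(1)[OF j(1) k] by (simp add: A'_def)
      qed
      show "nondegenerate_on I' A'"
        unfolding nondegenerate_on_def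
      proof (intro allI impI)
        fix v assume v: "\<forall>k\<in>I'. (\<Sum>l\<in>I'. A' k l * v l) = 0"
        define S where "S k = (\<Sum>l\<in>I'. A k l * v l)" for k
        \<comment> \<open>The entries at \<open>i\<close> and \<open>j\<close> are the unique ones
          that make rows \<open>j\<close> and \<open>i\<close> of \<open>A\<close> annihilate
          \<open>w\<close>; the other rows then reproduce those of \<open>A'\<close>.\<close>
        define w where "w = v(i := S j / a, j := - S i / a)"
        have split: "(\<Sum>l\<in>I. A k l * w l) = A k i * (S j / a) + A k j * (- S i / a) + S k" for k
        proof -
          have "(\<Sum>l\<in>I'. A k l * w l) = S k"
            unfolding S_def w_def using I' by (intro sum.cong) auto
          thus ?thesis using I' ij by (simp add: w_def)
        qed
        have "(\<Sum>l\<in>I. A k l * w l) = 0" if kI: "k \<in> I" for k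
        proof -
          consider "k = i" | "k = j" | "k \<in> I'" using kI I' by blast
          thus ?thesis
          proof cases
            case 1
            thus ?thesis using a skew(2)[OF i i] by (simp add: split flip: a_def)
          next
            case 2
            thus ?thesis using a skew(2)[OF j(1) j(1)] by (simp add: split)
          next
            case 3
            have "0 = (\<Sum>l\<in>I'. A' k l * v l)" using v 3 by simp
            also have "\<dots> = (\<Sum>l\<in>I'. A k l * v l + (A k i * (A j l * v l) - A k j * (A i l * v l)) / a)"
              by (intro sum.cong refl) (simp add: A'_def algebra_simps diff_divide_distrib)
            also have "\<dots> = S k + (A k i * S j - A k j * S i) / a"
              by (simp add: S_def sum.distrib sum_subtractf sum_distrib_left flip: sum_divide_distrib)
            finally show ?thesis by (simp add: split diff_divide_distrib add.commute)
          qed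
        qed
        hence "\<forall>l\<in>I. w l = 0" using less.prems(3) unfolding nondegenerate_on_def by blast
        thus "\<forall>l\<in>I'. v l = 0" using I' by (auto simp: w_def split: if_splits)
      qed
    qed
    thus ?thesis using card by simp
  qed simp
qed

text \<open>Linear algebra by counting: an injective self-map of the finite set \<open>V\<close> is
  onto, which yields a right inverse. It is also a left inverse, because
  \<open>A (B A - 1) = 0\<close> and \<open>A\<close> has trivial kernel.\<close>

lemma nondegenerate_inverse:
  fixes A :: "nat \<Rightarrow> nat \<Rightarrow> 'a::{field,finite}"
  assumes I: "finite I" and A: "nondegenerate_on I A"
  obtains B where "\<And>i j. i \<in> I \<Longrightarrow> j \<in> I \<Longrightarrow> (\<Sum>k\<in>I. A i k * B k j) = (if i = j then 1 else 0)"
    and "\<And>i j. i \<in> I \<Longrightarrow> j \<in> I \<Longrightarrow> (\<Sum>k\<in>I. B i k * A k j) = (if i = j then 1 else 0)"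
proof -
  define V where "V = I \<rightarrow>\<^sub>E (UNIV :: 'a set)"
  define T where "T v = restrict (\<lambda>i. \<Sum>j\<in>I. A i j * v j) I" for v
  have ker: "\<forall>j\<in>I. v j = 0" if "\<And>i. i \<in> I \<Longrightarrow> (\<Sum>j\<in>I. A i j * v j) = 0" for v
    using A that unfolding nondegenerate_on_def by blast
  have "inj_on T V"
  proof (rule inj_onI)
    fix v w assume vw: "v \<in> V" "w \<in> V" "T v = T w"
    have "\<forall>j\<in>I. v j - w j = 0"
    proof (rule ker)
      fix i assume "i \<in> I"
      with fun_cong[OF vw(3), of i] show "(\<Sum>j\<in>I. A i j * (v j - w j)) = 0"
        by (simp add: T_def right_diff_distrib sum_subtractf)
    qed
    thus "v = w" using vw(1,2) by (intro PiE_ext[of v I "\<lambda>_. UNIV" w]) (auto simp: V_def)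
  qed
  moreover have "finite V" unfolding V_def using I by (intro finite_PiE) auto
  moreover have "T ` V \<subseteq> V" by (auto simp: T_def V_def)
  ultimately have surj: "T ` V = V" by (simp add: endo_inj_surj)
  have "\<exists>b. \<forall>i\<in>I. (\<Sum>k\<in>I. A i k * b k) = (if i = j then 1 else 0)" for j
  proof -
    have "restrict (\<lambda>i. if i = j then 1 else 0) I \<in> T ` V" unfolding surj by (simp add: V_def)
    then obtain b where "restrict (\<lambda>i. if i = j then 1 else 0) I = T b" by blast
    hence "(\<Sum>k\<in>I. A i k * b k) = (if i = j then 1 else 0)" if "i \<in> I" for i
      using that by (metis (mono_tags, lifting) T_def restrict_apply')
    thus ?thesis by blast
  qed
  then obtain B where B: "\<And>i j. i \<in> I \<Longrightarrow> (\<Sum>k\<in>I. A i k * B j k) = (if i = j then 1 else 0)" by metis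
  have "(\<Sum>k\<in>I. B k i * A k j) = (if i = j then 1 else 0)" if ij: "i \<in> I" "j \<in> I" for i j
  proof -
    have "\<forall>l\<in>I. (\<Sum>k\<in>I. B k l * A k j) - (if l = j then 1 else 0) = 0"
    proof (rule ker)
      fix i assume i: "i \<in> I"
      have "(\<Sum>l\<in>I. A i l * (\<Sum>k\<in>I. B k l * A k j)) = (\<Sum>k\<in>I. (\<Sum>l\<in>I. A i l * B k l) * A k j)"
        unfolding sum_distrib_left sum_distrib_right by (subst sum.swap) (simp add: mult_ac)
      also have "\<dots> = (\<Sum>k\<in>I. if k = i then A k j else 0)"
        using B[OF i] by (intro sum.cong) auto
      also have "\<dots> = A i j" using i I by simp
      finally show "(\<Sum>l\<in>I. A i l * ((\<Sum>k\<in>I. B k l * A k j) - (if l = j then 1 else 0))) = 0"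
        using I ij by (simp add: right_diff_distrib sum_subtractf if_distrib[of "\<lambda>x. _ * x"] cong: if_cong)
    qed
    thus ?thesis using ij by auto
  qed
  thus thesis using that[of "\<lambda>k j. B j k"] B by simp
qed

lemma nondegenerate_if_left_inverse:
  fixes A :: "nat \<Rightarrow> nat \<Rightarrow> 'a::field"
  assumes I: "finite I"
    and BA: "\<And>i j. i \<in> I \<Longrightarrow> j \<in> I \<Longrightarrow> (\<Sum>k\<in>I. B i k * A k j) = (if i = j then 1 else 0)"
  shows "nondegenerate_on I A"
  unfolding nondegenerate_on_def
proof (intro allI impI ballI)
  fix v i assume v: "\<forall>i\<in>I. (\<Sum>j\<in>I. A i j * v j) = 0" and i: "i \<in> I"
  have "v i = (\<Sum>j\<in>I. (if i = j then 1 else 0) * v j)"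
    using I i by (simp add: if_distrib[of "\<lambda>x. x * _"] cong: if_cong)
  also have "\<dots> = (\<Sum>j\<in>I. (\<Sum>k\<in>I. B i k * A k j) * v j)" using BA[OF i] by simp
  also have "\<dots> = (\<Sum>k\<in>I. B i k * (\<Sum>j\<in>I. A k j * v j))"
    unfolding sum_distrib_left sum_distrib_right by (subst sum.swap) (simp add: mult_ac)
  also have "\<dots> = 0" using v by simp
  finally show "v i = 0" .
qed

lemma sum_alternating_form_eq_0:
  fixes f :: "nat \<Rightarrow> 'b::comm_ring_1"
  assumes "finite I" "\<And>k. k \<in> I \<Longrightarrow> A k k = 0" "\<And>k l. k \<in> I \<Longrightarrow> l \<in> I \<Longrightarrow> A l k = - A k l"
  shows "(\<Sum>k\<in>I. \<Sum>l\<in>I. f k * A k l * f l) = 0"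
proof (rule sum_antisymmetric_eq_0)
  fix k l assume "k \<in> I" "l \<in> I"
  thus "f k * A k l * f l = - (f l * A l k * f k)" using assms(3)[of k l] by (simp add: mult_ac)
qed (use assms(1,2) in auto)

text \<open>From \<open>A B = 1\<close> one gets \<open>B^T A B = B^T\<close>, and congruence
  preserves alternating matrices, including the zero diagonal in characteristic two.\<close>

lemma inverse_skew_zero_diag:
  fixes A :: "nat \<Rightarrow> nat \<Rightarrow> 'a::field"
  assumes I: "finite I" and A: "skew_zero_diag_on I A"
    and AB: "\<And>i j. i \<in> I \<Longrightarrow> j \<in> I \<Longrightarrow> (\<Sum>k\<in>I. A i k * B k j) = (if i = j then 1 else 0)"
  shows "skew_zero_diag_on I B"
proof -
  have skew: "A l k = - A k l" "A k k = 0" if "k \<in> I" "l \<in> I" for k l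
    using A that unfolding skew_zero_diag_on_def by blast+
  have B: "B j i = (\<Sum>k\<in>I. \<Sum>l\<in>I. B k i * A k l * B l j)" if ij: "i \<in> I" "j \<in> I" for i j
  proof -
    have "(\<Sum>k\<in>I. \<Sum>l\<in>I. B k i * A k l * B l j) = (\<Sum>k\<in>I. B k i * (\<Sum>l\<in>I. A k l * B l j))"
      by (simp add: sum_distrib_left mult.assoc)
    also have "\<dots> = (\<Sum>k\<in>I. if k = j then B k i else 0)" using AB ij by (intro sum.cong) auto
    finally show ?thesis using I ij by simp
  qed
  show ?thesis
    unfolding skew_zero_diag_on_def
  proof (intro conjI ballI)
    fix i j assume ij: "i \<in> I" "j \<in> I"
    have "B j i = (\<Sum>k\<in>I. \<Sum>l\<in>I. - (B l j * A l k * B k i))"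
      unfolding B[OF ij]
    proof (intro sum.cong refl)
      fix k l assume "k \<in> I" "l \<in> I"
      thus "B k i * A k l * B l j = - (B l j * A l k * B k i)"
        using skew(1)[of k l] by (simp add: mult_ac)
    qed
    also have "\<dots> = - B i j"
      unfolding B[OF ij(2,1)] sum_negf by (subst sum.swap) simp
    finally show "B j i = - B i j" .
  next
    fix i assume i: "i \<in> I"
    show "B i i = 0" unfolding B[OF i i]
      by (rule sum_alternating_form_eq_0[OF I]) (auto intro: skew)
  qed
qed

text \<open>Pigeonhole: there are more coefficient vectors on \<open>P\<close> than values on
  \<open>T\<close>, and the difference of two vectors with the same image is the solution.\<close>

lemma exists_kernel_vector:
  fixes c :: "'p \<Rightarrow> 't \<Rightarrow> 'a::{field,finite}"
  assumes P: "finite P" and T: "finite T" and less: "card T < card P"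
  shows "\<exists>s. (\<exists>p\<in>P. s p \<noteq> 0) \<and> (\<forall>k\<in>T. (\<Sum>p\<in>P. s p * c p k) = 0)"
proof -
  define V where "V = P \<rightarrow>\<^sub>E (UNIV :: 'a set)"
  define W where "W = T \<rightarrow>\<^sub>E (UNIV :: 'a set)"
  define L where "L s = restrict (\<lambda>k. \<Sum>p\<in>P. s p * c p k) T" for s
  have q: "CARD('a) > 1"
    using card_mono[of "UNIV :: 'a set" "{0, 1}"] by simp
  have "card V = CARD('a) ^ card P" "card W = CARD('a) ^ card T"
    unfolding V_def W_def using P T by (simp_all add: card_PiE)
  hence "card W < card V" using q less by simp
  moreover have "L ` V \<subseteq> W" by (auto simp: L_def W_def)
  moreover have "finite W" unfolding W_def using T by (intro finite_PiE) auto
  ultimately have "\<not> inj_on L V" by (meson card_inj_on_le not_le)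
  then obtain s t where st: "s \<in> V" "t \<in> V" "L s = L t" "s \<noteq> t" by (auto simp: inj_on_def)
  have "\<exists>p\<in>P. s p \<noteq> t p"
    using PiE_ext[of s P "\<lambda>_. UNIV" t] st by (auto simp: V_def)
  moreover have "(\<Sum>p\<in>P. (s p - t p) * c p k) = 0" if "k \<in> T" for k
    using fun_cong[OF st(3), of k] that by (simp add: L_def left_diff_distrib sum_subtractf)
  ultimately show ?thesis by (intro exI[of _ "\<lambda>p. s p - t p"]) auto
qed

subsection \<open>Polynomials over a finite field\<close>

lemma card_finite_field_gt_1: "CARD('a::{field,finite}) > 1"
  using card_mono[of "UNIV :: 'a set" "{0, 1}"] by simp

lemma of_nat_card_eq_0: "of_nat CARD('a) = (0 :: 'a::{field,finite})"
proof -
  have "(\<Sum>a\<in>UNIV. a + 1) = (\<Sum>a\<in>UNIV. a :: 'a)"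
    by (rule sum.reindex_bij_witness[where i = "\<lambda>a. a - 1" and j = "\<lambda>a. a + 1"]) auto
  thus ?thesis by (simp add: sum.distrib)
qed

lemma power_card_eq_same: "(a :: 'a::{field,finite}) ^ CARD('a) = a"
proof (cases "a = 0")
  case False
  have "(\<Prod>y\<in>UNIV - {0}. y) = (\<Prod>y\<in>UNIV - {0}. a * y)"
    by (rule prod.reindex_bij_witness[of _ "\<lambda>y. a * y" "\<lambda>y. y / a"]) (use False in auto)
  also have "\<dots> = a ^ (CARD('a) - 1) * (\<Prod>y\<in>UNIV - {0}. y)"
    by (simp add: prod.distrib)
  finally have "a ^ (CARD('a) - 1) = 1" by simp
  moreover have "CARD('a) = Suc (CARD('a) - 1)" using card_finite_field_gt_1[where 'a = 'a] by simp
  ultimately show ?thesis by (metis power_Suc mult_1_right)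
qed (use card_finite_field_gt_1[where 'a = 'a] in simp)

text \<open>\<open>(X + 1)^q - X^q - 1\<close> has degree below \<open>q\<close> but vanishes at all
  \<open>q\<close> field elements, so it is the zero polynomial.\<close>

lemma binomial_card_eq_0:
  assumes k: "0 < k" "k < CARD('a)"
  shows "of_nat (CARD('a) choose k) = (0 :: 'a::{field,finite})"
proof -
  let ?q = "CARD('a)"
  define P where "P = (\<Sum>k=1..<?q. monom (of_nat (?q choose k) :: 'a) k)"
  have coeff: "coeff P k = (if k \<in> {1..<?q} then of_nat (?q choose k) else 0)" for k
    by (auto simp: P_def coeff_sum sum.delta)
  have "P = 0"
  proof (rule ccontr)
    assume P: "P \<noteq> 0"
    have "poly P a = 0" for a
    proof -
      have "a + 1 = (a + 1) ^ ?q" by (simp add: power_card_eq_same)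
      also have "\<dots> = (\<Sum>k\<le>?q. of_nat (?q choose k) * a ^ k)" by (simp add: binomial_ring)
      also have "{..?q} = insert 0 (insert ?q {1..<?q})" using card_finite_field_gt_1[where 'a = 'a] by auto
      also have "(\<Sum>k\<in>\<dots>. of_nat (?q choose k) * a ^ k) = 1 + (a ^ ?q + poly P a)"
        using card_finite_field_gt_1[where 'a = 'a]
        by (subst sum.insert) (auto simp: P_def poly_sum poly_monom)
      finally show ?thesis by (simp add: power_card_eq_same)
    qed
    hence "?q \<le> degree P" using card_poly_roots_bound[OF P] by simp
    moreover have "degree P \<le> ?q - 1" by (rule degree_le) (auto simp: coeff)
    ultimately show False using card_finite_field_gt_1[where 'a = 'a] by simp
  qed
  thus ?thesis using coeff[of k] k by simp
qed

lemma mpoly_frobenius_add: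
  fixes F G :: "'a::{field,finite} mpoly"
  shows "(F + G) ^ CARD('a) = F ^ CARD('a) + G ^ CARD('a)"
proof -
  let ?q = "CARD('a)"
  have "(F + G) ^ ?q = (\<Sum>k\<le>?q. of_nat (?q choose k) * F ^ k * G ^ (?q - k))"
    by (rule binomial_ring)
  also have "\<dots> = (\<Sum>k\<in>{0, ?q}. of_nat (?q choose k) * F ^ k * G ^ (?q - k))"
  proof (intro sum.mono_neutral_right ballI)
    fix k assume "k \<in> {..?q} - {0, ?q}"
    hence "of_nat (?q choose k) = (0 :: 'a mpoly)"
      using binomial_card_eq_0[where 'a = 'a, of k] by (simp flip: mconst_of_nat)
    thus "of_nat (?q choose k) * F ^ k * G ^ (?q - k) = 0" by simp
  qed auto
  also have "\<dots> = F ^ ?q + G ^ ?q" using card_finite_field_gt_1[where 'a = 'a] by simp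
  finally show ?thesis .
qed

lemma linear_form_power_card:
  fixes v :: "'i \<Rightarrow> 'a::{field,finite}"
  shows "(\<Sum>i\<in>I. mconst (v i) * F i) ^ CARD('a) = (\<Sum>i\<in>I. mconst (v i) * F i ^ CARD('a))"
proof (induction I rule: infinite_finite_induct)
  case (insert i I)
  have "(mconst (v i) * F i) ^ CARD('a) = mconst (v i) * F i ^ CARD('a)"
    by (simp add: power_mult_distrib power_card_eq_same flip: mconst_power)
  thus ?case using insert by (simp add: mpoly_frobenius_add)
qed (use card_finite_field_gt_1[where 'a = 'a] in simp_all)

lemma meval_origin_homogeneous:
  assumes "homogeneous k F" "k > 0"
  shows "meval (\<lambda>_. 0) F = 0"
  unfolding meval_heval heval_def
proof (intro sum.neutral ballI)
  fix m assume m: "m \<in> keys F"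
  hence "mdeg m \<noteq> 0" using assms by (auto simp: homogeneous_iff)
  then obtain i where i: "i \<in> keys m" unfolding mdeg_def by (auto simp: sum_eq_0_iff)
  hence "mon (\<lambda>_. 0 :: 'a) m = 0"
    unfolding mon_def by (intro prod_zero) (auto simp: in_keys_iff power_0_left intro!: bexI[of _ i])
  thus "lookup F m * mon (\<lambda>_. 0) m = 0" by simp
qed

text \<open>In \<open>mvar n\<close> the degree is at most \<open>e\<close>; the coefficient of
  \<open>mvar n ^ e\<close> is a constant, killed by the point (0, ..., 0, 1), so the degree is
  below \<open>q\<close> while there are \<open>q\<close> roots. All slices then vanish at rational
  points. The bound is sharp: \<open>x^q y - x y^q\<close> has degree \<open>q + 1\<close>.\<close>

lemma homogeneous_vanishing_on_rational_points:
  fixes F :: "'a::{field,finite} mpoly"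
  assumes "homogeneous e F" "e \<le> CARD('a)" "vars_in {..<n} F" "\<And>a. meval a F = 0"
  shows "F = 0"
  using assms
proof (induction n arbitrary: e F)
  case 0
  hence "\<forall>m\<in>keys F. m = 0" by (simp add: vars_in_def)
  hence "homogeneous 0 F" by (simp add: homogeneous_iff mdeg_eq_0_iff)
  hence F: "F = mconst (lookup F 0)" by (rule homogeneous_0_imp_mconst)
  have "lookup F 0 = meval (\<lambda>_. 0) F" by (subst F) simp
  thus ?case using F 0 by simp
next
  case (Suc n)
  have coeff: "coeff (eval_last n a F) k = meval a (slice n k F)" for a k by (rule coeff_eval_last)
  have root: "poly (eval_last n a F) t = 0" for a t by (simp add: poly_eval_last Suc.prems)
  have top: "slice n e F = 0"
  proof -
    have c: "slice n e F = mconst (lookup (slice n e F) 0)"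
      using homogeneous_slice[OF Suc.prems(1), of e n] by (intro homogeneous_0_imp_mconst) simp
    let ?c = "lookup (slice n e F) 0"
    have "eval_last n (\<lambda>_. 0) F = monom ?c e"
    proof (rule poly_eqI)
      fix k
      consider "k < e" | "k = e" | "k > e" by linarith
      thus "coeff (eval_last n (\<lambda>_. 0) F) k = coeff (monom ?c e) k"
      proof cases
        case 1
        thus ?thesis
          using meval_origin_homogeneous[OF homogeneous_slice[OF Suc.prems(1)], of k n] by (simp add: coeff)
      next
        case 2
        thus ?thesis using arg_cong[OF c, of "meval (\<lambda>_. 0)"] by (simp add: coeff)
      next
        case 3
        thus ?thesis by (simp add: coeff slice_eq_0_beyond[OF Suc.prems(1)])
      qed
    qed
    hence "?c = 0" using root[of "\<lambda>_. 0" 1] by (simp add: poly_monom)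
    thus ?thesis using c by simp
  qed
  have "eval_last n a F = 0" for a
  proof (rule ccontr)
    assume nz: "eval_last n a F \<noteq> 0"
    have "coeff (eval_last n a F) k = 0" if "k \<ge> e" for k
      using that top slice_eq_0_beyond[OF Suc.prems(1), of k n]
      by (cases "k = e") (simp_all add: coeff)
    hence "degree (eval_last n a F) < e" using nz by (metis leading_coeff_0_iff not_le)
    moreover have "CARD('a) \<le> degree (eval_last n a F)"
      using card_poly_roots_bound[OF nz] by (simp add: root)
    ultimately show False using Suc.prems(2) by simp
  qed
  hence "meval a (slice n k F) = 0" for a k by (simp flip: coeff)
  moreover have "vars_in {..<n} (slice n k F)" for k
    using vars_in_slice[OF Suc.prems(3), of n k] by (rule vars_in_mono) auto
  ultimately have "slice n k F = 0" for k
    using Suc.prems(2) by (intro Suc.IH[OF homogeneous_slice[OF Suc.prems(1), of k]]) auto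
  moreover obtain D where "F = (\<Sum>k\<le>D. slice n k F * mvar n ^ k)" using slice_expansion by blast
  ultimately show ?case by simp
qed

subsection \<open>Syzygies of the partial derivatives\<close>

lemma mvar_power_mult_mvar: "mvar i ^ a * mconst c * mvar j = single (single i a + single j 1) c"
  by (simp add: mvar_power mconst_def mult_single) (simp add: mvar_def mult_single)

lemma monomial_eq_iff:
  assumes "q \<ge> 2"
  shows "single i q + single j (1::nat) = single k q + single l 1 \<longleftrightarrow> i = k \<and> j = l"
proof
  assume eq: "single i q + single j (1::nat) = single k q + single l 1"
  have "i = k"
  proof (rule ccontr)
    assume "i \<noteq> k"
    hence "lookup (single i q + single j (1::nat)) k \<le> 1"
      by (simp add: lookup_add lookup_single when_def)
    moreover have "lookup (single k q + single l (1::nat)) k \<ge> 2"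
      using assms by (simp add: lookup_add)
    ultimately show False using eq by simp
  qed
  moreover from this eq have "single j (1::nat) = single l 1" by simp
  hence "j = l" by (metis lookup_single_eq lookup_single_not_eq zero_neq_one)
  ultimately show "i = k \<and> j = l" ..
qed simp

lemma lookup_frobenius_form:
  assumes "finite I" "q \<ge> 2" "k \<in> I" "l \<in> I"
  shows "lookup (\<Sum>i\<in>I. \<Sum>j\<in>I. mvar i ^ q * mconst (A i j) * mvar j) (single k q + single l 1) = A k l"
proof -
  have "lookup (\<Sum>i\<in>I. \<Sum>j\<in>I. mvar i ^ q * mconst (A i j) * mvar j) (single k q + single l 1)
      = (\<Sum>i\<in>I. \<Sum>j\<in>I. if i = k \<and> j = l then A i j else 0)"
    by (simp add: mvar_power_mult_mvar lookup_sum lookup_single when_def monomial_eq_iff[OF assms(2)]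
        del: One_nat_def)
  also have "\<dots> = (\<Sum>i\<in>I. if i = k then A i l else 0)"
    using assms by (intro sum.cong) (auto simp: sum.delta)
  finally show ?thesis using assms by simp
qed

lemma mvar_power_neq:
  "a > 0 \<Longrightarrow> i \<noteq> j \<Longrightarrow> mvar i ^ a \<noteq> (mvar j ^ a :: 'a::comm_ring_1 mpoly)"
proof
  assume "a > 0" "i \<noteq> j" and eq: "(mvar i :: 'a mpoly) ^ a = mvar j ^ a"
  have "single i a = single j a"
    using arg_cong[OF eq, of "\<lambda>F. lookup F (single i a)"] by (auto simp: mvar_power lookup_single when_def split: if_splits)
  from arg_cong[OF this, of "\<lambda>m. lookup m i"] show False
    using \<open>a > 0\<close> \<open>i \<noteq> j\<close> by (simp add: lookup_single)
qed

locale smooth_fnc_hypersurface =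
  fixes F H :: "'a::{field,finite} mpoly" and n d q :: nat
  assumes q_def: "q = CARD('a)"
    and n2: "n \<ge> 2"
    and Fvars: "vars_in {..n} F"
    and Fnz: "F \<noteq> 0"
    and Fhom: "homogeneous d F"
    and d2: "d \<ge> 2"
    and smooth: "smooth_hypersurface n F"
    and F10: "F10 q n F = F * H"
begin

abbreviation P :: "nat \<Rightarrow> 'a mpoly" where "P i \<equiv> mpderiv i F"

lemma q2: "q \<ge> 2"
  using card_finite_field_gt_1[where 'a = 'a] by (simp add: q_def)

lemma Phom: "homogeneous (d - 1) (P i)"
  using homogeneous_mpderiv[OF Fhom] .

lemma frobenius_relation: "(\<Sum>i\<le>n. mvar i ^ q * P i) = F * H"
  using F10 by (simp add: F10_def)

lemma euler_relation: "(\<Sum>i\<le>n. mvar i * P i) = of_nat d * F"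
  using euler_identity[OF Fvars Fhom] by simp

lemma Hhom: "homogeneous (q - 1) H"
proof (rule homogeneous_cofactor[OF Fhom Fnz])
  have "homogeneous (q + (d - 1)) (F * H)"
    unfolding frobenius_relation[symmetric]
    using homogeneous_power[OF homogeneous_mvar, of q] Phom
    by (intro homogeneous_sum homogeneous_mult) auto
  moreover have "q + (d - 1) = d + (q - 1)" using q2 d2 by simp
  ultimately show "homogeneous (d + (q - 1)) (F * H)" by simp
qed

lemma not_singular:
  fixes x :: "nat \<Rightarrow> 'a alg_closure"
  assumes "i \<le> n" "x i \<noteq> 0" "heval to_ac x F = 0"
  shows "\<exists>i\<le>n. heval to_ac x (P i) \<noteq> 0"
  using smooth assms
  by (auto simp: smooth_hypersurface_def mpderiv_map_to_ac meval_map_to_ac)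

lemma ksign_singleton: "ksign j {i} = (if i < j then - 1 else 1)"
proof -
  have "{s \<in> {i}. s < j} = (if i < j then {i} else {})" by auto
  thus ?thesis by (simp add: ksign_def)
qed

lemma partials_no_common_zero:
  fixes x :: "nat \<Rightarrow> 'a alg_closure"
  assumes d: "of_nat d \<noteq> (0::'a)" and x: "i \<le> n" "x i \<noteq> 0"
  shows "\<exists>i\<le>n. heval to_ac x (P i) \<noteq> 0"
proof (rule ccontr)
  assume no: "\<not> ?thesis"
  have "heval to_ac x (of_nat d * F) = 0"
    unfolding euler_relation[symmetric] using no by (simp add: ac_hom.heval_simps)
  hence "to_ac (of_nat d) * heval to_ac x F = 0"
    by (simp add: ac_hom.heval_simps flip: mconst_of_nat)
  hence "heval to_ac x F = 0" using d by (metis mult_eq_0_iff to_ac_eq_0_iff)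
  thus False using not_singular[where x = x, OF x] no by blast
qed

text \<open>Here \<open>r = L = n + 1\<close>, so homology vanishes from degree 1 on and
  \<open>z\<close> is a boundary. \<open>C\<close> is the bounding chain, a function of unordered
  pairs, turned into an alternating matrix by the signs.\<close>

lemma partials_syzygy:
  assumes d: "of_nat d \<noteq> (0::'a)" and z: "(\<Sum>i\<le>n. P i * z i) = 0"
  obtains C where "\<And>i j. C j i = - C i j" "\<And>i. C i i = 0" "\<And>i. i \<le> n \<Longrightarrow> z i = (\<Sum>j\<le>n. P j * C i j)"
proof -
  have le: "{..<Suc n} = {..n}" by auto
  have "\<exists>w. \<forall>S\<subseteq>{..<Suc n}. card S = 1 \<longrightarrow> z (the_elem S) = kbd (Suc n) P w S"
  proof (rule koszul_acyclic)
    fix i assume "i < Suc n"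
    thus "\<exists>N a. mvar i ^ N = (\<Sum>j<Suc n. a j * P j)"
    proof (intro power_in_ideal_if_no_common_zero[where n = "Suc n" and d = "\<lambda>_. d - 1"])
      fix x :: "nat \<Rightarrow> 'a alg_closure" assume "\<exists>i<Suc n. x i \<noteq> 0"
      thus "\<exists>j<Suc n. heval to_ac x (P j) \<noteq> 0"
        using partials_no_common_zero[OF d, where x = x] by (metis less_Suc_eq_le)
    qed (auto simp: le intro: vars_in_mpderiv Fvars Phom simp del: One_nat_def)
  next
    fix S assume S: "S \<subseteq> {..<Suc n}" "Suc (card S) = 1"
    hence "S = {}" using finite_subset[OF S(1)] by simp
    thus "kbd (Suc n) P (\<lambda>S. z (the_elem S)) S = 0"
      using z by (simp add: kbd_def ksign_def le)
  qed simp
  then obtain w where w': "\<forall>S\<subseteq>{..<Suc n}. card S = 1 \<longrightarrow> z (the_elem S) = kbd (Suc n) P w S" by blast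
  have w: "z i = kbd (Suc n) P w {i}" if "i \<le> n" for i
    using w'[rule_format, of "{i}"] that by simp
  define C where "C i j = (if i = j then 0 else ksign j {i} * w {i, j})" for i j
  show thesis
  proof
    show "C j i = - C i j" for i j
      by (cases i j rule: linorder_cases) (auto simp: C_def ksign_singleton insert_commute)
    show "C i i = 0" for i by (simp add: C_def)
    show "z i = (\<Sum>j\<le>n. P j * C i j)" if "i \<le> n" for i
    proof -
      have "z i = (\<Sum>j\<in>{..n} - {i}. ksign j {i} * P j * w {i, j})"
        unfolding w[OF that] kbd_def le by (simp add: insert_commute)
      also have "\<dots> = (\<Sum>j\<in>{..n} - {i}. P j * C i j)"
        by (intro sum.cong) (auto simp: C_def mult_ac)
      also have "\<dots> = (\<Sum>j\<le>n. P j * C i j)"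
        by (intro sum.mono_neutral_left) (auto simp: C_def)
      finally show ?thesis .
    qed
  qed
qed

lemma no_low_degree_syzygy:
  assumes d: "of_nat d \<noteq> (0::'a)" and z: "(\<Sum>i\<le>n. P i * z i) = 0"
    and g: "\<And>i. homogeneous g (z i)" "g < d - 1" and i: "i \<le> n"
  shows "z i = 0"
proof -
  obtain C where C: "\<And>i. i \<le> n \<Longrightarrow> z i = (\<Sum>j\<le>n. P j * C i j)"
    using partials_syzygy[OF d z] by metis
  have "z i = hcomp g (z i)" using hcomp_homogeneous[OF g(1)] by simp
  also have "\<dots> = (\<Sum>j\<le>n. hcomp g (P j * C i j))" unfolding C[OF i] hcomp_sum ..
  also have "\<dots> = 0" using g(2) by (simp add: hcomp_mult_homogeneous[OF Phom])
  finally show ?thesis .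
qed

text \<open>The Koszul cofactors need not be homogeneous; the component of degree
  \<open>d - 1\<close> retains just their constant terms.\<close>

lemma constant_syzygy:
  assumes d: "of_nat d \<noteq> (0::'a)" and z: "(\<Sum>i\<le>n. P i * z i) = 0"
    and g: "\<And>i. homogeneous (d - 1) (z i)"
  obtains A where "skew_zero_diag_on {..n} A" "\<And>i. i \<le> n \<Longrightarrow> z i = (\<Sum>j\<le>n. mconst (A i j) * P j)"
proof -
  obtain C where C: "\<And>i j. C j i = - C i j" "\<And>i. C i i = 0"
      "\<And>i. i \<le> n \<Longrightarrow> z i = (\<Sum>j\<le>n. P j * C i j)"
    by (rule partials_syzygy[OF d z]) (rule that; assumption)
  define A where "A i j = lookup (C i j) 0" for i j
  show thesis
  proof
    show "skew_zero_diag_on {..n} A"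
      unfolding skew_zero_diag_on_def
    proof (intro conjI ballI)
      fix i j show "A j i = - A i j" using C(1)[of j i] by (simp add: A_def)
      show "A i i = 0" using C(2)[of i] by (simp add: A_def)
    qed
    fix i assume i: "i \<le> n"
    have "z i = hcomp (d - 1) (z i)" using hcomp_homogeneous[OF g] by simp
    also have "\<dots> = (\<Sum>j\<le>n. hcomp (d - 1) (P j * C i j))" unfolding C(3)[OF i] hcomp_sum ..
    also have "\<dots> = (\<Sum>j\<le>n. mconst (A i j) * P j)"
      by (intro sum.cong refl)
        (simp add: hcomp_mult_homogeneous[OF Phom] hcomp_0_eq A_def mult.commute[of "mconst _"])
    finally show "z i = (\<Sum>j\<le>n. mconst (A i j) * P j)" .
  qed
qed

lemma frobenius_syzygy: "(\<Sum>i\<le>n. P i * (of_nat d * mvar i ^ q - H * mvar i)) = 0"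
proof -
  have "(\<Sum>i\<le>n. P i * (of_nat d * mvar i ^ q - H * mvar i))
      = of_nat d * (\<Sum>i\<le>n. mvar i ^ q * P i) - H * (\<Sum>i\<le>n. mvar i * P i)"
    by (simp add: sum_distrib_left right_diff_distrib sum_subtractf mult_ac)
  thus ?thesis unfolding frobenius_relation euler_relation by (simp add: mult_ac)
qed

lemma frobenius_syzygy_homogeneous: "homogeneous q (of_nat d * mvar i ^ q - H * mvar i)"
proof (rule homogeneous_diff)
  show "homogeneous q (of_nat d * mvar i ^ q :: 'a mpoly)"
    unfolding mconst_of_nat[symmetric]
    using homogeneous_power[OF homogeneous_mvar, of q] by (intro homogeneous_mult_mconst) simp
  show "homogeneous q (H * mvar i)"
    using homogeneous_mult[OF Hhom homogeneous_mvar] q2 by simp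
qed

text \<open>Beyond \<open>q + 1\<close> the Frobenius syzygy has degree below that of the partials
  and must vanish; then \<open>H\<close> equals \<open>d\<close> times the \<open>(q - 1)\<close>-st
  power of every variable, absurd for two variables.\<close>

lemma degree_le_if_char_not_dvd:
  assumes d: "of_nat d \<noteq> (0::'a)"
  shows "d \<le> q + 1"
proof (rule ccontr)
  assume "\<not> d \<le> q + 1"
  hence z: "of_nat d * mvar i ^ q - H * mvar i = 0" if "i \<le> n" for i
    using no_low_degree_syzygy[OF d frobenius_syzygy frobenius_syzygy_homogeneous _ that] by simp
  have "H = of_nat d * mvar i ^ (q - 1)" if "i \<le> n" for i
  proof -
    have "mvar i ^ q = (mvar i ^ (q - 1) * mvar i :: 'a mpoly)"
      using q2 power_minus_mult[of q "mvar i :: 'a mpoly"] by simp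
    hence "(of_nat d * mvar i ^ (q - 1) - H) * mvar i = 0"
      using z[OF that] by (simp add: left_diff_distrib mult.assoc)
    thus ?thesis by simp
  qed
  from this[of 0] this[of 1] n2 have "of_nat d * mvar 0 ^ (q - 1) = (of_nat d * mvar 1 ^ (q - 1) :: 'a mpoly)"
    by (metis One_nat_def Suc_leD numeral_2_eq_2 zero_le)
  moreover have "of_nat d \<noteq> (0 :: 'a mpoly)" using d by (simp flip: mconst_of_nat)
  ultimately have "mvar 0 ^ (q - 1) = (mvar 1 ^ (q - 1) :: 'a mpoly)" by simp
  thus False using mvar_power_neq[where 'a = 'a, of "q - 1" 0 1] q2 by simp
qed

subsection \<open>Degree divisible by the characteristic\<close>

lemma second_syzygy:
  assumes d: "of_nat d = (0::'a)"
  obtains w where "\<And>i j. i < j \<Longrightarrow> j \<le> n \<Longrightarrow> mvar i * mvar j ^ q - mvar j * mvar i ^ q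
    = (\<Sum>k\<in>{..n} - {i, j}. ksign k {i, j} * P k * w (insert k {i, j}))
      + ksign (Suc n) {i, j} * F * w (insert (Suc n) {i, j})"
proof -
  define f where "f j = (if j \<le> n then P j else F)" for j
  \<comment> \<open>The syzygies \<open>u\<close> (Euler) and \<open>v\<close> (Frobenius), with
    index \<open>Suc n\<close> standing for \<open>F\<close>: the entry there is 0 for Euler, as
    \<open>d\<close> is zero in the field, and \<open>- H\<close> for Frobenius.\<close>
  define u where "u j = (if j \<le> n then mvar j else 0 :: 'a mpoly)" for j
  define v where "v j = (if j \<le> n then mvar j ^ q else - H)" for j
  \<comment> \<open>The exterior product of \<open>u\<close> and \<open>v\<close>:
    \<open>Min\<close> and \<open>Max\<close> order the pair, so the value is a 2 by 2
    minor.\<close>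
  define z where "z S = u (Min S) * v (Max S) - u (Max S) * v (Min S)" for S
  have split: "{..<n + 2} = insert (Suc n) {..n}" by auto
  have fu: "(\<Sum>j<n + 2. f j * u j) = 0" and fv: "(\<Sum>j<n + 2. f j * v j) = 0"
  proof -
    have "(\<Sum>j\<le>n. f j * u j) = (\<Sum>i\<le>n. mvar i * P i)"
      by (intro sum.cong) (auto simp: f_def u_def)
    thus "(\<Sum>j<n + 2. f j * u j) = 0"
      unfolding split by (simp add: euler_relation u_def d flip: mconst_of_nat)
    have "(\<Sum>j\<le>n. f j * v j) = (\<Sum>i\<le>n. mvar i ^ q * P i)"
      by (intro sum.cong) (auto simp: f_def v_def)
    thus "(\<Sum>j<n + 2. f j * v j) = 0"
      unfolding split by (simp add: frobenius_relation f_def v_def)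
  qed
  \<comment> \<open>With \<open>r = n + 2\<close> and \<open>L = n + 1\<close>, vanishing is
    guaranteed from degree 2 on.\<close>
  have "\<exists>w. \<forall>S\<subseteq>{..<n + 2}. card S = 2 \<longrightarrow> z S = kbd (n + 2) f w S"
  proof (rule koszul_acyclic[where L = "Suc n"])
    fix i assume "i < Suc n"
    thus "\<exists>N a. mvar i ^ N = (\<Sum>j<n + 2. a j * f j)"
    proof (intro power_in_ideal_if_no_common_zero[where n = "Suc n" and d = "\<lambda>j. if j \<le> n then d - 1 else d"])
      fix x :: "nat \<Rightarrow> 'a alg_closure" assume "\<exists>i<Suc n. x i \<noteq> 0"
      then obtain i where i: "i \<le> n" "x i \<noteq> 0" using less_Suc_eq_le by blast
      show "\<exists>j<n + 2. heval to_ac x (f j) \<noteq> 0"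
      proof (cases "heval to_ac x F = 0")
        case True
        then obtain j where "j \<le> n" "heval to_ac x (P j) \<noteq> 0" using not_singular[where x = x, OF i] by blast
        thus ?thesis by (intro exI[of _ j]) (auto simp: f_def)
      next
        case False
        thus ?thesis by (intro exI[of _ "Suc n"]) (auto simp: f_def)
      qed
    qed (auto simp: lessThan_Suc_atMost f_def Fhom intro: vars_in_mpderiv Fvars Phom simp del: One_nat_def)
  next
    fix S assume S: "S \<subseteq> {..<n + 2}" "Suc (card S) = 2"
    hence "card S = 1" by simp
    then obtain i where i: "S = {i}" by (rule card_1_singletonE)
    have summand: "ksign j {i} * f j * z (insert j {i}) = v i * (f j * u j) - u i * (f j * v j)" if "j \<noteq> i" for j
      using that by (cases i j rule: linorder_cases) (auto simp: z_def ksign_singleton algebra_simps)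
    have "kbd (n + 2) f z {i} = (\<Sum>j\<in>{..<n + 2} - {i}. v i * (f j * u j) - u i * (f j * v j))"
      unfolding kbd_def by (intro sum.cong refl) (simp add: summand)
    \<comment> \<open>The summand for \<open>j = i\<close> is zero, so both full syzygies can be
      used.\<close>
    also have "\<dots> = (\<Sum>j<n + 2. v i * (f j * u j) - u i * (f j * v j))"
      by (intro sum.mono_neutral_left) (auto simp: mult_ac)
    also have "\<dots> = v i * (\<Sum>j<n + 2. f j * u j) - u i * (\<Sum>j<n + 2. f j * v j)"
      by (simp only: sum_subtractf sum_distrib_left)
    also have "\<dots> = 0" unfolding fu fv by simp
    finally show "kbd (n + 2) f z S = 0" unfolding i .
  qed simp
  then obtain w where w: "\<And>S. S \<subseteq> {..<n + 2} \<Longrightarrow> card S = 2 \<Longrightarrow> z S = kbd (n + 2) f w S" by blast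
  show thesis
  proof
    fix i j assume ij: "i < j" "j \<le> n"
    have "{..<n + 2} - {i, j} = insert (Suc n) ({..n} - {i, j})" using ij by auto
    hence "kbd (n + 2) f w {i, j} = ksign (Suc n) {i, j} * F * w (insert (Suc n) {i, j})
        + (\<Sum>k\<in>{..n} - {i, j}. ksign k {i, j} * f k * w (insert k {i, j}))"
      by (simp add: kbd_def f_def)
    also have "(\<Sum>k\<in>{..n} - {i, j}. ksign k {i, j} * f k * w (insert k {i, j}))
        = (\<Sum>k\<in>{..n} - {i, j}. ksign k {i, j} * P k * w (insert k {i, j}))"
      by (intro sum.cong) (auto simp: f_def)
    finally have "kbd (n + 2) f w {i, j}
        = (\<Sum>k\<in>{..n} - {i, j}. ksign k {i, j} * P k * w (insert k {i, j}))
          + ksign (Suc n) {i, j} * F * w (insert (Suc n) {i, j})" by (simp only: add.commute)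
    moreover have "z {i, j} = mvar i * mvar j ^ q - mvar j * mvar i ^ q"
      using ij by (simp add: z_def u_def v_def)
    ultimately show "mvar i * mvar j ^ q - mvar j * mvar i ^ q
        = (\<Sum>k\<in>{..n} - {i, j}. ksign k {i, j} * P k * w (insert k {i, j}))
          + ksign (Suc n) {i, j} * F * w (insert (Suc n) {i, j})"
      using w[of "{i, j}"] ij by simp
  qed
qed

end

section \<open>Cross forms, and polynomials with zero derivatives in characteristic two\<close>

lemma mconst_ksign: "mconst (ksign k S) = ksign k S"
  by (simp add: ksign_def mconst_power mconst_uminus)

lemma mpderiv_power_card: "mpderiv k ((F :: 'a::{field,finite} mpoly) ^ CARD('a)) = 0"
proof -
  have "of_nat CARD('a) = (0 :: 'a mpoly)"
    using of_nat_card_eq_0[where 'a = 'a] by (simp flip: mconst_of_nat)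
  thus ?thesis by (simp add: mpderiv_power)
qed

lemma lookup_cross_term:
  assumes "q \<ge> 2" "i < j" "k < l"
  shows "lookup (mvar i * mvar j ^ q - mvar j * mvar i ^ q) (single l q + single k 1)
    = (if i = k \<and> j = l then 1 else 0 :: 'a::comm_ring_1)"
proof -
  have "mvar a * mvar b ^ q = (single (single b q + single a 1) 1 :: 'a mpoly)" for a b
    using mvar_power_mult_mvar[of b q 1 a] by (simp add: mult.commute)
  thus ?thesis using assms
    by (auto simp: lookup_minus lookup_single when_def monomial_eq_iff simp del: One_nat_def)
qed

text \<open>In characteristic two an odd exponent contributes the factor 1 to the derivative, so
  vanishing derivatives leave only even exponents. \<open>G\<close> has the same coefficients with
  exponents halved.\<close>

lemma even_exponents_substitution:
  fixes R :: "'a::{field,finite} mpoly"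
  assumes two: "(2::'a) = 0" and R: "vars_in {..n} R" "\<And>i. i \<le> n \<Longrightarrow> mpderiv i R = 0"
  shows "\<exists>G. vars_in {..n} G \<and> R = msubst (\<lambda>i. mvar i ^ 2) G"
proof -
  have even: "even (lookup m i)" if m: "m \<in> keys R" for m i
  proof (cases "i \<le> n")
    case True
    show ?thesis
    proof (rule ccontr)
      assume odd: "odd (lookup m i)"
      have "m - single i 1 + single i 1 = m"
        using odd by (intro poly_mapping_eqI)
          (auto simp: lookup_add lookup_minus lookup_single when_def elim: oddE)
      moreover have "lookup (m - single i 1) i + 1 = lookup m i"
        using odd by (auto simp: lookup_minus elim: oddE)
      ultimately have "lookup (mpderiv i R) (m - single i 1) = of_nat (lookup m i) * lookup R m"
        by (simp only: lookup_mpderiv)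
      moreover obtain k where "lookup m i = 2 * k + 1" using odd by (auto elim: oddE)
      hence "of_nat (lookup m i) = (1::'a)" using two by simp
      ultimately show False using R(2)[OF True] m by (simp add: in_keys_iff)
    qed
  next
    case False
    hence "i \<notin> keys m" using R(1) m by (auto simp: vars_in_def)
    thus ?thesis by (simp add: in_keys_iff)
  qed
  define h where "h m = Poly_Mapping.map (\<lambda>k::nat. k div 2) (m :: nat \<Rightarrow>\<^sub>0 nat)" for m
  have h: "lookup (h m) i = lookup m i div 2" for m i
    by (simp add: h_def map.rep_eq when_def)
  define G where "G = (\<Sum>m\<in>keys R. single (h m) (lookup R m))"
  have "msubst (\<lambda>i. mvar i ^ 2) (single (h m) c) = single m c" if m: "m \<in> keys R" for m and c :: 'a
  proof -
    have "mon (\<lambda>i. mvar i ^ 2 :: 'a mpoly) (h m) = (\<Prod>i\<in>keys m. (mvar i ^ 2) ^ lookup (h m) i)"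
      by (rule mon_superset) (auto simp: in_keys_iff h)
    also have "\<dots> = mon mvar m"
      unfolding mon_def using even[OF m] by (intro prod.cong) (auto simp: h simp flip: power_mult)
    finally show ?thesis
      unfolding msubst_heval mconst_hom.heval_single by (simp only: single_eq)
  qed
  hence "msubst (\<lambda>i. mvar i ^ 2) G = (\<Sum>m\<in>keys R. single m (lookup R m))"
    by (simp add: G_def msubst_simps)
  hence "R = msubst (\<lambda>i. mvar i ^ 2) G" by (simp flip: mpoly_sum_singles)
  moreover have "vars_in {..n} G"
    unfolding G_def
  proof (rule vars_in_sum)
    fix m assume m: "m \<in> keys R"
    have "keys (h m) \<subseteq> keys m" by (auto simp: in_keys_iff h)
    thus "vars_in {..n} (single (h m) (lookup R m))" using R(1) m by (auto simp: vars_in_def)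
  qed
  ultimately show ?thesis by blast
qed

text \<open>Expanded, \<open>x_0^q x_1 x_2 + x_0 x_1^q x_2 + x_0 x_1 x_2^q\<close>. Each partial is,
  up to a sign invisible in characteristic two, the cross form of the other two variables: it is a
  common antiderivative.\<close>

definition cubic_part :: "nat \<Rightarrow> 'a::comm_ring_1 mpoly" where
  "cubic_part q = mvar 0 * mvar 1 * mvar 2 * (mvar 0 ^ (q - 1) + mvar 1 ^ (q - 1) + mvar 2 ^ (q - 1))"

lemma mpderiv_cubic_part:
  fixes i j k :: nat
  assumes "CARD('a) = q" and ijk: "(i, j, k) \<in> {(0, 1, 2), (1, 0, 2), (2, 0, 1)}"
  shows "mpderiv i (cubic_part q :: 'a::{field,finite} mpoly) = mvar j * mvar k ^ q + mvar k * mvar j ^ q"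
proof -
  have q: "q > 1" using card_finite_field_gt_1[where 'a = 'a] assms(1) by simp
  have pow: "mvar l * mvar l ^ (q - 1) = (mvar l ^ q :: 'a mpoly)" for l
    using q power_minus_mult[of q "mvar l :: 'a mpoly"] by (simp add: mult.commute)
  have "(cubic_part q :: 'a mpoly) = mvar 0 * mvar 0 ^ (q - 1) * (mvar 1 * mvar 2)
      + mvar 1 * mvar 1 ^ (q - 1) * (mvar 0 * mvar 2) + mvar 2 * mvar 2 ^ (q - 1) * (mvar 0 * mvar 1)"
    by (simp add: cubic_part_def ring_distribs mult_ac)
  also have "\<dots> = mvar 0 ^ q * (mvar 1 * mvar 2) + mvar 1 ^ q * (mvar 0 * mvar 2)
      + mvar 2 ^ q * (mvar 0 * mvar 1)"
    unfolding pow ..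
  finally have c: "(cubic_part q :: 'a mpoly) = mvar 0 ^ q * (mvar 1 * mvar 2)
      + mvar 1 ^ q * (mvar 0 * mvar 2) + mvar 2 ^ q * (mvar 0 * mvar 1)" .
  show ?thesis
    using ijk unfolding c mpderiv_add mpderiv_mult mpderiv_power_card[where 'a = 'a, unfolded assms(1)]
    by (elim insertE emptyE) (auto simp: mpderiv_mvar algebra_simps)
qed

context smooth_fnc_hypersurface
begin

text \<open>In degree \<open>q + 1\<close> multiples of \<open>F\<close> contribute nothing, since
  \<open>d > q + 1\<close>, and multiples of a partial contribute only if
  \<open>d - 1 = q + 1\<close>, with constant cofactors. The cross forms are not zero, so this must
  occur.\<close>

lemma char_dvd_constants:
  assumes d: "of_nat d = (0::'a)" and ge: "q + 2 \<le> d"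
  obtains c where "d = q + 2"
    "\<And>i j. i < j \<Longrightarrow> j \<le> n \<Longrightarrow> mvar i * mvar j ^ q - mvar j * mvar i ^ q
      = (\<Sum>k\<in>{..n} - {i, j}. mconst (ksign k {i, j} * c (insert k {i, j})) * P k)"
proof -
  obtain w where w: "\<And>i j. i < j \<Longrightarrow> j \<le> n \<Longrightarrow> mvar i * mvar j ^ q - mvar j * mvar i ^ q
    = (\<Sum>k\<in>{..n} - {i, j}. ksign k {i, j} * P k * w (insert k {i, j}))
      + ksign (Suc n) {i, j} * F * w (insert (Suc n) {i, j})"
    by (rule second_syzygy[OF d]) (rule that; assumption)
  have hom: "homogeneous (q + 1) (mvar i * mvar j ^ q - mvar j * mvar i ^ q :: 'a mpoly)" for i j
    using homogeneous_mult[OF homogeneous_mvar homogeneous_power[OF homogeneous_mvar, of q]]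
    by (intro homogeneous_diff) auto
  have E: "mvar i * mvar j ^ q - mvar j * mvar i ^ q
      = (\<Sum>k\<in>{..n} - {i, j}. if d = q + 2
          then mconst (ksign k {i, j} * lookup (w (insert k {i, j})) 0) * P k else 0)"
    if ij: "i < j" "j \<le> n" for i j
  proof -
    have 1: "hcomp (q + 1) (ksign k {i, j} * P k * w (insert k {i, j}))
        = (if d = q + 2 then mconst (ksign k {i, j} * lookup (w (insert k {i, j})) 0) * P k else 0)" for k
    proof -
      have eq: "ksign k {i, j} * P k * w (insert k {i, j}) = P k * (mconst (ksign k {i, j}) * w (insert k {i, j}))"
        by (simp only: mconst_ksign mult_ac)
      show ?thesis
        unfolding eq hcomp_mult_homogeneous[OF Phom] using ge by (auto simp: hcomp_0_eq mult.commute)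
    qed
    have 2: "hcomp (q + 1) (ksign (Suc n) {i, j} * F * w (insert (Suc n) {i, j})) = 0"
    proof -
      have eq: "ksign (Suc n) {i, j} * F * w (insert (Suc n) {i, j}) = F * (ksign (Suc n) {i, j} * w (insert (Suc n) {i, j}))"
        by (simp only: mult_ac)
      show ?thesis unfolding eq hcomp_mult_homogeneous[OF Fhom] using ge by simp
    qed
    have "mvar i * mvar j ^ q - mvar j * mvar i ^ q
        = hcomp (q + 1) (mvar i * mvar j ^ q - mvar j * mvar i ^ q :: 'a mpoly)"
      using hcomp_homogeneous[OF hom, of "q + 1"] by simp
    also have "\<dots> = (\<Sum>k\<in>{..n} - {i, j}. hcomp (q + 1) (ksign k {i, j} * P k * w (insert k {i, j})))"
      unfolding w[OF ij] hcomp_add hcomp_sum 2 by simp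
    finally show ?thesis unfolding 1 .
  qed
  have dq: "d = q + 2"
  proof (rule ccontr)
    assume "d \<noteq> q + 2"
    hence "mvar 0 * mvar 1 ^ q - mvar 1 * mvar 0 ^ q = (0 :: 'a mpoly)" using E[of 0 1] n2 by simp
    hence "lookup (mvar 0 * mvar 1 ^ q - mvar 1 * mvar 0 ^ q :: 'a mpoly) (single 1 q + single 0 1) = 0"
      by simp
    thus False using lookup_cross_term[where 'a = 'a, of q 0 1 0 1] q2 by simp
  qed
  show thesis
    by (rule that[of "\<lambda>S. lookup (w S) 0"]) (use E dq in auto)
qed

text \<open>Distinct cross forms have no monomial in common, so they are linearly independent;
  \<open>n + 2\<close> of them cannot lie in the span of the \<open>n + 1\<close> partials.\<close>

lemma char_dvd_dimension:
  assumes d: "of_nat d = (0::'a)" and ge: "q + 2 \<le> d"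
  shows "n = 2"
proof (rule ccontr)
  assume "n \<noteq> 2"
  hence n3: "n \<ge> 3" using n2 by simp
  obtain c where c: "\<And>i j. i < j \<Longrightarrow> j \<le> n \<Longrightarrow> mvar i * mvar j ^ q - mvar j * mvar i ^ q
      = (\<Sum>k\<in>{..n} - {i, j}. mconst (ksign k {i, j} * c (insert k {i, j})) * P k)"
    by (rule char_dvd_constants[OF d ge]) (rule that; assumption)
  \<comment> \<open>A choice of \<open>n + 2\<close> pairs: \<open>n\<close> with first entry 0 and
    two more; the last one exists because \<open>n \<ge> 3\<close>.\<close>
  define Q where "Q = Pair 0 ` {1..n} \<union> {(1::nat, 2::nat), (1, 3)}"
  have "card Q = card (Pair (0::nat) ` {1..n}) + card {(1::nat, 2::nat), (1, 3)}"
    unfolding Q_def by (intro card_Un_disjoint) auto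
  hence "card Q = n + 2" by (simp add: card_image inj_on_def)
  hence card: "card {..n} < card Q" by simp
  have Q: "i < j" "j \<le> n" if "(i, j) \<in> Q" for i j using that n3 by (auto simp: Q_def)
  have fin: "finite Q" by (simp add: Q_def)
  define b where "b p k = (if k \<in> {fst p, snd p} then 0
      else ksign k {fst p, snd p} * c (insert k {fst p, snd p}))" for p k
  define E where "E p = (mvar (fst p) * mvar (snd p) ^ q - mvar (snd p) * mvar (fst p) ^ q :: 'a mpoly)" for p
  have E: "E p = (\<Sum>k\<le>n. mconst (b p k) * P k)" if "p \<in> Q" for p
  proof -
    obtain i j where p: "p = (i, j)" by fastforce
    have "E p = (\<Sum>k\<in>{..n} - {i, j}. mconst (ksign k {i, j} * c (insert k {i, j})) * P k)"
      using c[of i j] Q[of i j] that p by (simp add: E_def)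
    also have "\<dots> = (\<Sum>k\<in>{..n} - {i, j}. mconst (b p k) * P k)"
      by (intro sum.cong) (auto simp: b_def p)
    also have "\<dots> = (\<Sum>k\<le>n. mconst (b p k) * P k)"
      by (intro sum.mono_neutral_left) (auto simp: b_def p)
    finally show ?thesis .
  qed
  obtain s where s: "\<exists>p\<in>Q. s p \<noteq> 0" "\<And>k. k \<le> n \<Longrightarrow> (\<Sum>p\<in>Q. s p * b p k) = 0"
    using exists_kernel_vector[OF fin finite_atMost card, of b] by auto
  have "(\<Sum>p\<in>Q. mconst (s p) * E p) = (\<Sum>p\<in>Q. mconst (s p) * (\<Sum>k\<le>n. mconst (b p k) * P k))"
    by (intro sum.cong refl) (simp only: E)
  also have "\<dots> = (\<Sum>k\<le>n. mconst (\<Sum>p\<in>Q. s p * b p k) * P k)"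
    unfolding sum_distrib_left mconst_sum sum_distrib_right
    by (subst sum.swap) (simp add: mconst_mult mult.assoc)
  also have "\<dots> = 0" using s(2) by simp
  finally have rel: "(\<Sum>p\<in>Q. mconst (s p) * E p) = 0" .
  have "s p = 0" if p: "p \<in> Q" for p
  proof -
    obtain k l where kl: "p = (k, l)" by fastforce
    have "0 = lookup (\<Sum>p\<in>Q. mconst (s p) * E p) (single l q + single k 1)" unfolding rel by simp
    also have "\<dots> = (\<Sum>p'\<in>Q. if p' = p then s p' else 0)"
      unfolding lookup_sum
    proof (intro sum.cong refl)
      fix p' assume "p' \<in> Q"
      thus "lookup (mconst (s p') * E p') (single l q + single k 1) = (if p' = p then s p' else 0)"
        using Q[of "fst p'" "snd p'"] Q[of k l] p kl lookup_cross_term[OF q2, of "fst p'" "snd p'" k l]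
        by (auto simp: E_def prod_eq_iff split: if_splits simp del: One_nat_def)
    qed
    finally show ?thesis using p fin by simp
  qed
  thus False using s(1) by blast
qed

lemma char_dvd_form:
  assumes d: "of_nat d = (0::'a)" and ge: "q + 2 \<le> d"
  shows "d = q + 2 \<and> n = 2 \<and> (2::'a) = 0 \<and> (\<exists>c G. c \<noteq> 0 \<and> vars_in {..2} G \<and>
    mconst c * F = cubic_part q + msubst (\<lambda>i. mvar i ^ 2) G)"
proof -
  note n = char_dvd_dimension[OF d ge]
  obtain c where dq: "d = q + 2" and c: "\<And>i j. i < j \<Longrightarrow> j \<le> n \<Longrightarrow>
      mvar i * mvar j ^ q - mvar j * mvar i ^ q
      = (\<Sum>k\<in>{..n} - {i, j}. mconst (ksign k {i, j} * c (insert k {i, j})) * P k)"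
    by (rule char_dvd_constants[OF d ge]) (rule that; assumption)
  \<comment> \<open>Both \<open>d = q + 2\<close> and \<open>q\<close> are zero in the
    field.\<close>
  have two: "(2::'a) = 0" using d of_nat_card_eq_0[where 'a = 'a] by (simp add: dq q_def)
  hence neg: "(- 1 :: 'a) = 1" by (metis add.inverse_unique one_add_one)
  hence sign: "ksign k S = (1::'a)" for k S unfolding ksign_def neg by simp
  have minus: "- G = G" for G :: "'a mpoly"
  proof -
    have "- G = mconst (- 1) * G" by (simp add: mconst_uminus)
    thus ?thesis unfolding neg by simp
  qed
  define c0 where "c0 = c {0, 1, 2}"
  have part: "mconst c0 * P i = mvar j * mvar k ^ q + mvar k * mvar j ^ q"
    if ijk: "(i, j, k) \<in> {(0, 1, 2), (1, 0, 2), (2, 0, 1)}" for i j k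
  proof -
    have "{..2} - {j, k} = {i}" "j < k" "k \<le> 2" "insert i {j, k} = {0, 1, 2}"
      using ijk by (elim insertE emptyE; auto)+
    hence "mvar j * mvar k ^ q - mvar k * mvar j ^ q = mconst c0 * P i"
      using c[of j k] n by (simp add: sign c0_def)
    thus ?thesis using minus[of "mvar k * mvar j ^ q"] by (metis diff_conv_add_uminus)
  qed
  have "c0 \<noteq> 0"
  proof
    assume "c0 = 0"
    hence "mvar 1 * mvar 2 ^ q + mvar 2 * mvar 1 ^ q = (0 :: 'a mpoly)" using part[of 0 1 2] by simp
    hence "mvar 1 * mvar 2 ^ q - mvar 2 * mvar 1 ^ q = (0 :: 'a mpoly)"
      using minus[of "mvar 2 * mvar 1 ^ q"] by (metis diff_conv_add_uminus)
    hence "lookup (mvar 1 * mvar 2 ^ q - mvar 2 * mvar 1 ^ q :: 'a mpoly) (single 2 q + single 1 1) = 0"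
      by simp
    thus False using lookup_cross_term[where 'a = 'a, of q 1 2 1 2] q2 by simp
  qed
  \<comment> \<open>The scaled \<open>F\<close> and the cubic part have equal partials, so all
    partials of \<open>R\<close> vanish and \<open>R\<close> is a polynomial in the squares.\<close>
  define R where "R = mconst c0 * F - cubic_part q"
  have "vars_in {..2} (cubic_part q :: 'a mpoly)"
    unfolding cubic_part_def by (intro vars_in_mult vars_in_add vars_in_power) auto
  hence "vars_in {..2} R" using Fvars n by (auto simp: R_def intro!: vars_in_diff vars_in_mult)
  moreover have "mpderiv i R = 0" if i: "i \<le> 2" for i
  proof -
    have R: "mpderiv i R = mconst c0 * P i - mpderiv i (cubic_part q)"
      by (simp add: R_def mpderiv_diff mpderiv_mconst_mult)
    consider "i = 0" | "i = 1" | "i = 2" using i by linarith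
    then obtain j k :: nat where "(i, j, k) \<in> {(0, 1, 2), (1, 0, 2), (2, 0, 1)}" by cases auto
    from part[OF this] mpderiv_cubic_part[where 'a = 'a, OF q_def[symmetric] this] show ?thesis
      unfolding R by simp
  qed
  ultimately obtain G where "vars_in {..2} G" "R = msubst (\<lambda>i. mvar i ^ 2) G"
    using even_exponents_substitution[OF two] by blast
  hence "mconst c0 * F = cubic_part q + msubst (\<lambda>i. mvar i ^ 2) G"
    by (simp add: R_def algebra_simps)
  thus ?thesis using dq n two \<open>c0 \<noteq> 0\<close> \<open>vars_in {..2} G\<close> by blast
qed

text \<open>The squares have zero derivative, so all partials come from \<open>cubic_part\<close>,
  and the six products in \<open>F10\<close> cancel in pairs. \<open>G\<close> may be inhomogeneous,
  so the degree is read off from \<open>P 0\<close>, a nonzero form of degree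
  \<open>q + 1\<close>.\<close>

lemma char_dvd_form_converse:
  assumes two: "(2::'a) = 0" and n: "n = 2" and c: "c \<noteq> 0" and G: "vars_in {..2} G"
    and F: "mconst c * F = cubic_part q + msubst (\<lambda>i. mvar i ^ 2) G"
  shows "d = q + 2" "F10 q n F = 0"
proof -
  have "mpderiv k (msubst (\<lambda>i. mvar i ^ 2) G) = 0" for k
  proof -
    have "(2 :: 'a mpoly) = mconst 2" by (simp add: mconst_def)
    hence "(2 :: 'a mpoly) = 0" using two by simp
    hence "mpderiv k (mvar i ^ 2 :: 'a mpoly) = 0" for i by (simp add: mpderiv_power)
    thus ?thesis by (subst mpderiv_msubst[OF G]) simp_all
  qed
  hence P: "mconst c * P k = mpderiv k (cubic_part q)" for k
    using arg_cong[OF F, of "mpderiv k"] by (simp add: mpderiv_add mpderiv_mconst_mult)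
  have P0: "mconst c * P 0 = mvar 1 * mvar 2 ^ q + mvar 2 * mvar 1 ^ q"
    and P1: "mconst c * P 1 = mvar 0 * mvar 2 ^ q + mvar 2 * mvar 0 ^ q"
    and P2: "mconst c * P 2 = mvar 0 * mvar 1 ^ q + mvar 1 * mvar 0 ^ q"
    unfolding P by (rule mpderiv_cubic_part; simp add: q_def)+
  have minus: "G' + G' = 0" for G' :: "'a mpoly"
  proof -
    have "G' + G' = mconst (1 + 1) * G'" by (simp only: mconst_add ring_distribs) simp
    thus ?thesis using two by simp
  qed
  have "mconst c * F10 q n F = (\<Sum>i\<le>2. mvar i ^ q * (mconst c * P i))"
    by (simp add: F10_def n sum_distrib_left mult_ac)
  also have "\<dots> = mvar 0 ^ q * (mconst c * P 0) + mvar 1 ^ q * (mconst c * P 1) + mvar 2 ^ q * (mconst c * P 2)"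
    by (simp add: numeral_2_eq_2)
  also have "\<dots> = (mvar 0 ^ q * mvar 1 * mvar 2 ^ q + mvar 0 ^ q * mvar 1 * mvar 2 ^ q)
      + (mvar 0 ^ q * mvar 2 * mvar 1 ^ q + mvar 0 ^ q * mvar 2 * mvar 1 ^ q)
      + (mvar 1 ^ q * mvar 0 * mvar 2 ^ q + mvar 1 ^ q * mvar 0 * mvar 2 ^ q)"
    unfolding P0 P1 P2 by (simp only: ring_distribs mult_ac add_ac)
  also have "\<dots> = 0" unfolding minus by simp
  finally show "F10 q n F = 0" using c by simp
  have "homogeneous (d - 1) (mconst c * P 0)" by (intro homogeneous_mult_mconst Phom)
  moreover have "homogeneous (1 + q) (mconst c * P 0)"
    unfolding P0 using homogeneous_mult[OF homogeneous_mvar homogeneous_power[OF homogeneous_mvar, of q]]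
    by (intro homogeneous_add) auto
  moreover have "mconst c * P 0 \<noteq> 0"
  proof
    assume 0: "mconst c * P 0 = 0"
    have "mvar 1 * mvar 2 ^ q - mvar 2 * mvar 1 ^ q
        = mconst c * P 0 - (mvar 2 * mvar 1 ^ q + mvar 2 * mvar 1 ^ q)"
      unfolding P0 by (simp add: algebra_simps)
    also have "\<dots> = 0" unfolding 0 minus by simp
    finally have "mvar 1 * mvar 2 ^ q - mvar 2 * mvar 1 ^ q = (0 :: 'a mpoly)" .
    hence "lookup (mvar 1 * mvar 2 ^ q - mvar 2 * mvar 1 ^ q :: 'a mpoly) (single 2 q + single 1 1) = 0"
      by simp
    thus False using lookup_cross_term[where 'a = 'a, of q 1 2 1 2] q2 by simp
  qed
  ultimately show "d = q + 2" using homogeneous_unique d2 by fastforce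
qed

subsection \<open>Vanishing of \<open>F\<^sub>1\<^sub>,\<^sub>0\<close>\<close>

text \<open>If all partials were zero, smoothness would leave \<open>F\<close> without projective
  zeros. The Koszul theorem for the single generator \<open>F\<close>, in degree 0 with
  \<open>L = 2\<close>, would then make 1 a multiple of \<open>F\<close>.\<close>

lemma some_partial_nonzero: "\<exists>j\<le>n. P j \<noteq> 0"
proof (rule ccontr)
  assume no: "\<not> ?thesis"
  have "\<exists>w. \<forall>S\<subseteq>{..<1}. card S = 0 \<longrightarrow> (1 :: 'a mpoly) = kbd 1 (\<lambda>_. F) w S"
  proof (rule koszul_acyclic[where L = 2])
    fix i :: nat assume "i < 2"
    hence "i < Suc n" using n2 by simp
    thus "\<exists>N a. mvar i ^ N = (\<Sum>j<(1::nat). a j * F)"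
    proof (intro power_in_ideal_if_no_common_zero[where n = "Suc n" and d = "\<lambda>_. d" and f = "\<lambda>_. F"])
      fix x :: "nat \<Rightarrow> 'a alg_closure" assume "\<exists>i<Suc n. x i \<noteq> 0"
      then obtain i where "i \<le> n" "x i \<noteq> 0" using less_Suc_eq_le by blast
      hence "heval to_ac x F \<noteq> 0" using not_singular[where x = x and i = i] no by auto
      thus "\<exists>j<(1::nat). heval to_ac x F \<noteq> 0" by auto
    qed (auto simp: Fhom lessThan_Suc_atMost Fvars)
  qed auto
  then obtain w where "(1 :: 'a mpoly) = kbd 1 (\<lambda>_. F) w {}" by fastforce
  hence "hcomp 0 1 = hcomp 0 (F * (ksign 0 {} * w {0}))"
    by (simp add: kbd_def mult_ac)
  also have "\<dots> = 0" using d2 by (simp add: hcomp_mult_homogeneous[OF Fhom])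
  finally show False by (simp add: hcomp_homogeneous[OF homogeneous_1])
qed

text \<open>At rational points \<open>x_i^q = x_i\<close>, so the Frobenius relation reads as
  Euler's. The same applies to each partial after differentiating the relation, because
  \<open>x_i^q\<close> has zero derivatives.\<close>

lemma rational_points_if_H_0:
  assumes H: "H = 0"
  shows "of_nat d * meval a F = 0" "of_nat (d - 1) * meval a (P j) = 0"
proof -
  have pow: "a i ^ q = a i" for i by (simp add: q_def power_card_eq_same)
  have "of_nat d * meval a F = meval a (of_nat d * F)" by (simp add: meval_simps flip: mconst_of_nat)
  also have "\<dots> = meval a (\<Sum>i\<le>n. mvar i ^ q * P i)"
    unfolding euler_relation[symmetric] by (simp add: meval_simps pow)
  also have "\<dots> = 0" unfolding frobenius_relation H by simp
  finally show "of_nat d * meval a F = 0" .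
  have "of_nat (d - 1) * meval a (P j) = meval a (of_nat (d - 1) * P j)"
    by (simp add: meval_simps flip: mconst_of_nat)
  also have "\<dots> = meval a (\<Sum>i\<le>n. mvar i ^ q * mpderiv i (P j))"
    unfolding euler_identity[OF vars_in_mpderiv[OF Fvars] Phom finite_atMost, symmetric]
    by (simp add: meval_simps pow)
  also have "(\<Sum>i\<le>n. mvar i ^ q * mpderiv i (P j)) = mpderiv j (\<Sum>i\<le>n. mvar i ^ q * P i)"
    unfolding mpderiv_sum mpderiv_mult
    by (simp add: mpderiv_power_card q_def mpderiv_commute[of j])
  also have "\<dots> = 0" unfolding frobenius_relation H by simp
  finally show "of_nat (d - 1) * meval a (P j) = 0" by simp
qed

lemma degree_ge_if_H_0:
  assumes H: "H = 0"
  shows "q + 1 \<le> d" "of_nat d = (0::'a) \<Longrightarrow> q + 2 \<le> d"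
proof -
  have 1: "q + 1 \<le> d" if d: "of_nat d \<noteq> (0::'a)"
  proof (rule ccontr)
    assume "\<not> q + 1 \<le> d"
    hence "F = 0"
      using Fvars d rational_points_if_H_0(1)[OF H]
      by (intro homogeneous_vanishing_on_rational_points[OF Fhom, where n = "Suc n"])
        (auto simp: q_def lessThan_Suc_atMost)
    thus False using Fnz by simp
  qed
  have 2: "q + 2 \<le> d" if d: "of_nat d = (0::'a)"
  proof (rule ccontr)
    assume le: "\<not> q + 2 \<le> d"
    \<comment> \<open>Euler's factor for the partials is thus invertible although \<open>d\<close>
      is zero in the field.\<close>
    have "of_nat (d - 1) = (- 1 :: 'a)" using d d2 by (simp add: of_nat_diff)
    hence "P j = 0" for j
      using vars_in_mpderiv[OF Fvars] le rational_points_if_H_0(2)[OF H, of _ j]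
      by (intro homogeneous_vanishing_on_rational_points[OF Phom, where n = "Suc n"])
        (auto simp: q_def lessThan_Suc_atMost)
    thus False using some_partial_nonzero by blast
  qed
  show "q + 1 \<le> d" using 1 2 by (cases "of_nat d = (0::'a)") auto
  show "of_nat d = (0::'a) \<Longrightarrow> q + 2 \<le> d" by (rule 2)
qed

end

subsection \<open>Degree prime to the characteristic\<close>

lemma skew_zero_diag_onD:
  assumes "skew_zero_diag_on I A" "i \<in> I"
  shows "A i i = 0" "j \<in> I \<Longrightarrow> A j i = - A i j"
  using assms unfolding skew_zero_diag_on_def by blast+

lemma frobenius_form_F10:
  fixes A :: "nat \<Rightarrow> nat \<Rightarrow> 'a::{field,finite}"
  assumes A: "skew_zero_diag_on {..n} A"
  shows "F10 CARD('a) n (\<Sum>i\<le>n. \<Sum>j\<le>n. mvar i ^ CARD('a) * mconst (A i j) * mvar j) = 0"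
proof -
  let ?q = "CARD('a)"
  have P: "mpderiv k (\<Sum>i\<le>n. \<Sum>j\<le>n. mvar i ^ ?q * mconst (A i j) * mvar j)
      = (\<Sum>i\<le>n. mvar i ^ ?q * mconst (A i k))" if "k \<le> n" for k
  proof -
    have "mpderiv k (\<Sum>i\<le>n. \<Sum>j\<le>n. mvar i ^ ?q * mconst (A i j) * mvar j)
        = (\<Sum>i\<le>n. \<Sum>j\<le>n. if j = k then mvar i ^ ?q * mconst (A i j) else 0)"
      unfolding mpderiv_sum by (intro sum.cong refl) (simp add: mpderiv_mult mpderiv_power_card mpderiv_mvar)
    thus ?thesis using that by simp
  qed
  have "F10 ?q n (\<Sum>i\<le>n. \<Sum>j\<le>n. mvar i ^ ?q * mconst (A i j) * mvar j)
      = (\<Sum>k\<le>n. mvar k ^ ?q * (\<Sum>i\<le>n. mvar i ^ ?q * mconst (A i k)))"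
    unfolding F10_def by (intro sum.cong refl) (simp only: atMost_iff P)
  also have "\<dots> = (\<Sum>k\<le>n. \<Sum>i\<le>n. mvar k ^ ?q * mconst (A i k) * mvar i ^ ?q)"
    by (simp add: sum_distrib_left mult_ac)
  also have "\<dots> = 0"
  proof (rule sum_alternating_form_eq_0)
    fix k l assume "k \<in> {..n}" "l \<in> {..n}"
    hence "A k l = - A l k" using A unfolding skew_zero_diag_on_def by blast
    thus "mconst (A k l) = - mconst (A l k)" by (simp add: mconst_uminus)
  qed (simp_all add: skew_zero_diag_onD(1)[OF A])
  finally show ?thesis .
qed

lemma lookup_mvar_mult_eq_0: "lookup m i = 0 \<Longrightarrow> lookup (mvar i * G) m = 0"
proof (induction G rule: mpoly_induct_single)
  case (single m' c)
  hence "single i 1 + m' \<noteq> m" by (auto simp: lookup_add)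
  thus ?case by (simp add: mvar_def mult_single lookup_single)
qed (simp add: ring_distribs lookup_add)

lemma solve_linear_relation:
  fixes p z :: "nat \<Rightarrow> 'a::field mpoly"
  assumes I: "finite I" and z: "\<And>i. i \<in> I \<Longrightarrow> z i = (\<Sum>j\<in>I. mconst (A i j) * p j)"
    and BA: "\<And>i j. i \<in> I \<Longrightarrow> j \<in> I \<Longrightarrow> (\<Sum>k\<in>I. B i k * A k j) = (if i = j then 1 else 0)"
    and i: "i \<in> I"
  shows "p i = (\<Sum>j\<in>I. mconst (B i j) * z j)"
proof -
  have "(\<Sum>j\<in>I. mconst (B i j) * z j) = (\<Sum>j\<in>I. \<Sum>k\<in>I. mconst (B i j * A j k) * p k)"
    using z by (intro sum.cong refl) (simp add: sum_distrib_left mconst_mult mult.assoc)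
  also have "\<dots> = (\<Sum>k\<in>I. mconst (\<Sum>j\<in>I. B i j * A j k) * p k)"
    by (subst sum.swap) (simp add: mconst_sum sum_distrib_right)
  also have "\<dots> = (\<Sum>k\<in>I. if k = i then p k else 0)"
    using BA[OF i] by (intro sum.cong) auto
  finally show ?thesis using I i by simp
qed

lemma sum_alternating_mconst:
  fixes B :: "nat \<Rightarrow> nat \<Rightarrow> 'a::field" and f :: "nat \<Rightarrow> 'a mpoly"
  assumes "finite I" "skew_zero_diag_on I B"
  shows "(\<Sum>i\<in>I. \<Sum>j\<in>I. f i * mconst (B i j) * f j) = 0"
proof (rule sum_alternating_form_eq_0[OF assms(1)])
  fix k l assume "k \<in> I" "l \<in> I"
  hence "B l k = - B k l" using assms(2) unfolding skew_zero_diag_on_def by blast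
  thus "mconst (B l k) = - mconst (B k l)" by (simp add: mconst_uminus)
qed (simp add: skew_zero_diag_onD(1)[OF assms(2)])

lemma skew_zero_diag_transpose: "skew_zero_diag_on I A \<Longrightarrow> skew_zero_diag_on I (\<lambda>i j. A j i)"
  unfolding skew_zero_diag_on_def by blast

text \<open>The substitution by \<open>M\<close> sends the linear form with coefficients
  \<open>v\<close> to \<open>mvar 0\<close>.\<close>

lemma complete_to_coordinates:
  fixes v :: "nat \<Rightarrow> 'a::field"
  assumes k: "k \<le> n" "v k \<noteq> 0"
  obtains M where "nondegenerate_on {..n} M" "\<And>j. j \<le> n \<Longrightarrow> (\<Sum>i\<le>n. v i * M i j) = (if j = 0 then 1 else 0)"
proof -
  \<comment> \<open>\<open>s\<close> exchanges 0 and \<open>k\<close>. Variables other than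
    \<open>k\<close> are merely permuted by \<open>s\<close>, and row \<open>k\<close> solves the
    equation "linear form = \<open>mvar 0\<close>" for \<open>mvar k\<close>.\<close>
  define s where "s i = (if i = 0 then k else if i = k then 0 else i)" for i
  have s: "s i \<le> n" "s (s i) = i" "s i = 0 \<longleftrightarrow> i = k" if "i \<le> n" for i
    using that k by (auto simp: s_def split: if_splits)
  define M where "M i j = (if i = k then (if j = 0 then 1 else - v (s j)) / v k
    else if j = s i then 1 else 0)" for i j
  show thesis
  proof
    show "nondegenerate_on {..n} M"
      unfolding nondegenerate_on_def
    proof (intro allI impI ballI)
      fix u j assume u: "\<forall>i\<in>{..n}. (\<Sum>j\<in>{..n}. M i j * u j) = 0" and j: "j \<in> {..n}"
      have pos: "u j = 0" if j: "j \<le> n" "j \<noteq> 0" for j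
      proof -
        have "s j \<noteq> k" using s(2,3)[OF j(1)] j k by (auto simp: s_def split: if_splits)
        hence "(\<Sum>l\<le>n. M (s j) l * u l) = (\<Sum>l\<le>n. if l = j then u l else 0)"
          using s(2)[OF j(1)] by (intro sum.cong) (auto simp: M_def)
        thus ?thesis using u s(1)[OF j(1)] j by auto
      qed
      have "(\<Sum>l\<le>n. M k l * u l) = (\<Sum>l\<le>n. if l = 0 then u l / v k else 0)"
        using pos by (intro sum.cong) (auto simp: M_def)
      hence "u 0 = 0" using u k by auto
      thus "u j = 0" using pos j by (cases "j = 0") auto
    qed
    fix j assume j: "j \<le> n"
    have "(\<Sum>i\<le>n. v i * M i j) = (\<Sum>i\<in>{..n} - {k}. v i * M i j) + v k * M k j"
      using k by (simp add: sum.remove)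
    also have "(\<Sum>i\<in>{..n} - {k}. v i * M i j) = (\<Sum>i\<in>{..n} - {k}. if i = s j then v i else 0)"
    proof (intro sum.cong refl)
      fix i assume i: "i \<in> {..n} - {k}"
      have "j = s i \<longleftrightarrow> i = s j" using s(2)[of i] s(2)[of j] i j by auto
      thus "v i * M i j = (if i = s j then v i else 0)" using i by (simp add: M_def)
    qed
    also have "\<dots> = (if s j \<noteq> k then v (s j) else 0)" using s(1)[OF j] by (simp add: sum.delta)
    also have "s j \<noteq> k \<longleftrightarrow> j \<noteq> 0" using s(2)[OF j] k by (auto simp: s_def split: if_splits)
    finally show "(\<Sum>i\<le>n. v i * M i j) = (if j = 0 then 1 else 0)" using k by (simp add: M_def)
  qed
qed

section \<open>Degree \<open>q + 1\<close>: invertible matrix or kernel vector\<close>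

context smooth_fnc_hypersurface
begin

lemma top_degree_relation:
  assumes dq: "d = q + 1"
  obtains A where "skew_zero_diag_on {..n} A"
    "\<And>i. i \<le> n \<Longrightarrow> mvar i ^ q - H * mvar i = (\<Sum>j\<le>n. mconst (A i j) * P j)"
proof -
  have d: "of_nat d = (1::'a)" using of_nat_card_eq_0[where 'a = 'a] by (simp add: dq q_def)
  hence d': "of_nat d = (1 :: 'a mpoly)" by (metis mconst_1 mconst_of_nat)
  have hom: "homogeneous (d - 1) (of_nat d * mvar i ^ q - H * mvar i)" for i
    using frobenius_syzygy_homogeneous dq by simp
  have "of_nat d \<noteq> (0::'a)" using d by simp
  then obtain A where "skew_zero_diag_on {..n} A"
    "\<And>i. i \<le> n \<Longrightarrow> of_nat d * mvar i ^ q - H * mvar i = (\<Sum>j\<le>n. mconst (A i j) * P j)"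
    by (rule constant_syzygy[OF _ frobenius_syzygy hom]) (rule that; assumption)
  thus thesis using that[of A] d' by simp
qed

lemma euler_top:
  assumes "d = q + 1"
  shows "F = (\<Sum>i\<le>n. mvar i * P i)"
proof -
  have d: "of_nat d = (1::'a)" using of_nat_card_eq_0[where 'a = 'a] by (simp add: assms q_def)
  hence "of_nat d = (1 :: 'a mpoly)" by (metis mconst_1 mconst_of_nat)
  thus ?thesis by (simp add: euler_relation)
qed

text \<open>Euler's relation recovers \<open>F\<close> from the solved partials, and the terms with
  \<open>H\<close> cancel because they form an alternating sum. The final matrix is a transpose
  because the \<open>q\<close>-th powers first appear at the second index.\<close>

lemma nondegenerate_case:
  assumes dq: "d = q + 1" and A: "skew_zero_diag_on {..n} A" "nondegenerate_on {..n} A"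
    and z: "\<And>i. i \<le> n \<Longrightarrow> mvar i ^ q - H * mvar i = (\<Sum>j\<le>n. mconst (A i j) * P j)"
  shows "odd n" "\<exists>B. skew_zero_diag_on {..n} B \<and> nondegenerate_on {..n} B \<and>
    F = (\<Sum>i\<le>n. \<Sum>j\<le>n. mvar i ^ q * mconst (B i j) * mvar j)"
proof -
  show "odd n" using alternating_nondegenerate_even[OF _ A] by simp
  obtain B where AB: "\<And>i j. i \<in> {..n} \<Longrightarrow> j \<in> {..n} \<Longrightarrow> (\<Sum>k\<le>n. A i k * B k j) = (if i = j then 1 else 0)"
    and BA: "\<And>i j. i \<in> {..n} \<Longrightarrow> j \<in> {..n} \<Longrightarrow> (\<Sum>k\<le>n. B i k * A k j) = (if i = j then 1 else 0)"
    by (rule nondegenerate_inverse[OF finite_atMost A(2)]) (rule that; assumption)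
  have B: "skew_zero_diag_on {..n} B" by (rule inverse_skew_zero_diag[OF finite_atMost A(1) AB])
  have P: "P i = (\<Sum>j\<le>n. mconst (B i j) * (mvar j ^ q - H * mvar j))" if "i \<le> n" for i
    by (rule solve_linear_relation[OF finite_atMost _ BA]) (use z that in auto)
  have "F = (\<Sum>i\<le>n. mvar i * (\<Sum>j\<le>n. mconst (B i j) * (mvar j ^ q - H * mvar j)))"
    using euler_top[OF dq] P by simp
  also have "\<dots> = (\<Sum>i\<le>n. \<Sum>j\<le>n. mvar j ^ q * mconst (B i j) * mvar i)
      - H * (\<Sum>i\<le>n. \<Sum>j\<le>n. mvar i * mconst (B i j) * mvar j)"
    by (simp add: sum_distrib_left right_diff_distrib sum_subtractf mult_ac)
  also have "\<dots> = (\<Sum>i\<le>n. \<Sum>j\<le>n. mvar j ^ q * mconst (B i j) * mvar i)"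
    unfolding sum_alternating_mconst[OF finite_atMost B] by simp
  also have "\<dots> = (\<Sum>i\<le>n. \<Sum>j\<le>n. mvar i ^ q * mconst (B j i) * mvar j)"
    by (rule sum.swap)
  finally have F: "F = (\<Sum>i\<le>n. \<Sum>j\<le>n. mvar i ^ q * mconst (B j i) * mvar j)" .
  have "nondegenerate_on {..n} (\<lambda>i j. B j i)"
    by (rule nondegenerate_if_left_inverse[where B = "\<lambda>i j. A j i"])
      (use BA in \<open>auto simp: mult.commute\<close>)
  thus "\<exists>B. skew_zero_diag_on {..n} B \<and> nondegenerate_on {..n} B \<and>
      F = (\<Sum>i\<le>n. \<Sum>j\<le>n. mvar i ^ q * mconst (B i j) * mvar j)"
    using F skew_zero_diag_transpose[OF B] by (intro exI[of _ "\<lambda>i j. B j i"]) simp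
qed

text \<open>Contracting with \<open>v\<close> kills the right-hand side, as \<open>A\<close> is
  skew. On the left the coefficients, being in \<open>'a\<close>, are fixed by the
  \<open>q\<close>-th power, so \<open>x_i^q\<close> combine to the \<open>q\<close>-th power of the
  linear form.\<close>

lemma degenerate_linear_form:
  assumes dq: "d = q + 1" and A: "skew_zero_diag_on {..n} A"
    and z: "\<And>i. i \<le> n \<Longrightarrow> mvar i ^ q - H * mvar i = (\<Sum>j\<le>n. mconst (A i j) * P j)"
    and v: "\<And>i. i \<le> n \<Longrightarrow> (\<Sum>j\<le>n. A i j * v j) = 0" "k \<le> n" "v k \<noteq> 0"
  shows "H = (\<Sum>i\<le>n. mconst (v i) * mvar i) ^ (q - 1)" "H \<noteq> 0"
proof -
  define l where "l = (\<Sum>i\<le>n. mconst (v i) * mvar i)"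
  have "lookup l (single k 1) = (\<Sum>i\<le>n. if i = k then v i else 0)"
    unfolding l_def lookup_sum
  proof (intro sum.cong refl)
    fix i
    have "single i (1::nat) = single k 1 \<longleftrightarrow> i = k"
      by (metis lookup_single_eq lookup_single_not_eq zero_neq_one)
    thus "lookup (mconst (v i) * mvar i) (single k 1) = (if i = k then v i else 0)"
      by (simp add: mvar_def lookup_single when_def)
  qed
  hence "lookup l (single k 1) \<noteq> 0" using v(2,3) by simp
  hence l0: "l \<noteq> 0" by auto
  have "l ^ q - H * l = (\<Sum>i\<le>n. mconst (v i) * (mvar i ^ q - H * mvar i))"
    unfolding l_def q_def linear_form_power_card
    by (simp add: sum_distrib_left right_diff_distrib sum_subtractf mult_ac)
  also have "\<dots> = (\<Sum>i\<le>n. \<Sum>j\<le>n. mconst (v i * A i j) * P j)"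
    using z by (intro sum.cong refl) (simp add: sum_distrib_left mconst_mult mult.assoc)
  also have "\<dots> = (\<Sum>j\<le>n. mconst (\<Sum>i\<le>n. v i * A i j) * P j)"
    by (subst sum.swap) (simp add: mconst_sum sum_distrib_right)
  also have "\<dots> = 0"
  proof (intro sum.neutral ballI)
    fix j assume j: "j \<in> {..n}"
    have "(\<Sum>i\<le>n. v i * A i j) = (\<Sum>i\<le>n. - (A j i * v i))"
    proof (intro sum.cong refl)
      fix i assume "i \<in> {..n}"
      hence "A i j = - A j i" using A j unfolding skew_zero_diag_on_def by blast
      thus "v i * A i j = - (A j i * v i)" by simp
    qed
    also have "\<dots> = 0" using v(1)[of j] j by (simp add: sum_negf)
    finally show "mconst (\<Sum>i\<le>n. v i * A i j) * P j = 0" by simp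
  qed
  finally have "l ^ q = H * l" by simp
  hence "(l ^ (q - 1) - H) * l = 0"
    using power_minus_mult[of q l] q2 by (simp add: left_diff_distrib)
  hence H: "H = l ^ (q - 1)" using l0 by simp
  thus "H = (\<Sum>i\<le>n. mconst (v i) * mvar i) ^ (q - 1)" unfolding l_def .
  show "H \<noteq> 0" using H l0 by simp
qed

end

subsection \<open>Linear changes of coordinates\<close>

lemma mpderiv_linear_form:
  "k \<le> n \<Longrightarrow> mpderiv k (\<Sum>j\<le>n. mconst (c j) * mvar j) = mconst (c k)"
  by (simp add: mpderiv_sum mpderiv_mconst_mult mpderiv_mvar if_distrib[of "\<lambda>x. _ * x"] cong: if_cong)

lemma mpderiv_lin_change:
  assumes "vars_in {..n} F" "k \<le> n"
  shows "mpderiv k (lin_change n M F) = (\<Sum>i\<le>n. lin_change n M (mpderiv i F) * mconst (M i k))"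
  unfolding lin_change_def using assms
  by (subst mpderiv_msubst[OF assms(1)]) (simp_all add: mpderiv_linear_form)

text \<open>The chain rule transposes \<open>M\<close>, and a linear form over \<open>'a\<close>
  raised to the power \<open>q\<close> is the same form in the \<open>q\<close>-th powers; the two
  effects match.\<close>

lemma F10_lin_change:
  fixes F :: "'a::{field,finite} mpoly"
  assumes "vars_in {..n} F"
  shows "F10 CARD('a) n (lin_change n M F) = lin_change n M (F10 CARD('a) n F)"
proof -
  let ?q = "CARD('a)" and ?L = "lin_change n M"
  have "F10 ?q n (?L F) = (\<Sum>k\<le>n. \<Sum>i\<le>n. ?L (mpderiv i F) * (mconst (M i k) * mvar k ^ ?q))"
    unfolding F10_def
    by (intro sum.cong refl) (simp add: mpderiv_lin_change[OF assms] sum_distrib_left mult_ac)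
  also have "\<dots> = (\<Sum>i\<le>n. ?L (mpderiv i F) * (\<Sum>k\<le>n. mconst (M i k) * mvar k) ^ ?q)"
    unfolding linear_form_power_card sum_distrib_left by (rule sum.swap)
  also have "\<dots> = ?L (F10 ?q n F)"
    by (simp add: F10_def lin_change_def msubst_simps mult.commute)
  finally show ?thesis .
qed

lemma lin_change_homogeneous: "homogeneous d F \<Longrightarrow> homogeneous d (lin_change n M F)"
  unfolding lin_change_def
  by (intro homogeneous_msubst) (auto intro!: homogeneous_sum homogeneous_mult_mconst)

lemma lin_change_vars_in: "vars_in {..n} F \<Longrightarrow> vars_in {..n} (lin_change n M F)"
  unfolding lin_change_def
  by (rule vars_in_msubst) (auto intro!: vars_in_sum vars_in_mult)

text \<open>Inverting \<open>A\<close> gives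
  \<open>mpderiv i F = S i - mvar 0 ^ (q - 1) * L i\<close> for \<open>i \<ge> 1\<close>. In Euler's
  relation the \<open>L i\<close> cancel, as \<open>B\<close> is alternating, leaving the normal
  form with \<open>G = mpderiv 0 F\<close>; differentiating that by \<open>mvar 0\<close> shows
  \<open>mpderiv 0 G = 0\<close>.\<close>

lemma even_dimension_normal_form:
  fixes F :: "'a::{field,finite} mpoly"
  assumes q: "q = CARD('a)" and n: "n \<ge> 1" and F: "vars_in {..n} F" "homogeneous (q + 1) F"
    and A: "skew_zero_diag_on {1..n} A" "nondegenerate_on {1..n} A"
    and z: "\<And>l. l \<in> {1..n} \<Longrightarrow>
      mvar l ^ q - mvar 0 ^ (q - 1) * mvar l = (\<Sum>k\<in>{1..n}. mconst (A l k) * mpderiv k F)"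
  shows "(2::'a) = 0" "\<exists>G B. vars_in {..n} G \<and> mpderiv 0 G = 0 \<and> skew_zero_diag_on {1..n} B \<and>
    nondegenerate_on {1..n} B \<and>
    F = mvar 0 * G + (\<Sum>i\<in>{1..n}. \<Sum>j\<in>{1..n}. mvar i ^ q * mconst (B i j) * mvar j)"
proof -
  have q2: "q \<ge> 2" using card_finite_field_gt_1[where 'a = 'a] by (simp add: q)
  have q0: "of_nat q = (0::'a)" using of_nat_card_eq_0[where 'a = 'a] by (simp add: q)
  obtain B where AB: "\<And>i j. i \<in> {1..n} \<Longrightarrow> j \<in> {1..n} \<Longrightarrow> (\<Sum>k\<in>{1..n}. A i k * B k j) = (if i = j then 1 else 0)"
    and BA: "\<And>i j. i \<in> {1..n} \<Longrightarrow> j \<in> {1..n} \<Longrightarrow> (\<Sum>k\<in>{1..n}. B i k * A k j) = (if i = j then 1 else 0)"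
    by (rule nondegenerate_inverse[OF finite_atLeastAtMost A(2)]) (rule that; assumption)
  have B: "skew_zero_diag_on {1..n} B"
    by (rule inverse_skew_zero_diag[OF finite_atLeastAtMost A(1) AB])
  define L where "L i = (\<Sum>j\<in>{1..n}. mconst (B i j) * mvar j)" for i
  define S where "S i = (\<Sum>j\<in>{1..n}. mconst (B i j) * mvar j ^ q)" for i
  have P: "mpderiv i F = S i - mvar 0 ^ (q - 1) * L i" if i: "i \<in> {1..n}" for i
  proof -
    have "mpderiv i F = (\<Sum>j\<in>{1..n}. mconst (B i j) * (mvar j ^ q - mvar 0 ^ (q - 1) * mvar j))"
      by (rule solve_linear_relation[OF finite_atLeastAtMost z BA i]) auto
    thus ?thesis by (simp add: S_def L_def sum_distrib_left right_diff_distrib sum_subtractf mult_ac)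
  qed
  define G where "G = mpderiv 0 F"
  have G: "vars_in {..n} G" unfolding G_def by (rule vars_in_mpderiv[OF F(1)])
  have one: "of_nat (q + 1) = (1 :: 'a mpoly)"
    using q0 by (metis add_0 mconst_1 mconst_of_nat of_nat_1 of_nat_add)
  have "F = of_nat (q + 1) * F" unfolding one by simp
  also have "\<dots> = (\<Sum>i\<le>n. mvar i * mpderiv i F)"
    by (rule euler_identity[OF F finite_atMost, symmetric])
  also have "{..n} = insert 0 {1..n}" by auto
  also have "(\<Sum>i\<in>insert 0 {1..n}. mvar i * mpderiv i F)
      = mvar 0 * G + (\<Sum>i\<in>{1..n}. mvar i * (S i - mvar 0 ^ (q - 1) * L i))"
    using P by (simp add: G_def)
  also have "(\<Sum>i\<in>{1..n}. mvar i * (S i - mvar 0 ^ (q - 1) * L i))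
      = (\<Sum>i\<in>{1..n}. mvar i * S i) - mvar 0 ^ (q - 1) * (\<Sum>i\<in>{1..n}. \<Sum>j\<in>{1..n}. mvar i * mconst (B i j) * mvar j)"
    by (simp add: L_def sum_distrib_left right_diff_distrib sum_subtractf mult_ac)
  also have "\<dots> = (\<Sum>i\<in>{1..n}. mvar i * S i)"
    unfolding sum_alternating_mconst[OF finite_atLeastAtMost B] by simp
  finally have FS: "F = mvar 0 * G + (\<Sum>i\<in>{1..n}. mvar i * S i)" .
  have dS: "mpderiv k (S i) = 0" for k i
    by (simp add: S_def mpderiv_sum mpderiv_mconst_mult mpderiv_power_card q)
  have "G = mpderiv 0 F" by (simp add: G_def)
  also have "\<dots> = G + mvar 0 * mpderiv 0 G + (\<Sum>i\<in>{1..n}. mpderiv 0 (mvar i) * S i)"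
    by (subst FS) (simp add: mpderiv_add mpderiv_mult mpderiv_sum dS mpderiv_mvar)
  also have "(\<Sum>i\<in>{1..n}. mpderiv 0 (mvar i) * S i) = 0"
    by (intro sum.neutral) (auto simp: mpderiv_mvar)
  finally have dG: "mpderiv 0 G = 0" by simp
  have F': "F = mvar 0 * G + (\<Sum>i\<in>{1..n}. \<Sum>j\<in>{1..n}. mvar i ^ q * mconst (B j i) * mvar j)"
    by (subst FS, subst sum.swap) (simp add: S_def sum_distrib_left mult_ac)
  have "nondegenerate_on {1..n} (\<lambda>i j. B j i)"
    by (rule nondegenerate_if_left_inverse[where B = "\<lambda>i j. A j i"])
      (use BA in \<open>auto simp: mult.commute\<close>)
  thus "\<exists>G B. vars_in {..n} G \<and> mpderiv 0 G = 0 \<and> skew_zero_diag_on {1..n} B \<and>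
      nondegenerate_on {1..n} B \<and>
      F = mvar 0 * G + (\<Sum>i\<in>{1..n}. \<Sum>j\<in>{1..n}. mvar i ^ q * mconst (B i j) * mvar j)"
    using F' G dG skew_zero_diag_transpose[OF B]
    by (intro exI[of _ G] exI[of _ "\<lambda>i j. B j i"]) simp
  \<comment> \<open>Comparing both expressions for \<open>mpderiv i F\<close> gives
    \<open>x_0 G_i = - x_0^(q-1) L_i\<close>, where \<open>G_i\<close> is the \<open>i\<close>-th
    partial of \<open>G\<close>. Differentiating by \<open>x_0\<close>, with
    \<open>q - 1 = -1\<close> in the field, gives \<open>x_0 G_i = x_0^(q-1) L_i\<close>. So
    \<open>2 L_i = 0\<close>, while invertibility of \<open>B\<close> forbids that all
    \<open>L_i\<close> vanish.\<close>
  show "(2::'a) = 0"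
  proof (rule ccontr)
    assume two: "(2::'a) \<noteq> 0"
    have "L i = 0" if i: "i \<in> {1..n}" for i
    proof -
      have "S i - mvar 0 ^ (q - 1) * L i = mpderiv i F" by (rule P[OF i, symmetric])
      also have "\<dots> = mvar 0 * mpderiv i G + (\<Sum>k\<in>{1..n}. if k = i then S k else 0)"
        proof -
        have "mpderiv i F = mpderiv i (mvar 0 * G) + (\<Sum>k\<in>{1..n}. mpderiv i (mvar k * S k))"
          by (subst FS) (simp add: mpderiv_add mpderiv_sum)
        also have "(\<Sum>k\<in>{1..n}. mpderiv i (mvar k * S k)) = (\<Sum>k\<in>{1..n}. if k = i then S k else 0)"
          by (intro sum.cong) (auto simp: mpderiv_mult dS mpderiv_mvar)
        also have "mpderiv i (mvar 0 * G) = mvar 0 * mpderiv i G"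
          using i by (simp add: mpderiv_mult mpderiv_mvar)
        finally show ?thesis .
      qed
      finally have iG: "mvar 0 * mpderiv i G = - (mvar 0 ^ (q - 1) * L i)" using i by simp
      have dL: "mpderiv 0 (L i) = 0"
        unfolding L_def mpderiv_sum by (intro sum.neutral) (auto simp: mpderiv_mconst_mult mpderiv_mvar)
      have "mpderiv i G = mpderiv 0 (mvar 0 * mpderiv i G)"
        using dG mpderiv_commute[of 0 i G] by (simp add: mpderiv_mult mpderiv_mvar)
      also have "\<dots> = - (of_nat (q - 1) * mvar 0 ^ (q - 2) * L i)"
        unfolding iG by (simp add: mpderiv_uminus mpderiv_mult dL mpderiv_power mpderiv_mvar numeral_2_eq_2)
      also have "of_nat (q - 1) = (- 1 :: 'a mpoly)"
      proof -
        have "of_nat (q - 1) = (- 1 :: 'a)" using q0 q2 by (simp add: of_nat_diff)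
        hence "mconst (of_nat (q - 1)) = (mconst (- 1) :: 'a mpoly)" by (simp only:)
        thus ?thesis by (simp add: mconst_of_nat mconst_uminus)
      qed
      finally have "mvar 0 * mpderiv i G = mvar 0 * mvar 0 ^ (q - 2) * L i" by (simp add: mult.assoc)
      also have "mvar 0 * mvar 0 ^ (q - 2) = (mvar 0 ^ (q - 1) :: 'a mpoly)"
      proof -
        have "q - 1 = Suc (q - 2)" using q2 by simp
        thus ?thesis by simp
      qed
      finally have "mvar 0 ^ (q - 1) * L i = - (mvar 0 ^ (q - 1) * L i)" using iG by simp
      hence "mconst (1 + 1) * (mvar 0 ^ (q - 1) * L i) = 0"
        by (simp only: mconst_add mconst_1 ring_distribs mult_1 eq_neg_iff_add_eq_0)
      thus "L i = 0" using two by simp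
    qed
    hence "B i j = 0" if "i \<in> {1..n}" "j \<in> {1..n}" for i j
    proof -
      have "0 = mpderiv j (L i)" using \<open>\<And>i. i \<in> {1..n} \<Longrightarrow> L i = 0\<close> that by simp
      also have "\<dots> = (\<Sum>k\<in>{1..n}. if k = j then mconst (B i k) else 0)"
        unfolding L_def mpderiv_sum by (intro sum.cong) (auto simp: mpderiv_mconst_mult mpderiv_mvar)
      finally show ?thesis using that by simp
    qed
    hence "(\<Sum>k\<in>{1..n}. A 1 k * B k 1) = 0" using n by (intro sum.neutral) auto
    thus False using AB[of 1 1] n by simp
  qed
qed

context smooth_fnc_hypersurface
begin

text \<open>In coordinates where the kernel form is \<open>mvar 0\<close>, the transformed matrix
  has zero row and column 0. The block on \<open>{1..n}\<close> is nondegenerate, which forces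
  \<open>n\<close> even and feeds the normal form.\<close>

lemma degenerate_case:
  assumes dq: "d = q + 1" and A: "skew_zero_diag_on {..n} A" "\<not> nondegenerate_on {..n} A"
    and z: "\<And>i. i \<le> n \<Longrightarrow> mvar i ^ q - H * mvar i = (\<Sum>j\<le>n. mconst (A i j) * P j)"
  shows "even n" "(2::'a) = 0" "H \<noteq> 0"
    "\<exists>M. nondegenerate_on {..n} M \<and>
       F10 q n (lin_change n M F) = mvar 0 ^ (q - 1) * lin_change n M F \<and>
       (\<exists>G B. vars_in {..n} G \<and> mpderiv 0 G = 0 \<and> skew_zero_diag_on {1..n} B \<and> nondegenerate_on {1..n} B \<and>
          lin_change n M F = mvar 0 * G + (\<Sum>i\<in>{1..n}. \<Sum>j\<in>{1..n}. mvar i ^ q * mconst (B i j) * mvar j))"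
proof -
  obtain v k where v: "\<And>i. i \<le> n \<Longrightarrow> (\<Sum>j\<le>n. A i j * v j) = 0" and k: "k \<le> n" "v k \<noteq> 0"
    using A(2) unfolding nondegenerate_on_def by auto
  have H: "H = (\<Sum>i\<le>n. mconst (v i) * mvar i) ^ (q - 1)" and H0: "H \<noteq> 0"
    using degenerate_linear_form[OF dq A(1) z v k] by auto
  obtain M where M: "nondegenerate_on {..n} M"
    and vM: "\<And>j. j \<le> n \<Longrightarrow> (\<Sum>i\<le>n. v i * M i j) = (if j = 0 then 1 else 0)"
    by (rule complete_to_coordinates[of k n v, OF k]) (rule that; assumption)
  obtain N where MN: "\<And>i j. i \<in> {..n} \<Longrightarrow> j \<in> {..n} \<Longrightarrow> (\<Sum>k\<le>n. M i k * N k j) = (if i = j then 1 else 0)"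
    and NM: "\<And>i j. i \<in> {..n} \<Longrightarrow> j \<in> {..n} \<Longrightarrow> (\<Sum>k\<le>n. N i k * M k j) = (if i = j then 1 else 0)"
    by (rule nondegenerate_inverse[OF finite_atMost M]) (rule that; assumption)
  let ?L = "lin_change n M"
  have L_simps: "?L (F + G) = ?L F + ?L G" "?L (F * G) = ?L F * ?L G" "?L (F - G) = ?L F - ?L G"
    "?L (F ^ e) = ?L F ^ e" "?L (mconst c) = mconst c" for F G e c
    by (simp_all add: lin_change_def msubst_simps)
  have L_sum: "?L (\<Sum>i\<in>I. f i) = (\<Sum>i\<in>I. ?L (f i))" for I :: "nat set" and f
    by (simp add: lin_change_def msubst_simps)
  have L_mvar: "?L (mvar i) = (\<Sum>j\<le>n. mconst (M i j) * mvar j)" for i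
    by (simp add: lin_change_def)
  define F' where "F' = ?L F"
  have LH: "?L H = mvar 0 ^ (q - 1)"
  proof -
    have "?L (\<Sum>i\<le>n. mconst (v i) * mvar i) = (\<Sum>i\<le>n. \<Sum>j\<le>n. mconst (v i * M i j) * mvar j)"
      by (simp add: L_sum L_simps L_mvar sum_distrib_left mconst_mult mult.assoc)
    also have "\<dots> = (\<Sum>j\<le>n. mconst (\<Sum>i\<le>n. v i * M i j) * mvar j)"
      by (subst sum.swap) (simp add: mconst_sum sum_distrib_right)
    also have "\<dots> = (\<Sum>j\<le>n. if j = 0 then mvar j else 0)"
      using vM by (intro sum.cong) auto
    finally show ?thesis unfolding H L_simps by simp
  qed
  have F10': "F10 q n F' = mvar 0 ^ (q - 1) * F'"
    unfolding F'_def q_def F10_lin_change[OF Fvars] using F10 LH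
    by (simp add: L_simps q_def mult.commute)
  have F': "vars_in {..n} F'" "homogeneous (q + 1) F'"
    unfolding F'_def using lin_change_vars_in[OF Fvars] lin_change_homogeneous[OF Fhom] dq by auto
  define z' :: "nat \<Rightarrow> 'a mpoly" where "z' l = mvar l ^ q - mvar 0 ^ (q - 1) * mvar l" for l
  have Mz: "?L (mvar i ^ q - H * mvar i) = (\<Sum>l\<le>n. mconst (M i l) * z' l)" for i
    unfolding L_simps L_mvar LH q_def linear_form_power_card
    by (simp add: z'_def q_def sum_distrib_left right_diff_distrib sum_subtractf mult_ac)
  have z'_eq: "z' l = (\<Sum>i\<le>n. mconst (N l i) * ?L (mvar i ^ q - H * mvar i))" if "l \<le> n" for l
    by (rule solve_linear_relation[OF finite_atMost _ NM]) (use Mz that in auto)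
  have Q: "?L (P j) = (\<Sum>k\<le>n. mconst (N k j) * mpderiv k F')" if "j \<le> n" for j
  proof (rule solve_linear_relation[OF finite_atMost, where A = "\<lambda>k j. M j k" and B = "\<lambda>j k. N k j"])
    show "mpderiv k F' = (\<Sum>j\<le>n. mconst (M j k) * ?L (P j))" if "k \<in> {..n}" for k
      using mpderiv_lin_change[OF Fvars, of k M] that by (simp add: F'_def mult.commute)
    show "(\<Sum>k\<le>n. N k i * M j k) = (if i = j then 1 else 0)" if "i \<in> {..n}" "j \<in> {..n}" for i j
      using MN[OF that(2,1)] by (simp add: mult.commute eq_commute)
  qed (use that in simp)
  \<comment> \<open>The left-hand sides transform by \<open>N\<close> and the gradient by the
    transpose of \<open>M\<close>, so \<open>A\<close> turns into the congruent matrix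
    \<open>N A N^T\<close>.\<close>
  define A' where "A' l k = (\<Sum>i\<le>n. \<Sum>j\<le>n. N l i * A i j * N k j)" for l k
  have z'A: "z' l = (\<Sum>k\<le>n. mconst (A' l k) * mpderiv k F')" if l: "l \<le> n" for l
  proof -
    have "z' l = (\<Sum>i\<le>n. mconst (N l i) * (\<Sum>j\<le>n. mconst (A i j) * (\<Sum>k\<le>n. mconst (N k j) * mpderiv k F')))"
      unfolding z'_eq[OF l]
    proof (intro sum.cong refl)
      fix i assume "i \<in> {..n}"
      hence "?L (mvar i ^ q - H * mvar i) = (\<Sum>j\<le>n. mconst (A i j) * ?L (P j))"
        using z by (simp add: L_sum L_simps)
      also have "\<dots> = (\<Sum>j\<le>n. mconst (A i j) * (\<Sum>k\<le>n. mconst (N k j) * mpderiv k F'))"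
        using Q by (intro sum.cong) auto
      finally show "mconst (N l i) * ?L (mvar i ^ q - H * mvar i)
          = mconst (N l i) * (\<Sum>j\<le>n. mconst (A i j) * (\<Sum>k\<le>n. mconst (N k j) * mpderiv k F'))" by simp
    qed
    also have "\<dots> = (\<Sum>i\<le>n. \<Sum>j\<le>n. \<Sum>k\<le>n. mconst (N l i * A i j * N k j) * mpderiv k F')"
      by (simp add: sum_distrib_left mconst_mult mult.assoc)
    also have "\<dots> = (\<Sum>i\<le>n. \<Sum>k\<le>n. \<Sum>j\<le>n. mconst (N l i * A i j * N k j) * mpderiv k F')"
      by (intro sum.cong refl sum.swap)
    also have "\<dots> = (\<Sum>k\<le>n. \<Sum>i\<le>n. \<Sum>j\<le>n. mconst (N l i * A i j * N k j) * mpderiv k F')"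
      by (rule sum.swap)
    also have "\<dots> = (\<Sum>k\<le>n. mconst (A' l k) * mpderiv k F')"
      by (simp add: A'_def mconst_sum sum_distrib_right)
    finally show ?thesis .
  qed
  \<comment> \<open>\<open>v M\<close> is the unit row of index 0, so \<open>v\<close> is that row
    of the inverse; as \<open>A v = 0\<close>, column 0 of \<open>A'\<close> vanishes.\<close>
  have N0: "N 0 i = v i" if i: "i \<le> n" for i
  proof -
    have "(\<Sum>j\<le>n. (\<Sum>l\<le>n. v l * M l j) * N j i) = (\<Sum>l\<le>n. v l * (\<Sum>j\<le>n. M l j * N j i))"
      unfolding sum_distrib_left sum_distrib_right by (subst sum.swap) (simp add: mult.assoc)
    also have "\<dots> = (\<Sum>l\<le>n. if l = i then v l else 0)" using MN i by (intro sum.cong) auto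
    also have "\<dots> = v i" using i by simp
    also have "(\<Sum>j\<le>n. (\<Sum>l\<le>n. v l * M l j) * N j i) = (\<Sum>j\<le>n. if j = 0 then N j i else 0)"
      using vM by (intro sum.cong) auto
    finally show ?thesis by simp
  qed
  have A'_skew: "A' k l = - A' l k" for k l
  proof -
    have "A' k l = (\<Sum>i\<le>n. \<Sum>j\<le>n. - (N l j * A j i * N k i))"
      unfolding A'_def
    proof (intro sum.cong refl)
      fix i j assume "i \<in> {..n}" "j \<in> {..n}"
      hence "A i j = - A j i" using skew_zero_diag_onD(2)[OF A(1)] by blast
      thus "N k i * A i j * N l j = - (N l j * A j i * N k i)" by simp
    qed
    also have "\<dots> = - A' l k" unfolding A'_def sum_negf by (subst sum.swap) simp
    finally show ?thesis .
  qed
  have A'_diag: "A' l l = 0" for l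
    unfolding A'_def
    by (rule sum_alternating_form_eq_0[OF finite_atMost skew_zero_diag_onD(1)[OF A(1)] skew_zero_diag_onD(2)[OF A(1)]])
  have A'_0: "A' l 0 = 0" for l
  proof -
    have "A' l 0 = (\<Sum>i\<le>n. N l i * (\<Sum>j\<le>n. A i j * v j))"
      unfolding A'_def using N0 by (simp add: sum_distrib_left mult.assoc)
    also have "\<dots> = 0" using v by simp
    finally show ?thesis .
  qed
  have z'': "z' l = (\<Sum>k\<in>{1..n}. mconst (A' l k) * mpderiv k F')" if "l \<in> {1..n}" for l
  proof -
    have "{..n} = insert 0 {1..n}" by auto
    thus ?thesis using z'A[of l] that A'_0[of l] by simp
  qed
  have skew': "skew_zero_diag_on {1..n} A'"
    unfolding skew_zero_diag_on_def using A'_skew A'_diag by blast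
  \<comment> \<open>A kernel vector \<open>u\<close> would give a linear relation among the
    \<open>z' l\<close>, but for \<open>l \<ge> 1\<close> the monomial \<open>x_l^q\<close> occurs
    in \<open>z' l\<close> alone.\<close>
  have nondeg': "nondegenerate_on {1..n} A'"
    unfolding nondegenerate_on_def
  proof (intro allI impI ballI)
    fix u j assume u: "\<forall>i\<in>{1..n}. (\<Sum>j\<in>{1..n}. A' i j * u j) = 0" and j: "j \<in> {1..n}"
    have "(\<Sum>l\<in>{1..n}. mconst (u l) * z' l)
        = (\<Sum>l\<in>{1..n}. \<Sum>k\<in>{1..n}. mconst (u l * A' l k) * mpderiv k F')"
      using z'' by (intro sum.cong refl) (simp add: sum_distrib_left mconst_mult mult.assoc)
    also have "\<dots> = (\<Sum>k\<in>{1..n}. mconst (\<Sum>l\<in>{1..n}. u l * A' l k) * mpderiv k F')"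
      by (subst sum.swap) (simp add: mconst_sum sum_distrib_right)
    also have "\<dots> = 0"
    proof (intro sum.neutral ballI)
      fix k assume k: "k \<in> {1..n}"
      have "(\<Sum>l\<in>{1..n}. u l * A' l k) = - (\<Sum>l\<in>{1..n}. A' k l * u l)"
        unfolding sum_negf[symmetric]
      proof (intro sum.cong refl)
        fix l show "u l * A' l k = - (A' k l * u l)" using A'_skew[of l k] by simp
      qed
      thus "mconst (\<Sum>l\<in>{1..n}. u l * A' l k) * mpderiv k F' = 0" using u k by simp
    qed
    finally have "0 = lookup (\<Sum>l\<in>{1..n}. mconst (u l) * z' l) (single j q)" by simp
    also have "\<dots> = (\<Sum>l\<in>{1..n}. if l = j then u l else 0)"
      unfolding lookup_sum
    proof (intro sum.cong refl)
      fix l assume l: "l \<in> {1..n}"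
      have "single l q = single j q \<longleftrightarrow> l = j"
        using q2 by (metis lookup_single_eq lookup_single_not_eq not_numeral_le_zero)
      moreover have "lookup (mvar 0 ^ (q - 1) * mvar l) (single j q) = (0::'a)"
      proof -
        have "mvar 0 ^ (q - 1) * mvar l = (mvar 0 * (mvar 0 ^ (q - 2) * mvar l) :: 'a mpoly)"
        proof -
          have "q - 1 = Suc (q - 2)" using q2 by simp
          thus ?thesis by (simp add: mult.assoc)
        qed
        moreover have "lookup (single j q) 0 = 0" using j by (simp add: lookup_single when_def)
        ultimately show ?thesis by (simp only: lookup_mvar_mult_eq_0)
      qed
      ultimately show "lookup (mconst (u l) * z' l) (single j q) = (if l = j then u l else 0)"
        by (simp add: z'_def lookup_minus mvar_power[of l q] lookup_single when_def)
    qed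
    finally show "u j = 0" using j by simp
  qed
  note z_final = z''[unfolded z'_def]
  show "even n" using alternating_nondegenerate_even[OF _ skew' nondeg'] by simp
  have n1: "n \<ge> 1" using n2 by simp
  show "(2::'a) = 0" by (rule even_dimension_normal_form(1)[OF q_def n1 F' skew' nondeg' z_final])
  show "H \<noteq> 0" by (rule H0)
  show "\<exists>M. nondegenerate_on {..n} M \<and>
       F10 q n (lin_change n M F) = mvar 0 ^ (q - 1) * lin_change n M F \<and>
       (\<exists>G B. vars_in {..n} G \<and> mpderiv 0 G = 0 \<and> skew_zero_diag_on {1..n} B \<and> nondegenerate_on {1..n} B \<and>
          lin_change n M F = mvar 0 * G + (\<Sum>i\<in>{1..n}. \<Sum>j\<in>{1..n}. mvar i ^ q * mconst (B i j) * mvar j))"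
    using M F10' even_dimension_normal_form(2)[OF q_def n1 F' skew' nondeg' z_final]
    unfolding F'_def by (intro exI[of _ M]) simp
qed

end

section \<open>Assembly of the equivalences\<close>

lemma nondegenerate_nonzero_entry:
  fixes A :: "nat \<Rightarrow> nat \<Rightarrow> 'a::field"
  assumes "nondegenerate_on I A" "i \<in> I"
  shows "\<exists>k\<in>I. \<exists>l\<in>I. A k l \<noteq> 0"
proof (rule ccontr)
  assume no: "\<not> ?thesis"
  have "(\<Sum>j\<in>I. A k j * 1) = 0" if "k \<in> I" for k
    using no that by (intro sum.neutral) auto
  from assms(1)[unfolded nondegenerate_on_def, rule_format, of "\<lambda>_. 1", OF this assms(2)] show False by simp
qed

lemma CHAR_eq_2_iff: "CHAR('a::field) = 2 \<longleftrightarrow> (2::'a) = 0"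
proof
  assume "CHAR('a) = 2"
  thus "(2::'a) = 0" using of_nat_CHAR[where 'a = 'a] by simp
next
  assume "(2::'a) = 0"
  hence "of_nat 2 = (0::'a)" by simp
  hence dvd: "CHAR('a) dvd 2" by (simp only: of_nat_eq_0_iff_char_dvd)
  hence "CHAR('a) \<le> 2" by (rule dvd_imp_le) simp
  moreover have "CHAR('a) \<noteq> 0" using dvd by (metis dvd_0_left_iff zero_neq_numeral)
  moreover have "CHAR('a) \<noteq> 1" using of_nat_CHAR[where 'a = 'a] by (metis of_nat_1 zero_neq_one)
  ultimately show "CHAR('a) = 2" by linarith
qed

context smooth_fnc_hypersurface
begin

lemma degree_le: "d \<le> q + 2"
  using degree_le_if_char_not_dvd char_dvd_form by (cases "of_nat d = (0::'a)"; cases "q + 2 \<le> d") auto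

lemma odd_form_iff:
  "d = q + 1 \<and> odd n \<longleftrightarrow> (\<exists>A. skew_zero_diag_on {..n} A \<and> nondegenerate_on {..n} A \<and>
     F = (\<Sum>i\<le>n. \<Sum>j\<le>n. mvar i ^ q * mconst (A i j) * mvar j))"
proof
  assume *: "d = q + 1 \<and> odd n"
  then obtain A where A: "skew_zero_diag_on {..n} A"
    "\<And>i. i \<le> n \<Longrightarrow> mvar i ^ q - H * mvar i = (\<Sum>j\<le>n. mconst (A i j) * P j)"
    using top_degree_relation by blast
  have "nondegenerate_on {..n} A" using degenerate_case(1)[OF _ A(1) _ A(2)] * by blast
  thus "\<exists>A. skew_zero_diag_on {..n} A \<and> nondegenerate_on {..n} A \<and>
      F = (\<Sum>i\<le>n. \<Sum>j\<le>n. mvar i ^ q * mconst (A i j) * mvar j)"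
    using nondegenerate_case(2)[OF _ A(1) _ A(2)] * by blast
next
  assume "\<exists>A. skew_zero_diag_on {..n} A \<and> nondegenerate_on {..n} A \<and>
     F = (\<Sum>i\<le>n. \<Sum>j\<le>n. mvar i ^ q * mconst (A i j) * mvar j)"
  then obtain A where A: "skew_zero_diag_on {..n} A" "nondegenerate_on {..n} A"
    and F: "F = (\<Sum>i\<le>n. \<Sum>j\<le>n. mvar i ^ q * mconst (A i j) * mvar j)" by blast
  obtain k l where kl: "k \<in> {..n}" "l \<in> {..n}" "A k l \<noteq> 0"
    using nondegenerate_nonzero_entry[OF A(2), of 0] by auto
  \<comment> \<open>A nonzero entry of \<open>A\<close> exhibits a monomial of degree
    \<open>q + 1\<close> in \<open>F\<close>.\<close>
  have "lookup F (single k q + single l 1) = A k l"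
    unfolding F by (rule lookup_frobenius_form[OF finite_atMost q2 kl(1,2)])
  hence "single k q + single l 1 \<in> keys F" using kl(3) by (simp add: in_keys_iff)
  hence "d = q + 1" using Fhom by (auto simp: homogeneous_iff mdeg_add)
  thus "d = q + 1 \<and> odd n" using alternating_nondegenerate_even[OF _ A] by simp
qed

lemma even_form_iff:
  "d = q + 1 \<and> even n \<longleftrightarrow> (2::'a) = 0 \<and> (\<exists>M. nondegenerate_on {..n} M \<and>
     F10 q n (lin_change n M F) = mvar 0 ^ (q - 1) * lin_change n M F \<and>
     (\<exists>G B. vars_in {..n} G \<and> mpderiv 0 G = 0 \<and> skew_zero_diag_on {1..n} B \<and> nondegenerate_on {1..n} B \<and>
        lin_change n M F = mvar 0 * G + (\<Sum>i\<in>{1..n}. \<Sum>j\<in>{1..n}. mvar i ^ q * mconst (B i j) * mvar j)))"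
  (is "_ \<longleftrightarrow> _ \<and> (\<exists>M. ?form M)")
proof
  assume *: "d = q + 1 \<and> even n"
  then obtain A where A: "skew_zero_diag_on {..n} A"
    "\<And>i. i \<le> n \<Longrightarrow> mvar i ^ q - H * mvar i = (\<Sum>j\<le>n. mconst (A i j) * P j)"
    using top_degree_relation by blast
  have "\<not> nondegenerate_on {..n} A" using nondegenerate_case(1)[OF _ A(1) _ A(2)] * by blast
  thus "(2::'a) = 0 \<and> (\<exists>M. ?form M)"
    using degenerate_case(2,4)[OF _ A(1) _ A(2)] * by blast
next
  assume "(2::'a) = 0 \<and> (\<exists>M. ?form M)"
  then obtain M G B where B: "skew_zero_diag_on {1..n} B" "nondegenerate_on {1..n} B"
    and F': "lin_change n M F = mvar 0 * G + (\<Sum>i\<in>{1..n}. \<Sum>j\<in>{1..n}. mvar i ^ q * mconst (B i j) * mvar j)"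
    by blast
  obtain k l where kl: "k \<in> {1..n}" "l \<in> {1..n}" "B k l \<noteq> 0"
    using nondegenerate_nonzero_entry[OF B(2), of 1] n2 by auto
  \<comment> \<open>This monomial does not involve \<open>mvar 0\<close>, so
    \<open>mvar 0 * G\<close> cannot cancel it and it reveals the degree.\<close>
  have "lookup (single k q + single l (1::nat)) 0 = 0"
    using kl by (simp add: lookup_add lookup_single when_def)
  hence "lookup (mvar 0 * G) (single k q + single l 1) = 0" by (rule lookup_mvar_mult_eq_0)
  hence "lookup (lin_change n M F) (single k q + single l 1) = B k l"
    unfolding F' lookup_add lookup_frobenius_form[OF finite_atLeastAtMost q2 kl(1,2)]
    by (simp only: add_0)
  hence "single k q + single l 1 \<in> keys (lin_change n M F)" using kl(3) by (simp add: in_keys_iff)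
  hence "d = q + 1" using lin_change_homogeneous[OF Fhom, of n M] by (auto simp: homogeneous_iff mdeg_add)
  thus "d = q + 1 \<and> even n" using alternating_nondegenerate_even[OF _ B] by simp
qed

lemma plane_curve_form_iff:
  "d = q + 2 \<longleftrightarrow> (2::'a) = 0 \<and> n = 2 \<and> (\<exists>c G. c \<noteq> 0 \<and> vars_in {..2} G \<and>
     mconst c * F = cubic_part q + msubst (\<lambda>i. mvar i ^ 2) G)"
proof
  assume dq: "d = q + 2"
  hence "of_nat d = (0::'a)" using degree_le_if_char_not_dvd by fastforce
  thus "(2::'a) = 0 \<and> n = 2 \<and> (\<exists>c G. c \<noteq> 0 \<and> vars_in {..2} G \<and>
     mconst c * F = cubic_part q + msubst (\<lambda>i. mvar i ^ 2) G)"
    using char_dvd_form dq by simp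
qed (use char_dvd_form_converse(1) in blast)

lemma F10_eq_0_iff: "(d = q + 1 \<and> odd n) \<or> d = q + 2 \<longleftrightarrow> F10 q n F = 0"
proof
  assume "(d = q + 1 \<and> odd n) \<or> d = q + 2"
  thus "F10 q n F = 0"
  proof
    assume "d = q + 1 \<and> odd n"
    then obtain A where "skew_zero_diag_on {..n} A"
      and F: "F = (\<Sum>i\<le>n. \<Sum>j\<le>n. mvar i ^ q * mconst (A i j) * mvar j)"
      using odd_form_iff by blast
    thus ?thesis using frobenius_form_F10[of n A] unfolding q_def by simp
  next
    assume "d = q + 2"
    thus ?thesis using plane_curve_form_iff char_dvd_form_converse(2) by blast
  qed
next
  assume "F10 q n F = 0"
  hence H: "H = 0" using F10 Fnz by simp
  show "(d = q + 1 \<and> odd n) \<or> d = q + 2"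
  proof (cases "of_nat d = (0::'a)")
    case True
    thus ?thesis using degree_ge_if_H_0(2)[OF H] degree_le by simp
  next
    case False
    hence dq: "d = q + 1" using degree_ge_if_H_0(1)[OF H] degree_le_if_char_not_dvd by simp
    then obtain A where A: "skew_zero_diag_on {..n} A"
      "\<And>i. i \<le> n \<Longrightarrow> mvar i ^ q - H * mvar i = (\<Sum>j\<le>n. mconst (A i j) * P j)"
      using top_degree_relation by blast
    \<comment> \<open>In the degenerate case \<open>H\<close> is a power of a nonzero linear form,
      contrary to \<open>H = 0\<close>.\<close>
    have "nondegenerate_on {..n} A" using degenerate_case(3)[OF dq A(1) _ A(2)] H by blast
    thus ?thesis using nondegenerate_case(1)[OF dq A(1) _ A(2)] dq by blast
  qed
qed

end

theorem theorem1p6: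
  fixes F :: "'a::{field,finite} mpoly" and n d q p :: nat
  assumes q_def: "q = CARD('a)"
    and p_def: "p = CHAR('a)"
    and n2: "n \<ge> 2"
    and Fvars: "in_vars n F"
    and Fnz: "F \<noteq> 0"
    and Fhom: "homogeneous d F"
    and d2: "d \<ge> 2"
    and smooth: "smooth_hypersurface n F"
    and fnc: "frobenius_nonclassical q n F"
  shows "d \<le> q + 2
    \<and> ((d = q + 1 \<and> odd n) \<longleftrightarrow>
         (\<exists>A. skew_zero_diag_on {..n} A \<and> nondegenerate_on {..n} A \<and>
              F = (\<Sum>i\<le>n. \<Sum>j\<le>n. mvar i ^ q * mconst (A i j) * mvar j)))
    \<and> ((d = q + 1 \<and> even n) \<longleftrightarrow>
         (p = 2 \<and>
          (\<exists>M. nondegenerate_on {..n} M \<and>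
             F10 q n (lin_change n M F) = mvar 0 ^ (q - 1) * lin_change n M F \<and>
             (\<exists>G B. in_vars n G \<and> mpderiv 0 G = 0 \<and>
                skew_zero_diag_on {1..n} B \<and> nondegenerate_on {1..n} B \<and>
                lin_change n M F = mvar 0 * G +
                  (\<Sum>i\<in>{1..n}. \<Sum>j\<in>{1..n}. mvar i ^ q * mconst (B i j) * mvar j)))))
    \<and> (d = q + 2 \<longleftrightarrow>
         (p = 2 \<and> n = 2 \<and>
          (\<exists>c G. c \<noteq> 0 \<and> in_vars 2 G \<and>
             mconst c * F = mvar 0 * mvar 1 * mvar 2 *
                 (mvar 0 ^ (q - 1) + mvar 1 ^ (q - 1) + mvar 2 ^ (q - 1))
               + msubst (\<lambda>i. mvar i ^ 2) G)))
    \<and> (((d = q + 1 \<and> odd n) \<or> d = q + 2) \<longleftrightarrow> F10 q n F = 0)"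
proof -
  obtain H where H: "F10 q n F = F * H"
    using fnc unfolding frobenius_nonclassical_def by (elim dvdE)
  interpret smooth_fnc_hypersurface F H n d q
    by unfold_locales (use assms H in \<open>simp_all add: in_vars_iff\<close>)
  have p: "p = 2 \<longleftrightarrow> (2::'a) = 0" unfolding p_def by (rule CHAR_eq_2_iff)
  show ?thesis
    unfolding p in_vars_iff
    by (intro conjI degree_le odd_form_iff even_form_iff F10_eq_0_iff
        plane_curve_form_iff[unfolded cubic_part_def])
qed

end
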